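(* Let $1\le r\le\infty$, $r'=r/(r-1)$, let $\mathcal G=(V,E)$ be a connected simple graph with Beurling dimension $d$ and normal counting measure $\mu$, and let $\alpha>d/r'$. Then there exists a constant $C>0$, independent of $A$, such that for every $A\in\mathcal B_{r,\alpha}(\mathcal G)$ that is invertible in $\mathcal B(\ell^2)$, $$\|A^{-1}\|_{\mathcal B_{r,\alpha}}\le C\,\|A^{-1}\|_{\mathcal B(\ell^2)}\big(\|A^{-1}\|_{\mathcal B(\ell^2)}\|A\|_{\mathcal B_{r,\alpha}}\big)^{(\alpha+d/r)/\min(\alpha-d/r',1)}\times L(A),$$ where $L(A)=1$ if $\alpha\ne1+d/r'$, and $L(A)=\big(\ln(\|A^{-1}\|_{\mathcal B(\ell^2)}\|A\|_{\mathcal B_{r,\alpha}}+1)\big)^{(d+1)/r'}$ if $\alpha=1+d/r'$.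
   Context: A simple graph is an unweighted, undirected graph without loops or multiple edges. For a connected simple graph $\mathcal G=(V,E)$, $\rho(\lambda,\lambda')$ is the geodesic distance on $V$ (number of edges in a shortest path), $B(\lambda,R)=\{\lambda'\in V:\rho(\lambda,\lambda')\le R\}$, and $\mu$ is the counting measure on $V$. It has polynomial growth if there are positive constants $D_1(\mathcal G)$ and $d$ with $\mu(B(\lambda,R))\le D_1(\mathcal G)(R+1)^d$ for all $\lambda\in V$, $R\ge0$; the minimal constants $d$ and $D_1(\mathcal G)$ are called the Beurling dimension and density of $\mathcal G$. The counting measure is normal if there are positive constants $D_1(\mathcal G),D_2(\mathcal G)$ with $D_2(\mathcal G)(R+1)^d\le\mu(B(\lambda,R))\le D_1(\mathcal G)(R+1)^d$ for all $\lambda\in V$ and $0\le R\le\mathrm{diam}(\mathcal G)$. For a matrix $A=(a(\lambda,\lambda'))_{\lambda,\lambda'\in V}$ put $h_A(n)=\sup_{\rho(\lambda,\lambda')\ge n}|a(\lambda,\lambda')|$, $n\ge0$. For $1\le r\le\infty$, $\alpha\ge0$, $$\|A\|_{\mathcal B_{r,\alpha}}=\Big(\sum_{n=0}^\infty h_A(n)^r(n+1)^{\alpha r+d-1}\Big)^{1/r}\ (1\le r<\infty),\qquad \|A\|_{\mathcal B_{\infty,\alpha}}=\sup_{n\ge0}h_A(n)(n+1)^\alpha,$$ and $\mathcal B_{r,\alpha}(\mathcal G)$ is the set of all $A$ with $\|A\|_{\mathcal B_{r,\alpha}}<\infty$. $\mathcal B(\ell^2)$ is the algebra of bounded operators on $\ell^2=\ell^2(V)$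 with operator norm. Convention: $1/r'=0$ if $r=1$, $d/r=0$ and $r'=1$ if $r=\infty$. The constant $C$ may depend on $\mathcal G,r,\alpha$. *)

theory Defs
  imports "HOL-Analysis.Analysis"
begin

section \<open>Simple graphs\<close>

text \<open>The vertex set is the type of the vertices, which may be infinite; \<open>E\<close> is adjacency.\<close>

definition simple_graph :: "('v \<Rightarrow> 'v \<Rightarrow> bool) \<Rightarrow> bool" where
  "simple_graph E \<longleftrightarrow> symp E \<and> irreflp E"

definition connected_graph :: "('v \<Rightarrow> 'v \<Rightarrow> bool) \<Rightarrow> bool" where
  "connected_graph E \<longleftrightarrow> (\<forall>u v. E\<^sup>*\<^sup>* u v)"

definition geodesic_dist :: "('v \<Rightarrow> 'v \<Rightarrow> bool) \<Rightarrow> 'v \<Rightarrow> 'v \<Rightarrow> nat" where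
  "geodesic_dist E u v = (LEAST n. (E ^^ n) u v)"

definition graph_ball :: "('v \<Rightarrow> 'v \<Rightarrow> bool) \<Rightarrow> 'v \<Rightarrow> real \<Rightarrow> 'v set" where
  "graph_ball E u R = {v. real (geodesic_dist E u v) \<le> R}"

text \<open>Infinite when distances are unbounded.\<close>

definition graph_diam :: "('v \<Rightarrow> 'v \<Rightarrow> bool) \<Rightarrow> ereal" where
  "graph_diam E = (SUP (u, v) \<in> UNIV. ereal (real (geodesic_dist E u v)))"

text \<open>The counting measure takes values in \<^typ>\<open>ennreal\<close> because \<^const>\<open>card\<close> would give
  infinite balls the value \<open>0\<close>.\<close>

definition polynomial_growth_with :: "('v \<Rightarrow> 'v \<Rightarrow> bool) \<Rightarrow> real \<Rightarrow> bool" where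
  "polynomial_growth_with E d \<longleftrightarrow> (\<exists>D1>0. \<forall>u. \<forall>R\<ge>0.
     emeasure (count_space UNIV) (graph_ball E u R) \<le> ennreal (D1 * (R + 1) powr d))"

definition polynomial_growth :: "('v \<Rightarrow> 'v \<Rightarrow> bool) \<Rightarrow> bool" where
  "polynomial_growth E \<longleftrightarrow> (\<exists>d>0. polynomial_growth_with E d)"

text \<open>The minimal growth exponent, taken as an infimum so that finite graphs, for which every
  positive exponent is admissible, get dimension \<open>0\<close>. If the counting measure of an infinite
  graph is normal, the infimum is a minimum and positive.\<close>

definition beurling_dim :: "('v \<Rightarrow> 'v \<Rightarrow> bool) \<Rightarrow> real" where
  "beurling_dim E = Inf {d. 0 < d \<and> polynomial_growth_with E d}"

definition normal_counting_measure :: "('v \<Rightarrow> 'v \<Rightarrow> bool) \<Rightarrow> bool" where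
  "normal_counting_measure E \<longleftrightarrow> (\<exists>D1>0. \<exists>D2>0. \<forall>u. \<forall>R\<ge>0. ereal R \<le> graph_diam E \<longrightarrow>
     ennreal (D2 * (R + 1) powr beurling_dim E) \<le> emeasure (count_space UNIV) (graph_ball E u R) \<and>
     emeasure (count_space UNIV) (graph_ball E u R) \<le> ennreal (D1 * (R + 1) powr beurling_dim E))"


section \<open>The matrix classes\<close>

text \<open>Conjugate exponent \<open>r' = r / (r - 1)\<close> for \<open>1 \<le> r \<le> \<infinity>\<close>.\<close>

definition conj_exp :: "ereal \<Rightarrow> ereal" where
  "conj_exp r = (if r = 1 then \<infinity> else if r = \<infinity> then 1 else r / (r - 1))"

text \<open>The quotient \<open>x / p\<close> with the convention \<open>x / \<infinity> = 0\<close>.\<close>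

definition over_exp :: "real \<Rightarrow> ereal \<Rightarrow> real" where
  "over_exp x p = (if p = \<infinity> then 0 else x / real_of_ereal p)"

text \<open>Powers of extended nonnegative reals; only used for exponents \<open>p > 0\<close>.\<close>

definition ennreal_powr :: "ennreal \<Rightarrow> real \<Rightarrow> ennreal" where
  "ennreal_powr x p = (if x = \<infinity> then \<infinity> else ennreal (enn2real x powr p))"

text \<open>The supremum over the empty set (\<open>n\<close> exceeding the diameter) is \<open>0\<close> in \<^typ>\<open>ennreal\<close>.\<close>

definition offdiag_sup ::
  "('v \<Rightarrow> 'v \<Rightarrow> bool) \<Rightarrow> ('v \<Rightarrow> 'v \<Rightarrow> complex) \<Rightarrow> nat \<Rightarrow> ennreal" where
  "offdiag_sup E A n = (SUP (u, v) \<in> {(u, v). n \<le> geodesic_dist E u v}. ennreal (cmod (A u v)))"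

definition beurling_norm ::
  "('v \<Rightarrow> 'v \<Rightarrow> bool) \<Rightarrow> ereal \<Rightarrow> real \<Rightarrow> ('v \<Rightarrow> 'v \<Rightarrow> complex) \<Rightarrow> ennreal" where
  "beurling_norm E r \<alpha> A =
     (if r = \<infinity> then (SUP n. offdiag_sup E A n * ennreal (real (n + 1) powr \<alpha>))
      else ennreal_powr
        (\<Sum>n. ennreal_powr (offdiag_sup E A n) (real_of_ereal r) *
              ennreal (real (n + 1) powr (\<alpha> * real_of_ereal r + beurling_dim E - 1)))
        (1 / real_of_ereal r))"

definition beurling_class ::
  "('v \<Rightarrow> 'v \<Rightarrow> bool) \<Rightarrow> ereal \<Rightarrow> real \<Rightarrow> ('v \<Rightarrow> 'v \<Rightarrow> complex) set" where
  "beurling_class E r \<alpha> = {A. beurling_norm E r \<alpha> A < \<infinity>}"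


section \<open>Complex square-summable sequences\<close>

typedef 'v ell2 = "{x :: 'v \<Rightarrow> complex. (\<lambda>i. (cmod (x i))\<^sup>2) summable_on UNIV}"
  morphisms ell2_coord Abs_ell2
  by (rule exI[of _ "\<lambda>_. 0"]) simp

setup_lifting type_definition_ell2

lemma square_summable_add:
  fixes x y :: "'v \<Rightarrow> complex"
  assumes "(\<lambda>i. (cmod (x i))\<^sup>2) summable_on UNIV" "(\<lambda>i. (cmod (y i))\<^sup>2) summable_on UNIV"
  shows "(\<lambda>i. (cmod (x i + y i))\<^sup>2) summable_on UNIV"
proof (rule summable_on_comparison_test)
  show "(\<lambda>i. 2 * (cmod (x i))\<^sup>2 + 2 * (cmod (y i))\<^sup>2) summable_on UNIV"
    by (intro summable_on_add summable_on_cmult_right assms)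
  show "(cmod (x i + y i))\<^sup>2 \<le> 2 * (cmod (x i))\<^sup>2 + 2 * (cmod (y i))\<^sup>2" for i
  proof -
    have "(cmod (x i + y i))\<^sup>2 \<le> (cmod (x i) + cmod (y i))\<^sup>2"
      by (intro power_mono norm_triangle_ineq) auto
    also have "\<dots> \<le> 2 * (cmod (x i))\<^sup>2 + 2 * (cmod (y i))\<^sup>2"
      using sum_squares_bound[of "cmod (x i)" "cmod (y i)"] by (simp add: power2_sum)
    finally show ?thesis .
  qed
qed auto

instantiation ell2 :: (type) real_normed_vector
begin

lift_definition zero_ell2 :: "'a ell2" is "\<lambda>_. 0" by simp

lift_definition plus_ell2 :: "'a ell2 \<Rightarrow> 'a ell2 \<Rightarrow> 'a ell2" is "\<lambda>x y i. x i + y i"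
  by (rule square_summable_add)

lift_definition uminus_ell2 :: "'a ell2 \<Rightarrow> 'a ell2" is "\<lambda>x i. - x i" by simp

lift_definition minus_ell2 :: "'a ell2 \<Rightarrow> 'a ell2 \<Rightarrow> 'a ell2" is "\<lambda>x y i. x i - y i"
  subgoal for x y using square_summable_add[of x "\<lambda>i. - y i"] by simp
  done

lift_definition scaleR_ell2 :: "real \<Rightarrow> 'a ell2 \<Rightarrow> 'a ell2" is "\<lambda>c x i. c *\<^sub>R x i"
  by (simp add: power_mult_distrib summable_on_cmult_right)

lift_definition norm_ell2 :: "'a ell2 \<Rightarrow> real" is "\<lambda>x. sqrt (\<Sum>\<^sub>\<infinity>i. (cmod (x i))\<^sup>2)" .

definition dist_ell2 :: "'a ell2 \<Rightarrow> 'a ell2 \<Rightarrow> real" where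
  "dist_ell2 x y = norm (x - y)"

definition sgn_ell2 :: "'a ell2 \<Rightarrow> 'a ell2" where
  "sgn_ell2 x = inverse (norm x) *\<^sub>R x"

definition uniformity_ell2 :: "('a ell2 \<times> 'a ell2) filter" where
  "uniformity_ell2 = (INF e\<in>{0<..}. principal {(x, y). dist x y < e})"

definition open_ell2 :: "'a ell2 set \<Rightarrow> bool" where
  "open_ell2 U \<longleftrightarrow> (\<forall>x\<in>U. eventually (\<lambda>(x', y). x' = x \<longrightarrow> y \<in> U) uniformity)"

instance
proof
  fix x y z :: "'a ell2" and a b :: real
  show "x + y + z = x + (y + z)" by transfer (simp add: add.assoc)
  show "x + y = y + x" by transfer (simp add: add.commute)
  show "0 + x = x" by transfer simp
  show "- x + x = 0" by transfer simp
  show "x - y = x + - y" by transfer simp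
  show "a *\<^sub>R (x + y) = a *\<^sub>R x + a *\<^sub>R y" by transfer (simp add: scaleR_add_right)
  show "(a + b) *\<^sub>R x = a *\<^sub>R x + b *\<^sub>R x" by transfer (simp add: scaleR_add_left)
  show "a *\<^sub>R b *\<^sub>R x = (a * b) *\<^sub>R x" by transfer simp
  show "1 *\<^sub>R x = x" by transfer simp
  show "dist x y = norm (x - y)" by (rule dist_ell2_def)
  show "sgn x = inverse (norm x) *\<^sub>R x" by (rule sgn_ell2_def)
  show "(uniformity :: ('a ell2 \<times> 'a ell2) filter) =
      (INF e\<in>{0<..}. principal {(x, y). dist x y < e})"
    by (rule uniformity_ell2_def)
  show "open U \<longleftrightarrow> (\<forall>x\<in>U. eventually (\<lambda>(x', y). x' = x \<longrightarrow> y \<in> U) uniformity)"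
    for U :: "'a ell2 set"
    by (rule open_ell2_def)
  show "norm x = 0 \<longleftrightarrow> x = 0"
  proof transfer
    fix x :: "'a \<Rightarrow> complex"
    assume sm: "(\<lambda>i. (cmod (x i))\<^sup>2) summable_on UNIV"
    show "sqrt (\<Sum>\<^sub>\<infinity>i. (cmod (x i))\<^sup>2) = 0 \<longleftrightarrow> x = (\<lambda>_. 0)"
    proof
      assume "sqrt (\<Sum>\<^sub>\<infinity>i. (cmod (x i))\<^sup>2) = 0"
      then have "(\<Sum>\<^sub>\<infinity>i. (cmod (x i))\<^sup>2) \<le> 0" by simp
      then have "(cmod (x i))\<^sup>2 = 0" for i
        by (rule nonneg_infsum_le_0D[OF _ sm]) simp_all
      then show "x = (\<lambda>_. 0)" by (simp add: fun_eq_iff)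
    qed simp
  qed
  show "norm (a *\<^sub>R x) = \<bar>a\<bar> * norm x"
    by transfer (simp add: power_mult_distrib infsum_cmult_right' real_sqrt_mult)
  show "norm (x + y) \<le> norm x + norm y"
  proof transfer
    fix x y :: "'a \<Rightarrow> complex"
    assume x: "(\<lambda>i. (cmod (x i))\<^sup>2) summable_on UNIV" and y: "(\<lambda>i. (cmod (y i))\<^sup>2) summable_on UNIV"
    define X Y where "X = sqrt (\<Sum>\<^sub>\<infinity>i. (cmod (x i))\<^sup>2)" and "Y = sqrt (\<Sum>\<^sub>\<infinity>i. (cmod (y i))\<^sup>2)"
    have "(\<Sum>i\<in>F. (cmod (x i + y i))\<^sup>2) \<le> (X + Y)\<^sup>2" if F: "finite F" for F
    proof -
      have "L2_set (\<lambda>i. cmod (x i + y i)) F \<le> L2_set (\<lambda>i. cmod (x i) + cmod (y i)) F"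
        by (intro L2_set_mono norm_triangle_ineq) auto
      also have "\<dots> \<le> L2_set (\<lambda>i. cmod (x i)) F + L2_set (\<lambda>i. cmod (y i)) F"
        by (rule L2_set_triangle_ineq)
      also have "\<dots> \<le> X + Y"
        unfolding L2_set_def X_def Y_def
        by (intro add_mono real_sqrt_le_mono finite_sum_le_infsum x y F) auto
      finally show ?thesis
        unfolding L2_set_def by (rule sqrt_le_D)
    qed
    then have "(\<Sum>\<^sub>\<infinity>i. (cmod (x i + y i))\<^sup>2) \<le> (X + Y)\<^sup>2"
      by (rule infsum_le_finite_sums[OF square_summable_add[OF x y]])
    moreover have "0 \<le> X + Y"
      unfolding X_def Y_def by (intro add_nonneg_nonneg real_sqrt_ge_zero infsum_nonneg) simp_all
    ultimately have "sqrt (\<Sum>\<^sub>\<infinity>i. (cmod (x i + y i))\<^sup>2) \<le> X + Y"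
      by (rule real_le_lsqrt[rotated])
    then show "sqrt (\<Sum>\<^sub>\<infinity>i. (cmod (x i + y i))\<^sup>2) \<le>
        sqrt (\<Sum>\<^sub>\<infinity>i. (cmod (x i))\<^sup>2) + sqrt (\<Sum>\<^sub>\<infinity>i. (cmod (y i))\<^sup>2)"
      by (simp only: X_def Y_def)
  qed
qed

end

lift_definition scaleC_ell2 :: "complex \<Rightarrow> 'v ell2 \<Rightarrow> 'v ell2" is "\<lambda>c x i. c * x i"
  by (simp add: norm_mult power_mult_distrib summable_on_cmult_right)

lift_definition unit_ell2 :: "'v \<Rightarrow> 'v ell2" is "\<lambda>j i. if i = j then 1 else 0"
  by (rule finite_nonzero_values_imp_summable_on) simp


section \<open>Bounded operators and matrices\<close>

text \<open>Membership in \<open>\<B>(\<ell>\<^sup>2)\<close>. The library predicate \<^const>\<open>bounded_linear\<close> only provides real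
  linearity; the operator norm is \<^const>\<open>onorm\<close>.\<close>

definition bounded_ell2_op :: "('v ell2 \<Rightarrow> 'v ell2) \<Rightarrow> bool" where
  "bounded_ell2_op T \<longleftrightarrow>
     bounded_linear T \<and> (\<forall>c x. T (scaleC_ell2 c x) = scaleC_ell2 c (T x))"

text \<open>\<open>T\<close> is the bounded operator on \<open>\<ell>\<^sup>2\<close> given by the matrix \<open>A\<close>.\<close>

definition ell2_op_of_matrix :: "('v \<Rightarrow> 'v \<Rightarrow> complex) \<Rightarrow> ('v ell2 \<Rightarrow> 'v ell2) \<Rightarrow> bool" where
  "ell2_op_of_matrix A T \<longleftrightarrow> bounded_ell2_op T \<and>
     (\<forall>x u. ((\<lambda>v. A u v * ell2_coord x v) has_sum ell2_coord (T x) u) UNIV)"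

definition matrix_of_ell2_op :: "('v ell2 \<Rightarrow> 'v ell2) \<Rightarrow> 'v \<Rightarrow> 'v \<Rightarrow> complex" where
  "matrix_of_ell2_op S u v = ell2_coord (S (unit_ell2 v)) u"

text \<open>\<open>S\<close> is the inverse in \<open>\<B>(\<ell>\<^sup>2)\<close> of (the operator given by) the matrix \<open>A\<close>.\<close>

definition ell2_inverse_of :: "('v \<Rightarrow> 'v \<Rightarrow> complex) \<Rightarrow> ('v ell2 \<Rightarrow> 'v ell2) \<Rightarrow> bool" where
  "ell2_inverse_of A S \<longleftrightarrow>
     (\<exists>T. ell2_op_of_matrix A T \<and> bounded_ell2_op S \<and> S \<circ> T = id \<and> T \<circ> S = id)"

end

theory Submission
  imports Defs
begin

text \<open>Let \<open>S = A\<inverse>\<close>, \<open>s = \<parallel>S\<parallel>\<close>, \<open>M = \<parallel>A\<parallel>\<close>, \<open>\<kappa> = s M\<close>, \<open>\<beta> = \<alpha> + d/r\<close>, \<open>\<gamma> = \<beta> - d = \<alpha> - d/r'\<close>, and let \<open>f n\<close> be the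
  supremum of the local norms \<open>\<parallel>\<chi> S e\<^sub>w\<parallel>\<close> over balls of radius \<open>N\<close> whose centers have distance at
  least \<open>n\<close> from \<open>w\<close>. Commuting \<open>A\<close> with a Lipschitz cutoff of width \<open>N\<close> costs \<open>M \<epsilon>\<close>, where \<open>\<epsilon>\<close> is
  \<open>N powr - min \<gamma> 1\<close> with a logarithmic correction for \<open>\<gamma> = 1\<close>. Hence, for \<open>n \<ge> 10 N\<close>,
  \<open>f n \<le> C \<kappa> \<epsilon> f (n/2) + C s a(n/6) \<Sum>\<^sub>k f k ((k+1)\<^sup>d - k\<^sup>d)\<close> with \<open>k \<le> n/2\<close>, where \<open>a\<close> majorizes \<open>A\<close>.
  Take \<open>N\<close> of order \<open>\<kappa> powr (1 / min \<gamma> 1)\<close>, up to the logarithm, so that \<open>C \<kappa> \<epsilon>\<close> is small. Induction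
  on \<open>n\<close> then gives \<open>f n \<le> C s (N / (n+1)) powr \<beta>\<close>, so the sum over \<open>k\<close> is at most \<open>C s N\<^sup>d\<close>; inserting
  this and absorbing the term with \<open>f (n/2)\<close> bounds the weighted \<open>r\<close>-norm of \<open>f\<close>, which dominates
  \<open>S\<close>, by \<open>C s N powr \<beta>\<close>.\<close>

section \<open>Sums of real powers\<close>

text \<open>For finite r the weights of the norm are (n+1) powr (\<beta> r - 1), so a sequence of
  size s up to N and small beyond has norm of order s times N powr \<beta>. The claimed bound is
  exactly this for the scale N at which commutators become harmless; the exponent \<beta> / min
  \<gamma> 1 only converts N into \<kappa>. Since nothing but constants may be lost, the recursion
  is used twice. Its coefficient contains an unknown sum over f, which the first pass has to bound.
  The pointwise decay of order \<beta> found there settles r = \<infinity>, but for finite r it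
  would leave a logarithmically divergent weighted sum; the second pass therefore takes the decay
  from A itself. The logarithm at \<gamma> = 1 comes from Hoelder's inequality against a harmonic
  sum, and \<beta> = d + 1 there explains the exponent (d+1)/r'. A lower bound for \<kappa>
  independent of A keeps the rounding of N to an integer within a constant factor.\<close>

lemma powr_le_mult_powr:
  fixes x y k e :: real
  assumes "0 < x" "x \<le> y" "y \<le> k * x"
  shows "y powr e \<le> k powr \<bar>e\<bar> * x powr e" and "x powr e \<le> k powr \<bar>e\<bar> * y powr e"
proof -
  have y: "0 < y" using assms by linarith
  have "0 < k * x" using y assms by linarith
  then have k0: "0 < k" using assms(1) by (simp add: zero_less_mult_iff)
  have "1 * x \<le> k * x" using assms by linarith
  then have k: "1 \<le> k" using assms(1) mult_le_cancel_right by fastforce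
  have ge1: "1 \<le> k powr \<bar>e\<bar>" using k by (simp add: ge_one_powr_ge_zero)
  show "y powr e \<le> k powr \<bar>e\<bar> * x powr e"
  proof (cases "0 \<le> e")
    case True
    then have "y powr e \<le> (k * x) powr e" using assms y by (intro powr_mono2) auto
    then show ?thesis using True k0 assms by (simp add: powr_mult)
  next
    case False
    then have "y powr e \<le> x powr e" using assms by (intro powr_mono2') auto
    also have "\<dots> \<le> k powr \<bar>e\<bar> * x powr e" using ge1 mult_right_mono[of 1 "k powr \<bar>e\<bar>" "x powr e"] by simp
    finally show ?thesis .
  qed
  show "x powr e \<le> k powr \<bar>e\<bar> * y powr e"
  proof (cases "0 \<le> e")
    case True
    then have "x powr e \<le> y powr e" using assms by (intro powr_mono2) auto
    also have "\<dots> \<le> k powr \<bar>e\<bar> * y powr e" using ge1 mult_right_mono[of 1 "k powr \<bar>e\<bar>" "y powr e"] by simp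
    finally show ?thesis .
  next
    case False
    then have "(k * x) powr e \<le> y powr e" using assms y by (intro powr_mono2') auto
    then have "k powr (-e) * (k powr e * x powr e) \<le> k powr (-e) * y powr e"
      using k0 assms by (intro mult_left_mono) (auto simp: powr_mult)
    moreover have "k powr (-e) * (k powr e * x powr e) = x powr e"
      using k0 by (simp add: powr_minus field_simps)
    ultimately show ?thesis using False by simp
  qed
qed

lemma powr_diff_MVT:
  fixes x q :: real
  assumes "0 < x"
  obtains z where "x < z" "z < x + 1" "(x + 1) powr q - x powr q = q * z powr (q - 1)"
proof -
  have "\<exists>z>x. z < x + 1 \<and> (x + 1) powr q - x powr q = (x + 1 - x) * (q * z powr (q - 1))"
    using assms by (intro MVT2) (auto intro!: derivative_eq_intros)
  then show ?thesis using that by auto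
qed

lemma powr_increment_le:
  fixes q :: real
  assumes "0 \<le> q"
  shows "real (Suc n) powr q - real n powr q \<le> (q * 2 powr \<bar>q - 1\<bar> + 1) * real (Suc n) powr (q - 1)"
\<comment> \<open>The mean value theorem for real powers needs a positive left end. At n = 0 the
  increment is 1 for every q, because 0 powr 0 = 0, and the summand 1 in the constant pays for
  it.\<close>
proof (cases "n = 0")
  case True
  then show ?thesis using assms by simp
next
  case False
  then obtain z where z: "real n < z" "z < real n + 1"
    "(real n + 1) powr q - real n powr q = q * z powr (q - 1)"
    using powr_diff_MVT[of "real n" q] by auto
  have "z powr (q - 1) \<le> 2 powr \<bar>q - 1\<bar> * (real n + 1) powr (q - 1)"
    using z False by (intro powr_le_mult_powr(2)) auto
  then have "q * z powr (q - 1) \<le> q * (2 powr \<bar>q - 1\<bar> * (real n + 1) powr (q - 1))"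
    using assms by (intro mult_left_mono) auto
  then show ?thesis using z(3) powr_ge_zero[of "real n + 1" "q-1"] by (simp add: algebra_simps del: powr_ge_zero)
qed

lemma powr_increment_ge:
  fixes q :: real
  assumes "0 < q"
  shows "real (Suc n) powr (q - 1) \<le> (2 powr \<bar>q - 1\<bar> / q + 1) * (real (Suc n) powr q - real n powr q)"
proof (cases "n = 0")
  case True
  then show ?thesis using assms by simp
next
  case False
  then obtain z where z: "real n < z" "z < real n + 1"
    "(real n + 1) powr q - real n powr q = q * z powr (q - 1)"
    using powr_diff_MVT[of "real n" q] by auto
  have "(real n + 1) powr (q - 1) \<le> 2 powr \<bar>q - 1\<bar> * z powr (q - 1)"
    using z False by (intro powr_le_mult_powr(1)) auto
  also have "\<dots> = 2 powr \<bar>q - 1\<bar> / q * ((real n + 1) powr q - real n powr q)"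
    using z(3) assms by simp
  also have "\<dots> \<le> (2 powr \<bar>q - 1\<bar> / q + 1) * ((real n + 1) powr q - real n powr q)"
    using z(3) assms by (intro mult_right_mono) auto
  finally show ?thesis by (simp add: add.commute)
qed

lemma powr_decrement_ge:
  fixes g :: real
  assumes "0 < g"
  shows "real (Suc n) powr (- g - 1) \<le>
    2 powr (g + 1) / g * (real (Suc n) powr (- g) - real (Suc (Suc n)) powr (- g))"
proof -
  obtain z where z: "real (Suc n) < z" "z < real (Suc n) + 1"
    "(real (Suc n) + 1) powr (-g) - real (Suc n) powr (-g) = (-g) * z powr (-g - 1)"
    using powr_diff_MVT[of "real (Suc n)" "-g"] by auto
  have "real (Suc n) powr (-g - 1) \<le> 2 powr \<bar>-g - 1\<bar> * z powr (-g - 1)"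
    using z by (intro powr_le_mult_powr(2)) auto
  also have "\<dots> = 2 powr (g + 1) / g * (g * z powr (-g - 1))" using assms by (simp add: abs_if add.commute)
  also have "g * z powr (-g - 1) = real (Suc n) powr (- g) - real (Suc (Suc n)) powr (- g)"
    using z(3) by (simp add: add.commute)
  finally show ?thesis .
qed

lemma sum_powr_le:
  fixes q :: real
  assumes "0 < q"
  obtains C where "0 < C" "\<And>n. (\<Sum>k<n. real (Suc k) powr (q - 1)) \<le> C * real n powr q"
proof
  let ?C = "2 powr \<bar>q - 1\<bar> / q + 1"
  show "0 < ?C" using assms by (simp add: add_nonneg_pos)
  show "(\<Sum>k<n. real (Suc k) powr (q - 1)) \<le> ?C * real n powr q" for n
  proof -
    have "(\<Sum>k<n. real (Suc k) powr (q - 1)) \<le> (\<Sum>k<n. ?C * (real (Suc k) powr q - real k powr q))"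
      by (intro sum_mono powr_increment_ge assms)
    also have "\<dots> = ?C * real n powr q"
      using sum_lessThan_telescope[of "\<lambda>k. real k powr q" n]
      by (simp only: sum_distrib_left[symmetric]) simp
    finally show ?thesis .
  qed
qed

lemma sum_powr_ge:
  fixes q :: real
  assumes "0 < q"
  obtains C where "0 < C" "\<And>n. real n powr q \<le> C * (\<Sum>k<n. real (Suc k) powr (q - 1))"
proof
  let ?C = "q * 2 powr \<bar>q - 1\<bar> + 1"
  show "0 < ?C" using assms by (simp add: add_nonneg_pos)
  show "real n powr q \<le> ?C * (\<Sum>k<n. real (Suc k) powr (q - 1))" for n
  proof -
    have "(\<Sum>k<n. real (Suc k) powr q - real k powr q) \<le> (\<Sum>k<n. ?C * real (Suc k) powr (q - 1))"
      using assms by (intro sum_mono powr_increment_le) auto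
    then show ?thesis
      using sum_lessThan_telescope[of "\<lambda>k. real k powr q" n] assms
      by (simp only: sum_distrib_left[symmetric]) simp
  qed
qed

text \<open>Telescoping takes the place of an integral comparison. The constant does not depend on
  the upper end R, so tails can be handled by finite sums alone.\<close>

lemma sum_powr_tail:
  fixes g :: real
  assumes "0 < g"
  obtains C where "0 < C"
    "\<And>j R. (\<Sum>k\<in>{j..<R}. real (Suc k) powr (- g - 1)) \<le> C * real (Suc j) powr (- g)"
proof
  let ?C = "2 powr (g + 1) / g"
  show "0 < ?C" using assms by simp
  show "(\<Sum>k\<in>{j..<R}. real (Suc k) powr (- g - 1)) \<le> ?C * real (Suc j) powr (- g)" for j R
  proof (cases "j \<le> R")
    case True
    have "(\<Sum>k\<in>{j..<R}. real (Suc k) powr (- g - 1))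
        \<le> (\<Sum>k\<in>{j..<R}. ?C * (real (Suc k) powr (- g) - real (Suc (Suc k)) powr (- g)))"
      by (intro sum_mono powr_decrement_ge assms)
    also have "\<dots> = - ?C * (\<Sum>k\<in>{j..<R}. real (Suc (Suc k)) powr (- g) - real (Suc k) powr (- g))"
      unfolding sum_distrib_left by (intro sum.cong) (auto simp: algebra_simps diff_divide_distrib)
    also have "\<dots> = ?C * (real (Suc j) powr (- g) - real (Suc R) powr (- g))"
      by (subst sum_Suc_diff'[OF True]) (auto simp: algebra_simps diff_divide_distrib)
    also have "\<dots> \<le> ?C * real (Suc j) powr (- g)"
      using assms by (intro mult_left_mono) auto
    finally show ?thesis .
  qed (use assms in auto)
qed

text \<open>For g below 1 the partial sums grow like N powr (1 - g), and division by N leaves N powr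
  (-g); for g above 1 they are bounded and only the division contributes. At g = 1 a logarithm
  intervenes, which is treated separately.\<close>

lemma mean_powr_le:
  fixes g :: real
  assumes "0 < g" "g \<noteq> 1"
  obtains C where "0 < C"
    "\<And>N. 1 \<le> N \<Longrightarrow> (\<Sum>k<N. real (Suc k) powr (- g)) / real N \<le> C * real N powr (- min g 1)"
proof (cases "g < 1")
  case True
  then obtain C where C: "0 < C" "\<And>n. (\<Sum>k<n. real (Suc k) powr (1 - g - 1)) \<le> C * real n powr (1 - g)"
    using sum_powr_le[of "1 - g"] by auto
  show ?thesis
  proof
    show "0 < C" by fact
    fix N :: nat assume N: "1 \<le> N"
    have "(\<Sum>k<N. real (Suc k) powr (- g)) / real N \<le> C * real N powr (1 - g) / real N"
      using C(2)[of N] N by (intro divide_right_mono) auto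
    also have "\<dots> = C * real N powr (- min g 1)"
      using True N by (simp add: powr_diff powr_minus field_simps)
    finally show "(\<Sum>k<N. real (Suc k) powr (- g)) / real N \<le> C * real N powr (- min g 1)" .
  qed
next
  case False
  then have "0 < g - 1" using assms by simp
  then obtain C where C: "0 < C"
    "\<And>j R. (\<Sum>k\<in>{j..<R}. real (Suc k) powr (- (g - 1) - 1)) \<le> C * real (Suc j) powr (- (g - 1))"
    using sum_powr_tail by blast
  show ?thesis
  proof
    show "0 < C" by fact
    fix N :: nat assume N: "1 \<le> N"
    have "(\<Sum>k<N. real (Suc k) powr (- g)) \<le> C"
      using C(2)[of 0 N] by (simp add: atLeast0LessThan)
    then have "(\<Sum>k<N. real (Suc k) powr (- g)) / real N \<le> C / real N"
      using N by (intro divide_right_mono) auto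
    also have "\<dots> = C * real N powr (- min g 1)"
      using False N by (simp add: powr_minus field_simps)
    finally show "(\<Sum>k<N. real (Suc k) powr (- g)) / real N \<le> C * real N powr (- min g 1)" .
  qed
qed

text \<open>Every m is the value of n div c for exactly c consecutive n, and the weights there
  exceed the one at m by a factor of at most c powr |e|; this explains the exponent |e| + 1.\<close>

lemma sum_div_weight_le:
  fixes g :: "nat \<Rightarrow> real" and e :: real
  assumes g: "\<And>n. 0 \<le> g n" and c: "1 \<le> c"
  shows "(\<Sum>n<R. g (n div c) * real (Suc n) powr e)
    \<le> real c powr (\<bar>e\<bar> + 1) * (\<Sum>n<R. g n * real (Suc n) powr e)"
proof -
  have "(\<Sum>n<R. g (n div c) * real (Suc n) powr e) \<le> (\<Sum>n<R * c. g (n div c) * real (Suc n) powr e)"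
    using c g by (intro sum_mono2) auto
  also have "\<dots> = (\<Sum>m<R. \<Sum>n\<in>{m * c..<m * c + c}. g (n div c) * real (Suc n) powr e)"
    by (rule sum.nat_group[symmetric])
  also have "\<dots> \<le> (\<Sum>m<R. \<Sum>n\<in>{m * c..<m * c + c}. g m * (real c powr \<bar>e\<bar> * real (Suc m) powr e))"
  proof (intro sum_mono)
    fix m n assume n: "n \<in> {m * c..<m * c + c}"
    then have "n div c = m" by (intro div_nat_eqI) (auto simp: algebra_simps)
    moreover have "real (Suc n) powr e \<le> real c powr \<bar>e\<bar> * real (Suc m) powr e"
    proof (rule powr_le_mult_powr(1))
      have "m * 1 \<le> m * c" using c by (intro mult_left_mono) auto
      then show "real (Suc m) \<le> real (Suc n)" using n unfolding of_nat_le_iff atLeastLessThan_iff by linarith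
      have "Suc n \<le> c * Suc m" using n by (auto simp: algebra_simps)
      then show "real (Suc n) \<le> real c * real (Suc m)" unfolding of_nat_mult[symmetric] of_nat_le_iff .
    qed auto
    ultimately show "g (n div c) * real (Suc n) powr e \<le> g m * (real c powr \<bar>e\<bar> * real (Suc m) powr e)"
      using g by (auto intro: mult_left_mono)
  qed
  also have "\<dots> = real c powr (\<bar>e\<bar> + 1) * (\<Sum>n<R. g n * real (Suc n) powr e)"
    using c by (simp add: sum_distrib_left powr_add algebra_simps)
  finally show ?thesis .
qed

text \<open>Abel summation turns both sides into nonnegative combinations of partial sums, so only
  these have to be compared; single terms of c may exceed those of b.\<close>

lemma sum_mult_antitone_mono:
  fixes \<phi> c b :: "nat \<Rightarrow> real"
  assumes "antimono \<phi>" "\<And>n. 0 \<le> \<phi> n" and cb: "\<And>m. (\<Sum>k<m. c k) \<le> (\<Sum>k<m. b k)"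
  shows "(\<Sum>k<m. c k * \<phi> k) \<le> (\<Sum>k<m. b k * \<phi> k)"
proof -
  have parts: "(\<Sum>k<m. x k * \<phi> k) = (\<Sum>k<m. x k) * \<phi> m + (\<Sum>k<m. (\<Sum>i<Suc k. x i) * (\<phi> k - \<phi> (Suc k)))"
    for x :: "nat \<Rightarrow> real"
    by (induction m) (auto simp: algebra_simps)
  show ?thesis unfolding parts
  proof (rule add_mono)
    show "(\<Sum>k<m. c k) * \<phi> m \<le> (\<Sum>k<m. b k) * \<phi> m"
      by (intro mult_right_mono assms)
    show "(\<Sum>k<m. (\<Sum>i<Suc k. c i) * (\<phi> k - \<phi> (Suc k)))
        \<le> (\<Sum>k<m. (\<Sum>i<Suc k. b i) * (\<phi> k - \<phi> (Suc k)))"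
    proof (rule sum_mono)
      show "(\<Sum>i<Suc k. c i) * (\<phi> k - \<phi> (Suc k)) \<le> (\<Sum>i<Suc k. b i) * (\<phi> k - \<phi> (Suc k))" for k
        using assms(1) cb[of "Suc k"] by (intro mult_right_mono) (auto simp: antimono_iff_le_Suc)
    qed
  qed
qed

section \<open>Graphs with normal counting measure\<close>

lemma relpowp_geodesic_dist:
  assumes "connected_graph E"
  shows "(E ^^ geodesic_dist E u v) u v"
proof -
  have "E\<^sup>*\<^sup>* u v" using assms by (simp add: connected_graph_def)
  then obtain n where "(E ^^ n) u v" using rtranclp_imp_relpowp by metis
  then show ?thesis unfolding geodesic_dist_def by (rule LeastI)
qed

lemma geodesic_dist_le: "(E ^^ n) u v \<Longrightarrow> geodesic_dist E u v \<le> n"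
  unfolding geodesic_dist_def by (rule Least_le)

lemma geodesic_dist_self: "geodesic_dist E u u = 0"
  using geodesic_dist_le[of 0 E u u] by simp

lemma geodesic_dist_triangle:
  assumes "connected_graph E"
  shows "geodesic_dist E u w \<le> geodesic_dist E u v + geodesic_dist E v w"
  by (rule geodesic_dist_le[OF relpowp_trans[OF relpowp_geodesic_dist[OF assms] relpowp_geodesic_dist[OF assms]]])

lemma geodesic_dist_sym:
  assumes "connected_graph E" "symp E"
  shows "geodesic_dist E u v = geodesic_dist E v u"
proof -
  have rev: "(E ^^ n) x y \<Longrightarrow> (E ^^ n) y x" for n x y
  proof (induction n arbitrary: y)
    case (Suc n)
    then obtain z where z: "(E ^^ n) x z" "E z y" by (auto elim: relpowp_Suc_E)
    have "E y z" using z(2) assms(2) by (rule sympD[rotated])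
    then show ?case using Suc.IH[OF z(1)] by (rule relpowp_Suc_I2)
  qed simp
  show ?thesis
    by (rule antisym; rule geodesic_dist_le[OF rev[OF relpowp_geodesic_dist[OF assms(1)]]])
qed

text \<open>Both kinds of graphs fit here: an infinite one has infinite diameter, so the bounds hold at
  every scale, and a finite one has \<open>d = 0\<close>.\<close>

locale regular_metric =
  fixes \<rho> :: "'v \<Rightarrow> 'v \<Rightarrow> nat" and d D1 D2 :: real
  assumes dist_self: "\<rho> u u = 0" and dist_sym: "\<rho> u v = \<rho> v u"
    and dist_triangle: "\<rho> u w \<le> \<rho> u v + \<rho> v w"
    and dim_nonneg: "0 \<le> d" and D1_pos: "0 < D1" and D2_pos: "0 < D2"
    and finite_ball: "finite {v. \<rho> u v \<le> n}"
    and card_ball_le: "real (card {v. \<rho> u v \<le> n}) \<le> D1 * real (Suc n) powr d"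
    and card_ball_ge: "D2 * real (Suc n) powr d \<le> real (card {v. \<rho> u v \<le> n})"

lemma regular_metric_of_normal_graph:
  fixes E :: "'v \<Rightarrow> 'v \<Rightarrow> bool"
  assumes E: "simple_graph E" "connected_graph E" "polynomial_growth E" "normal_counting_measure E"
  obtains D1 D2 where "regular_metric (geodesic_dist E) (beurling_dim E) D1 D2"
proof -
  have sym: "symp E" using E(1) by (simp add: simple_graph_def)
  have ball: "graph_ball E u (real n) = {v. geodesic_dist E u v \<le> n}" for u n
    by (simp add: graph_ball_def)
  obtain d0 D where d0: "0 < d0" and D: "\<And>u R. 0 \<le> R \<Longrightarrow>
      emeasure (count_space UNIV) (graph_ball E u R) \<le> ennreal (D * (R + 1) powr d0)"
    using E(3) unfolding polynomial_growth_def polynomial_growth_with_def by blast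
  \<comment> \<open>An infinite ball would have \<open>card\<close> equal to 0 and satisfy upper
    bounds vacuously; the measure, which polynomial growth keeps finite, excludes this.\<close>
  have fin: "finite {v. geodesic_dist E u v \<le> n}" for u n
  proof (rule ccontr)
    assume "\<not> ?thesis"
    then have "emeasure (count_space UNIV) (graph_ball E u (real n)) = \<infinity>"
      unfolding ball by (simp add: emeasure_count_space_infinite)
    with D[of "real n" u] show False by (simp add: top_unique)
  qed
  have em: "emeasure (count_space UNIV) (graph_ball E u (real n))
      = ennreal (real (card {v. geodesic_dist E u v \<le> n}))" for u n
    unfolding ball using fin by (simp add: emeasure_count_space_finite ennreal_of_nat_eq_real_of_nat)
  have dim0: "0 \<le> beurling_dim E"
    unfolding beurling_dim_def using E(3) unfolding polynomial_growth_def
    by (intro cInf_greatest) auto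
  obtain D1 D2 where D12: "0 < D1" "0 < D2" and nrm: "\<And>u R. 0 \<le> R \<Longrightarrow> ereal R \<le> graph_diam E \<Longrightarrow>
     ennreal (D2 * (R + 1) powr beurling_dim E) \<le> emeasure (count_space UNIV) (graph_ball E u R) \<and>
     emeasure (count_space UNIV) (graph_ball E u R) \<le> ennreal (D1 * (R + 1) powr beurling_dim E)"
    using E(4) unfolding normal_counting_measure_def by blast
  have metric: "regular_metric (geodesic_dist E) (beurling_dim E) D1' D2'"
    if "0 < D1'" "0 < D2'"
      "\<And>u n. real (card {v. geodesic_dist E u v \<le> n}) \<le> D1' * real (Suc n) powr beurling_dim E"
      "\<And>u n. D2' * real (Suc n) powr beurling_dim E \<le> real (card {v. geodesic_dist E u v \<le> n})"
    for D1' D2'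
    by unfold_locales
      (rule that dim0 fin geodesic_dist_self geodesic_dist_triangle[OF E(2)] geodesic_dist_sym[OF E(2) sym])+
  show ?thesis
  proof (cases "graph_diam E = \<infinity>")
    case True
    have *: "ennreal (D2 * (real n + 1) powr beurling_dim E) \<le> ennreal (real (card {v. geodesic_dist E u v \<le> n}))"
      "ennreal (real (card {v. geodesic_dist E u v \<le> n})) \<le> ennreal (D1 * (real n + 1) powr beurling_dim E)" for u n
      using nrm[of "real n" u] True unfolding em by auto
    have "regular_metric (geodesic_dist E) (beurling_dim E) D1 D2"
    proof (rule metric[OF D12])
      show "real (card {v. geodesic_dist E u v \<le> n}) \<le> D1 * real (Suc n) powr beurling_dim E" for u n
        using *(2)[of u n] D12 by (subst (asm) ennreal_le_iff) (auto simp: add.commute)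
      show "D2 * real (Suc n) powr beurling_dim E \<le> real (card {v. geodesic_dist E u v \<le> n})" for u n
        using *(1)[of n u] D12 by (subst (asm) ennreal_le_iff) (auto simp: add.commute)
    qed
    then show ?thesis by (rule that)
  next
    case False
    have le: "ereal (real (geodesic_dist E u v)) \<le> graph_diam E" for u v
      unfolding graph_diam_def by (rule SUP_upper2[of "(u, v)"]) auto
    obtain x where x: "graph_diam E = ereal x"
      using False le[of undefined undefined] by (cases "graph_diam E") auto
    define n where "n = nat \<lceil>x\<rceil>"
    have n: "geodesic_dist E u v \<le> n" for u v
    proof -
      have "real (geodesic_dist E u v) \<le> x" using le[of u v] unfolding x by simp
      then show ?thesis unfolding n_def by linarith
    qed
    then have UNIV: "finite (UNIV :: 'v set)" using fin[of _ n] by simp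
    have growth: "polynomial_growth_with E e" if "0 < e" for e
      unfolding polynomial_growth_with_def
    proof (intro exI[of _ "real (card (UNIV :: 'v set))"] conjI allI impI)
      show "0 < real (card (UNIV :: 'v set))" using UNIV by (simp add: card_gt_0_iff)
      fix u :: 'v and R :: real assume R: "0 \<le> R"
      have "1 \<le> (R + 1) powr e" using R that by (intro ge_one_powr_ge_zero) auto
      then have "real (card (UNIV :: 'v set)) * 1 \<le> real (card (UNIV :: 'v set)) * (R + 1) powr e"
        by (intro mult_left_mono) auto
      moreover have "card (graph_ball E u R) \<le> card (UNIV :: 'v set)" using UNIV by (intro card_mono) auto
      ultimately have "real (card (graph_ball E u R)) \<le> real (card (UNIV :: 'v set)) * (R + 1) powr e"
        by linarith
      then show "emeasure (count_space UNIV) (graph_ball E u R)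
          \<le> ennreal (real (card (UNIV :: 'v set)) * (R + 1) powr e)"
        using finite_subset[OF subset_UNIV UNIV]
        by (simp add: emeasure_count_space_finite ennreal_of_nat_eq_real_of_nat ennreal_leI)
    qed
    \<comment> \<open>On a finite graph the infimum of the admissible exponents is 0 and is not
      attained. With d = 0 balls only need constant bounds: the number of vertices from above, and 1
      from below, for the center.\<close>
    have "{e. 0 < e \<and> polynomial_growth_with E e} = {0<..}" using growth by auto
    then have dim: "beurling_dim E = 0" unfolding beurling_dim_def by simp
    have "regular_metric (geodesic_dist E) (beurling_dim E) (real (card (UNIV :: 'v set))) 1"
    proof (rule metric)
      show "0 < real (card (UNIV :: 'v set))" using UNIV by (simp add: card_gt_0_iff)
      show "real (card {v. geodesic_dist E u v \<le> n}) \<le> real (card (UNIV :: 'v set)) * real (Suc n) powr beurling_dim E" for u n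
        unfolding dim using UNIV by (simp add: card_mono)
      have pos: "0 < card {v. geodesic_dist E u v \<le> n}" for u n
      proof -
        have "u \<in> {v. geodesic_dist E u v \<le> n}" by (simp add: geodesic_dist_self)
        then show ?thesis using fin[of u n] card_gt_0_iff by blast
      qed
      show "1 * real (Suc n) powr beurling_dim E \<le> real (card {v. geodesic_dist E u v \<le> n})" for u n
      proof -
        have "1 \<le> real (card {v. geodesic_dist E u v \<le> n})" using pos[of u n] by linarith
        moreover have "real (Suc n) powr beurling_dim E = 1" unfolding dim by simp
        ultimately show ?thesis by linarith
      qed
    qed simp
    then show ?thesis by (rule that)
  qed
qed

text \<open>Since \<open>0 powr 0 = 0\<close>, the increments still sum to \<open>n powr q\<close> for \<open>q = 0\<close>; replacing them by
  \<open>(n + 1) powr (q - 1)\<close> would lose a logarithm on finite graphs.\<close>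

definition powr_increment :: "real \<Rightarrow> nat \<Rightarrow> real" where
  "powr_increment q n = real (Suc n) powr q - real n powr q"

lemma powr_increment_nonneg: "0 \<le> q \<Longrightarrow> 0 \<le> powr_increment q n"
  by (simp add: powr_increment_def powr_mono2)

lemma sum_powr_increment: "(\<Sum>k<n. powr_increment q k) = real n powr q"
  using sum_lessThan_telescope[of "\<lambda>k. real k powr q" n] by (simp add: powr_increment_def)

section \<open>Sums over vertices, arranged by the distance to a point\<close>

context regular_metric
begin

text \<open>The growth condition controls balls and not spheres, so the number of vertices at
  distance exactly k may exceed D1 times \<open>powr_increment d k\<close>. The partial sums of
  these numbers are ball sizes, and for an antitone weight this suffices.\<close>

lemma sum_dist_less_le:
  fixes \<phi> :: "nat \<Rightarrow> real"
  assumes \<phi>: "antimono \<phi>" "\<And>n. 0 \<le> \<phi> n" and F: "finite F"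
  shows "(\<Sum>v\<in>{v\<in>F. \<rho> u v < R}. \<phi> (\<rho> u v)) \<le> D1 * (\<Sum>k<R. \<phi> k * powr_increment d k)"
proof -
  define B where "B = {v\<in>F. \<rho> u v < R}"
  have B: "finite B" using F by (simp add: B_def)
  define c where "c k = real (card {v\<in>B. \<rho> u v = k})" for k
  have sum_c: "(\<Sum>k<m. c k) \<le> (\<Sum>k<m. D1 * powr_increment d k)" for m
  proof (cases m)
    case (Suc l)
    have "(\<Sum>k<m. c k) = real (\<Sum>k<m. card {v\<in>{v\<in>B. \<rho> u v < m}. \<rho> u v = k})"
      unfolding c_def of_nat_sum by (intro sum.cong refl arg_cong[of _ _ "\<lambda>S. real (card S)"]) auto
    also have "(\<Sum>k<m. card {v\<in>{v\<in>B. \<rho> u v < m}. \<rho> u v = k}) = card {v\<in>B. \<rho> u v < m}"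
      unfolding card_eq_sum by (rule sum.group) (use B in auto)
    also have "\<dots> \<le> card {v. \<rho> u v \<le> l}"
      using Suc by (intro card_mono finite_ball) auto
    finally have "(\<Sum>k<m. c k) \<le> real (card {v. \<rho> u v \<le> l})" by simp
    also have "\<dots> \<le> D1 * real m powr d" using card_ball_le Suc by simp
    finally show ?thesis by (simp add: sum_powr_increment flip: sum_distrib_left)
  qed simp
  have "(\<Sum>v\<in>B. \<phi> (\<rho> u v)) = (\<Sum>k<R. \<Sum>v\<in>{v\<in>B. \<rho> u v = k}. \<phi> (\<rho> u v))"
    by (rule sum.group[symmetric]) (use B in \<open>auto simp: B_def\<close>)
  also have "\<dots> = (\<Sum>k<R. c k * \<phi> k)" by (simp add: c_def)
  also have "\<dots> \<le> (\<Sum>k<R. D1 * powr_increment d k * \<phi> k)"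
    by (rule sum_mult_antitone_mono[OF \<phi> sum_c])
  finally show ?thesis by (simp add: B_def sum_distrib_left mult_ac)
qed

lemma sum_dist_le:
  fixes \<phi> :: "nat \<Rightarrow> real"
  assumes \<phi>: "antimono \<phi>" "\<And>n. 0 \<le> \<phi> n" and F: "finite F"
    and K: "\<And>R. (\<Sum>k<R. \<phi> k * powr_increment d k) \<le> K"
  shows "(\<Sum>v\<in>F. \<phi> (\<rho> u v)) \<le> D1 * K"
proof -
  define R where "R = Suc (\<Sum>v\<in>F. \<rho> u v)"
  have "\<rho> u v < R" if "v \<in> F" for v
    unfolding R_def using member_le_sum[OF that, of "\<rho> u"] F by simp
  then have "{v\<in>F. \<rho> u v < R} = F" by auto
  then have "(\<Sum>v\<in>F. \<phi> (\<rho> u v)) \<le> D1 * (\<Sum>k<R. \<phi> k * powr_increment d k)"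
    using sum_dist_less_le[OF \<phi> F, of u R] by simp
  also have "\<dots> \<le> D1 * K" using K D1_pos by simp
  finally show ?thesis .
qed

lemma powr_increment_dim_le:
  "powr_increment d n \<le> (d * 2 powr \<bar>d - 1\<bar> + 1) * real (Suc n) powr (d - 1)"
  unfolding powr_increment_def by (rule powr_increment_le[OF dim_nonneg])

lemma sum_dist_tail:
  assumes "d < \<beta>"
  obtains C where "0 < C" "\<And>F u j. finite F \<Longrightarrow>
    (\<Sum>v\<in>{v\<in>F. j \<le> \<rho> u v}. real (Suc (\<rho> u v)) powr (-\<beta>)) \<le> C * real (Suc j) powr (d - \<beta>)"
proof -
  let ?c = "d * 2 powr \<bar>d - 1\<bar> + 1"
  have c: "0 < ?c" using dim_nonneg by (simp add: add_nonneg_pos)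
  obtain C where C: "0 < C" "\<And>j R. (\<Sum>k\<in>{j..<R}. real (Suc k) powr (- (\<beta> - d) - 1)) \<le> C * real (Suc j) powr (- (\<beta> - d))"
    using sum_powr_tail[of "\<beta> - d"] assms by auto
  show ?thesis
  proof
    show "0 < D1 * (1 + ?c * C)" using D1_pos c C by (simp add: add_pos_pos)
    fix F u j assume F: "finite (F :: 'v set)"
    \<comment> \<open>Flattened below j, the weight is antitone everywhere and unchanged on the
      vertices that are summed. The flat part costs (j+1) powr (d - \<beta>), the same order as the
      tail itself.\<close>
    define \<phi> where "\<phi> k = real (Suc (max k j)) powr (-\<beta>)" for k
    have \<beta>: "0 < \<beta>" using assms dim_nonneg by simp
    have \<phi>: "antimono \<phi>" "\<And>n. 0 \<le> \<phi> n"
      using \<beta> by (auto simp: \<phi>_def intro!: antimonoI powr_mono2')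
    have K: "(\<Sum>k<R. \<phi> k * powr_increment d k) \<le> (1 + ?c * C) * real (Suc j) powr (d - \<beta>)" for R
    proof -
      have "(\<Sum>k<R. \<phi> k * powr_increment d k) \<le> (\<Sum>k\<in>{..<Suc j} \<union> {j..<R}. \<phi> k * powr_increment d k)"
        using \<phi> powr_increment_nonneg[OF dim_nonneg] by (intro sum_mono2) auto
      also have "\<dots> \<le> (\<Sum>k<Suc j. \<phi> k * powr_increment d k) + (\<Sum>k\<in>{j..<R}. \<phi> k * powr_increment d k)"
        using \<phi> powr_increment_nonneg[OF dim_nonneg] by (subst sum_Un) (auto intro!: sum_nonneg)
      also have "(\<Sum>k<Suc j. \<phi> k * powr_increment d k) = (\<Sum>k<Suc j. real (Suc j) powr (-\<beta>) * powr_increment d k)"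
        by (intro sum.cong) (auto simp: \<phi>_def max_def)
      also have "\<dots> = real (Suc j) powr (d - \<beta>)"
        by (simp only: sum_powr_increment flip: sum_distrib_left powr_add) simp
      also have "(\<Sum>k\<in>{j..<R}. \<phi> k * powr_increment d k)
          \<le> (\<Sum>k\<in>{j..<R}. ?c * real (Suc k) powr (- (\<beta> - d) - 1))"
      proof (rule sum_mono)
        fix k assume "k \<in> {j..<R}"
        then have "\<phi> k = real (Suc k) powr (-\<beta>)" by (simp add: \<phi>_def max_absorb1)
        moreover have "real (Suc k) powr (- (\<beta> - d) - 1) = real (Suc k) powr (-\<beta>) * real (Suc k) powr (d - 1)"
          by (simp add: algebra_simps flip: powr_add)
        moreover have "real (Suc k) powr (-\<beta>) * powr_increment d k
            \<le> real (Suc k) powr (-\<beta>) * (?c * real (Suc k) powr (d - 1))"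
          by (intro mult_left_mono powr_increment_dim_le) auto
        ultimately show "\<phi> k * powr_increment d k \<le> ?c * real (Suc k) powr (- (\<beta> - d) - 1)"
          by (simp add: mult_ac)
      qed
      also have "\<dots> \<le> ?c * (C * real (Suc j) powr (- (\<beta> - d)))"
        using C(2)[of j R] c by (simp only: flip: sum_distrib_left) (intro mult_left_mono, auto)
      finally show ?thesis by (simp add: algebra_simps)
    qed
    have "(\<Sum>v\<in>{v\<in>F. j \<le> \<rho> u v}. real (Suc (\<rho> u v)) powr (-\<beta>)) = (\<Sum>v\<in>{v\<in>F. j \<le> \<rho> u v}. \<phi> (\<rho> u v))"
      by (intro sum.cong) (auto simp: \<phi>_def max_def)
    also have "\<dots> \<le> D1 * ((1 + ?c * C) * real (Suc j) powr (d - \<beta>))"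
      using F by (intro sum_dist_le \<phi> K) auto
    finally show "(\<Sum>v\<in>{v\<in>F. j \<le> \<rho> u v}. real (Suc (\<rho> u v)) powr (-\<beta>)) \<le> D1 * (1 + ?c * C) * real (Suc j) powr (d - \<beta>)"
      by (simp add: mult_ac)
  qed
qed

text \<open>A weight \<open>min 1 (\<rho> / N)\<close> is not antitone. Writing \<open>\<rho> = \<Sum>\<^sub>j [j < \<rho>]\<close> reduces the sum to antitone
  weights \<open>a (max \<rho> j)\<close>.\<close>

lemma sum_commutator_kernel:
  assumes "d < \<beta>"
  obtains C where "0 < C" "\<And>a P F u N. antimono a \<Longrightarrow> (\<And>n. 0 \<le> a n) \<Longrightarrow>
    (\<And>n. a n \<le> P * real (Suc n) powr (-\<beta>)) \<Longrightarrow> finite F \<Longrightarrow> 1 \<le> N \<Longrightarrow>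
    (\<Sum>v\<in>F. a (\<rho> u v) * min 1 (real (\<rho> u v) / real N))
      \<le> C * ((\<Sum>k<N. a k * real (Suc k) powr d) / real N + P * real N powr (d - \<beta>))"
proof -
  let ?c = "d * 2 powr \<bar>d - 1\<bar> + 1"
  have c: "0 < ?c" using dim_nonneg by (simp add: add_nonneg_pos)
  obtain C where C: "0 < C" "\<And>F u j. finite F \<Longrightarrow>
    (\<Sum>v\<in>{v\<in>F. j \<le> \<rho> u v}. real (Suc (\<rho> u v)) powr (-\<beta>)) \<le> C * real (Suc j) powr (d - \<beta>)"
    using sum_dist_tail[OF assms] by blast
  show ?thesis
  proof
    show "0 < C + D1 * (1 + ?c)" using D1_pos c C by (simp add: add_pos_pos)
    fix a :: "nat \<Rightarrow> real" and P and F :: "'v set" and u and N :: nat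
    assume a: "antimono a" "\<And>n. 0 \<le> a n" and aP: "\<And>n. a n \<le> P * real (Suc n) powr (-\<beta>)"
      and F: "finite F" and N: "1 \<le> N"
    have P: "0 \<le> P" using a(2)[of 0] aP[of 0] by simp
    let ?A = "\<Sum>k<N. a k * real (Suc k) powr d"
    have inc: "0 \<le> powr_increment d n" for n by (rule powr_increment_nonneg[OF dim_nonneg])
    have A: "0 \<le> ?A" using a by (intro sum_nonneg) auto
    define B where "B = {v\<in>F. \<rho> u v < N}"
    have "(\<Sum>v\<in>{v\<in>F. N \<le> \<rho> u v}. a (\<rho> u v) * min 1 (real (\<rho> u v) / real N))
        \<le> (\<Sum>v\<in>{v\<in>F. N \<le> \<rho> u v}. P * real (Suc (\<rho> u v)) powr (-\<beta>))"
    proof (rule sum_mono)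
      fix v
      have "a (\<rho> u v) * min 1 (real (\<rho> u v) / real N) \<le> a (\<rho> u v) * 1"
        using a by (intro mult_left_mono) auto
      then show "a (\<rho> u v) * min 1 (real (\<rho> u v) / real N) \<le> P * real (Suc (\<rho> u v)) powr (-\<beta>)"
        using aP[of "\<rho> u v"] by simp
    qed
    also have "\<dots> \<le> P * (C * real (Suc N) powr (d - \<beta>))"
      using C(2)[OF F, where j = N and u = u] P by (simp only: flip: sum_distrib_left) (intro mult_left_mono, auto)
    also have "\<dots> \<le> P * (C * real N powr (d - \<beta>))"
      using P C N assms by (intro mult_left_mono powr_mono2') auto
    finally have far: "(\<Sum>v\<in>{v\<in>F. N \<le> \<rho> u v}. a (\<rho> u v) * min 1 (real (\<rho> u v) / real N))
        \<le> C * (P * real N powr (d - \<beta>))" by (simp add: mult_ac)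
    have B: "finite B" using F by (simp add: B_def)
    have "(\<Sum>v\<in>B. a (\<rho> u v) * real (\<rho> u v)) = (\<Sum>v\<in>B. \<Sum>j<N. if j < \<rho> u v then a (\<rho> u v) else 0)"
    proof (rule sum.cong[OF refl])
      fix v assume "v \<in> B"
      then have "{j. j < N \<and> j < \<rho> u v} = {..<\<rho> u v}" by (auto simp: B_def)
      then show "a (\<rho> u v) * real (\<rho> u v) = (\<Sum>j<N. if j < \<rho> u v then a (\<rho> u v) else 0)"
        by (simp add: sum.If_cases Int_def)
    qed
    also have "\<dots> \<le> (\<Sum>v\<in>B. \<Sum>j<N. a (max (\<rho> u v) j))"
      using a by (intro sum_mono) (auto simp: max_def)
    also have "\<dots> = (\<Sum>j<N. \<Sum>v\<in>B. a (max (\<rho> u v) j))" by (rule sum.swap)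
    also have "\<dots> \<le> (\<Sum>j<N. D1 * (\<Sum>k<N. a (max k j) * powr_increment d k))"
      unfolding B_def using a F
      by (intro sum_mono sum_dist_less_le[where \<phi> = "\<lambda>k. a (max k j)" for j])
        (auto intro!: antimonoI antimonoD[OF a(1)])
    \<comment> \<open>For k at most j the weight is a j, and the increments telescope to (j+1) powr
      d. For k above j the weight does not depend on j, and the number k of such j raises the
      exponent d - 1 of the increment to d.\<close>
    also have "\<dots> \<le> (\<Sum>j<N. D1 * (\<Sum>k<N. (if k < Suc j then a j * powr_increment d k else 0)
        + (if j < k then a k * powr_increment d k else 0)))"
      using D1_pos a inc by (intro sum_mono mult_left_mono) (auto simp: max_def)
    also have "\<dots> = D1 * ((\<Sum>j<N. \<Sum>k<N. if k < Suc j then a j * powr_increment d k else 0)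
        + (\<Sum>k<N. \<Sum>j<N. if j < k then a k * powr_increment d k else 0))"
      by (subst sum.swap[of "\<lambda>k j. if j < k then a k * powr_increment d k else 0"])
        (simp add: sum.distrib flip: sum_distrib_left)
    also have "(\<Sum>j<N. \<Sum>k<N. if k < Suc j then a j * powr_increment d k else 0) = ?A"
    proof (rule sum.cong[OF refl])
      fix j assume "j \<in> {..<N}"
      then have "{k. k < N \<and> k < Suc j} = {..<Suc j}" by auto
      then have "(\<Sum>k<N. if k < Suc j then a j * powr_increment d k else 0) = (\<Sum>k<Suc j. a j * powr_increment d k)"
        by (simp add: sum.If_cases Int_def del: sum.lessThan_Suc)
      also have "\<dots> = a j * real (Suc j) powr d"
        by (simp only: sum_powr_increment flip: sum_distrib_left)
      finally show "(\<Sum>k<N. if k < Suc j then a j * powr_increment d k else 0) = a j * real (Suc j) powr d" .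
    qed
    also have "(\<Sum>k<N. \<Sum>j<N. if j < k then a k * powr_increment d k else 0) \<le> (\<Sum>k<N. ?c * (a k * real (Suc k) powr d))"
    proof (rule sum_mono)
      fix k assume "k \<in> {..<N}"
      then have "{j. j < N \<and> j < k} = {..<k}" by auto
      then have "(\<Sum>j<N. if j < k then a k * powr_increment d k else 0) = a k * (real k * powr_increment d k)"
        by (simp add: sum.If_cases Int_def)
      also have "\<dots> \<le> a k * (real (Suc k) * (?c * real (Suc k) powr (d - 1)))"
        using a inc by (intro mult_left_mono mult_mono powr_increment_dim_le) auto
      also have "\<dots> = ?c * (a k * real (Suc k) powr d)"
        by (simp add: powr_diff)
      finally show "(\<Sum>j<N. if j < k then a k * powr_increment d k else 0) \<le> ?c * (a k * real (Suc k) powr d)" .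
    qed
    also have "D1 * (?A + (\<Sum>k<N. ?c * (a k * real (Suc k) powr d))) = D1 * (1 + ?c) * ?A"
      by (simp only: flip: sum_distrib_left) (simp add: algebra_simps)
    finally have near: "(\<Sum>v\<in>B. a (\<rho> u v) * real (\<rho> u v)) \<le> D1 * (1 + ?c) * ?A"
      using D1_pos by simp
    have "(\<Sum>v\<in>F. a (\<rho> u v) * min 1 (real (\<rho> u v) / real N))
      = (\<Sum>v\<in>B. a (\<rho> u v) * min 1 (real (\<rho> u v) / real N)) + (\<Sum>v\<in>{v\<in>F. N \<le> \<rho> u v}. a (\<rho> u v) * min 1 (real (\<rho> u v) / real N))"
      using F by (subst sum.union_disjoint[symmetric]) (auto simp: B_def intro!: sum.cong)
    also have "(\<Sum>v\<in>B. a (\<rho> u v) * min 1 (real (\<rho> u v) / real N)) \<le> (\<Sum>v\<in>B. a (\<rho> u v) * (real (\<rho> u v) / real N))"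
      using a by (intro sum_mono mult_left_mono) auto
    also have "\<dots> = (\<Sum>v\<in>B. a (\<rho> u v) * real (\<rho> u v)) / real N" by (simp add: sum_divide_distrib)
    also have "\<dots> \<le> D1 * (1 + ?c) * ?A / real N"
      using near by (intro divide_right_mono) auto
    finally have "(\<Sum>v\<in>F. a (\<rho> u v) * min 1 (real (\<rho> u v) / real N))
        \<le> D1 * (1 + ?c) * (?A / real N) + C * (P * real N powr (d - \<beta>))" using far by simp
    also have "\<dots> \<le> (C + D1 * (1 + ?c)) * (?A / real N) + (C + D1 * (1 + ?c)) * (P * real N powr (d - \<beta>))"
      using C c D1_pos P A by (intro add_mono mult_right_mono) auto
    finally show "(\<Sum>v\<in>F. a (\<rho> u v) * min 1 (real (\<rho> u v) / real N))
      \<le> (C + D1 * (1 + ?c)) * (?A / real N + P * real N powr (d - \<beta>))" by (simp add: distrib_left)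
  qed
qed

end

section \<open>Local norms of the inverse\<close>

lemma sum_coord_le_norm:
  assumes "finite F"
  shows "(\<Sum>i\<in>F. (cmod (ell2_coord x i))\<^sup>2) \<le> (norm x)\<^sup>2"
proof -
  have sm: "(\<lambda>i. (cmod (ell2_coord x i))\<^sup>2) summable_on UNIV" using ell2_coord by blast
  have "(norm x)\<^sup>2 = (\<Sum>\<^sub>\<infinity>i. (cmod (ell2_coord x i))\<^sup>2)"
    unfolding norm_ell2.rep_eq by (intro real_sqrt_pow2 infsum_nonneg) simp
  then show ?thesis using finite_sum_le_infsum[OF sm assms] by simp
qed

lemma L2_set_coord_le_norm:
  "finite F \<Longrightarrow> L2_set (\<lambda>i. cmod (ell2_coord x i)) F \<le> norm x"
  unfolding L2_set_def by (intro real_le_lsqrt sum_coord_le_norm) simp_all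

lemma norm_ell2_leI:
  assumes "\<And>F. finite F \<Longrightarrow> L2_set (\<lambda>i. cmod (ell2_coord x i)) F \<le> K"
  shows "norm x \<le> K"
proof -
  have sm: "(\<lambda>i. (cmod (ell2_coord x i))\<^sup>2) summable_on UNIV" using ell2_coord by blast
  have K: "0 \<le> K" using assms[of "{}"] by simp
  have "(\<Sum>\<^sub>\<infinity>i. (cmod (ell2_coord x i))\<^sup>2) \<le> K\<^sup>2"
    by (rule infsum_le_finite_sums[OF sm]) (use assms in \<open>auto simp: L2_set_def intro: sqrt_le_D\<close>)
  then show ?thesis unfolding norm_ell2.rep_eq using K by (intro real_le_lsqrt) auto
qed

lemma ell2_coord_Abs_finite:
  assumes "finite B" "\<And>i. i \<notin> B \<Longrightarrow> f i = 0"
  shows "ell2_coord (Abs_ell2 f) = f"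
proof (rule Abs_ell2_inverse)
  have "{i. (cmod (f i))\<^sup>2 \<noteq> 0} \<subseteq> B" using assms(2) by auto
  then have "finite {i. (cmod (f i))\<^sup>2 \<noteq> 0}" using assms(1) finite_subset by blast
  then show "f \<in> {x. (\<lambda>i. (cmod (x i))\<^sup>2) summable_on UNIV}"
    using finite_nonzero_values_imp_summable_on[of UNIV "\<lambda>i. (cmod (f i))\<^sup>2"] by simp
qed

lemma norm_unit_ell2: "norm (unit_ell2 w) = 1"
proof -
  have "(\<Sum>\<^sub>\<infinity>i. (cmod (ell2_coord (unit_ell2 w) i))\<^sup>2) = (\<Sum>\<^sub>\<infinity>i\<in>{w}. (cmod (ell2_coord (unit_ell2 w) i))\<^sup>2)"
    by (rule infsum_cong_neutral) (auto simp: unit_ell2.rep_eq)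
  then show ?thesis unfolding norm_ell2.rep_eq by (simp add: unit_ell2.rep_eq)
qed

text \<open>Cauchy-Schwarz with the kernel split into two square roots: the row sums bound one
  factor, and the column sums appear after exchanging the summations in the other.\<close>

lemma Schur_test:
  fixes k :: "'a \<Rightarrow> 'b \<Rightarrow> real"
  assumes fin: "finite F" "finite B" and k: "\<And>u v. 0 \<le> k u v"
    and row: "\<And>u. u \<in> F \<Longrightarrow> (\<Sum>v\<in>B. k u v) \<le> \<kappa>"
    and col: "\<And>v. v \<in> B \<Longrightarrow> (\<Sum>u\<in>F. k u v) \<le> \<kappa>" and \<kappa>: "0 \<le> \<kappa>"
  shows "L2_set (\<lambda>u. \<Sum>v\<in>B. k u v * y v) F \<le> \<kappa> * L2_set y B"
proof -
  have "(\<Sum>u\<in>F. (\<Sum>v\<in>B. k u v * y v)\<^sup>2) \<le> (\<Sum>u\<in>F. \<kappa> * (\<Sum>v\<in>B. k u v * (y v)\<^sup>2))"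
  proof (rule sum_mono)
    fix u assume u: "u \<in> F"
    have "(\<Sum>v\<in>B. k u v * y v)\<^sup>2 = (\<Sum>v\<in>B. sqrt (k u v) * (sqrt (k u v) * y v))\<^sup>2"
      using k by (simp flip: mult.assoc)
    also have "\<dots> \<le> (\<Sum>v\<in>B. (sqrt (k u v))\<^sup>2) * (\<Sum>v\<in>B. (sqrt (k u v) * y v)\<^sup>2)"
      by (rule Cauchy_Schwarz_ineq_sum)
    also have "\<dots> = (\<Sum>v\<in>B. k u v) * (\<Sum>v\<in>B. k u v * (y v)\<^sup>2)"
      using k by (simp add: power_mult_distrib)
    also have "\<dots> \<le> \<kappa> * (\<Sum>v\<in>B. k u v * (y v)\<^sup>2)"
      using row[OF u] k by (intro mult_right_mono sum_nonneg) auto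
    finally show "(\<Sum>v\<in>B. k u v * y v)\<^sup>2 \<le> \<kappa> * (\<Sum>v\<in>B. k u v * (y v)\<^sup>2)" .
  qed
  also have "\<dots> = \<kappa> * (\<Sum>v\<in>B. (\<Sum>u\<in>F. k u v) * (y v)\<^sup>2)"
    by (simp add: sum.swap[of _ F B] sum_distrib_right flip: sum_distrib_left)
  also have "\<dots> \<le> \<kappa> * (\<Sum>v\<in>B. \<kappa> * (y v)\<^sup>2)"
    using col \<kappa> by (intro mult_left_mono sum_mono mult_right_mono) auto
  also have "\<dots> = \<kappa>\<^sup>2 * (\<Sum>v\<in>B. (y v)\<^sup>2)"
    by (simp add: power2_eq_square flip: sum_distrib_left)
  finally have "sqrt (\<Sum>u\<in>F. (\<Sum>v\<in>B. k u v * y v)\<^sup>2) \<le> sqrt (\<kappa>\<^sup>2 * (\<Sum>v\<in>B. (y v)\<^sup>2))"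
    by (rule real_sqrt_le_mono)
  then show ?thesis using \<kappa> by (simp add: L2_set_def real_sqrt_mult)
qed

context regular_metric
begin

text \<open>Double counting: each v of F lies in at least D2 (N+1) powr d balls of radius N, all of
  whose centers belong to G. This is where the lower bound in normality pays; with the upper bound
  it makes the passage to balls of radius N and back lossless up to D1 / D2.\<close>

lemma sum_le_sum_balls:
  fixes h :: "'v \<Rightarrow> real"
  assumes F: "finite F" and G: "finite G" "\<And>v y. v \<in> F \<Longrightarrow> \<rho> v y \<le> N \<Longrightarrow> y \<in> G"
    and h: "\<And>v. 0 \<le> h v"
  shows "D2 * real (Suc N) powr d * (\<Sum>v\<in>F. h v) \<le> (\<Sum>y\<in>G. \<Sum>v\<in>{v\<in>F. \<rho> v y \<le> N}. h v)"
proof -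
  have "D2 * real (Suc N) powr d * (\<Sum>v\<in>F. h v) \<le> (\<Sum>v\<in>F. \<Sum>y\<in>{y\<in>G. \<rho> v y \<le> N}. h v)"
    unfolding sum_distrib_left
  proof (rule sum_mono)
    fix v assume "v \<in> F"
    then have "{y\<in>G. \<rho> v y \<le> N} = {y. \<rho> v y \<le> N}" using G by auto
    then show "D2 * real (Suc N) powr d * h v \<le> (\<Sum>y\<in>{y\<in>G. \<rho> v y \<le> N}. h v)"
      using card_ball_ge[where u = v and n = N] h[of v] by (simp add: mult_right_mono)
  qed
  also have "\<dots> = (\<Sum>y\<in>G. \<Sum>v\<in>{v\<in>F. \<rho> v y \<le> N}. h v)"
    by (rule sum.swap_restrict[OF F G(1)])
  finally show ?thesis .
qed

text \<open>Stability of A is a statement about l2 norms, so single entries are too fine for it. A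
  local l2 norm still dominates the entry at its center and is at most
  \<open>onorm S\<close>.\<close>

definition local_norm :: "nat \<Rightarrow> ('v ell2 \<Rightarrow> 'v ell2) \<Rightarrow> 'v \<Rightarrow> 'v \<Rightarrow> real" where
  "local_norm N S y w = L2_set (\<lambda>v. cmod (ell2_coord (S (unit_ell2 w)) v)) {v. \<rho> y v \<le> N}"

lemma local_norm_nonneg: "0 \<le> local_norm N S y w"
  by (simp add: local_norm_def)

lemma D2_le_D1: "D2 \<le> D1"
  using card_ball_ge[of 0 undefined] card_ball_le[of undefined 0] by simp

text \<open>Allows the square root of this constant, which counting in l2 produces, to be replaced
  by the constant itself, so that one factor serves both parts of the commutator.\<close>

lemma one_le_density: "1 \<le> D1 / D2 * 5 powr d"
proof -
  have "1 \<le> D1 / D2" using D2_le_D1 D2_pos by simp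
  moreover have "1 \<le> (5::real) powr d" using dim_nonneg by (intro ge_one_powr_ge_zero) auto
  ultimately show ?thesis using mult_mono[of 1 "D1 / D2" 1 "5 powr d"] by simp
qed

text \<open>For a cutoff \<open>\<psi>\<close> at \<open>l\<close> and \<open>x = S e\<^sub>w\<close>, stability gives \<open>\<parallel>\<psi> x\<parallel> \<le> \<parallel>S\<parallel> \<parallel>T (\<psi> x)\<parallel>\<close>, and \<open>T (\<psi> x)\<close> is
  the commutator of \<open>T\<close> and \<open>\<psi>\<close> applied to \<open>x\<close> because \<open>\<psi> (T x) = 0\<close>. The part \<open>p\<close> sees only \<open>x\<close> near
  \<open>l\<close>; by \<open>\<psi> (T x) = 0\<close> again, \<open>q\<close> sees only \<open>x\<close> far from \<open>l\<close>.\<close>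

lemma localized_estimate:
  fixes A :: "'v \<Rightarrow> 'v \<Rightarrow> complex" and a :: "nat \<Rightarrow> real"
  assumes T: "ell2_op_of_matrix A T" and S: "bounded_ell2_op S" and ST: "S \<circ> T = id" and TS: "T \<circ> S = id"
    and a: "antimono a" "\<And>n. 0 \<le> a n" and Aa: "\<And>u v. cmod (A u v) \<le> a (\<rho> u v)"
    and N: "1 \<le> N"
    and \<kappa>: "\<And>F u. finite F \<Longrightarrow> (\<Sum>v\<in>F. a (\<rho> u v) * min 1 (real (\<rho> u v) / real N)) \<le> \<kappa>"
    and lw: "2 * N \<le> \<rho> l w"
    and g: "\<And>y. \<rho> l y \<le> 5 * N \<Longrightarrow> local_norm N S y w \<le> g"
    and Z: "\<And>F. finite F \<Longrightarrow> (\<Sum>y\<in>{y\<in>F. 3 * N \<le> \<rho> l y}. a (\<rho> l y div 3) * local_norm N S y w) \<le> Z"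
  shows "local_norm N S l w \<le> onorm S * (D1 / D2 * 5 powr d * (\<kappa> * g + Z))"
proof -
  define x where "x = ell2_coord (S (unit_ell2 w))"
  define \<psi> :: "'v \<Rightarrow> real" where "\<psi> v = max 0 (min 1 (2 - real (\<rho> l v) / real N))" for v
  \<comment> \<open>The cutoff \<open>\<psi>\<close> vanishes from distance 2 N on. Radius 4 N
    leaves a gap of 2 N between its support and the complement of B4, which makes the tail in q a
    sum over distant entries of A.\<close>
  define B4 where "B4 = {v. \<rho> l v \<le> 4 * N}"
  define m where "m = D2 * real (Suc N) powr d"
  define z where "z = (Abs_ell2 (\<lambda>v. complex_of_real (\<psi> v) * x v) :: 'v ell2)"
  have N0: "0 < real N" using N by simp
  have m: "0 < m" unfolding m_def using D2_pos by simp
  have B4: "finite B4" unfolding B4_def by (rule finite_ball)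
  have \<psi>0: "\<psi> v = 0" if "2 * N \<le> \<rho> l v" for v
  proof -
    have "2 * real N \<le> real (\<rho> l v)" using that by linarith
    then show ?thesis using N0 by (simp add: \<psi>_def le_divide_eq)
  qed
  have \<psi>1: "\<psi> v = 1" if "\<rho> l v \<le> N" for v
    using that N0 by (simp add: \<psi>_def divide_le_eq)
  have \<psi>01: "0 \<le> \<psi> v" "\<psi> v \<le> 1" for v by (auto simp: \<psi>_def)
  have \<psi>_diff: "\<bar>\<psi> v - \<psi> u\<bar> \<le> min 1 (real (\<rho> u v) / real N)" for u v
  proof -
    have "\<bar>real (\<rho> l v) - real (\<rho> l u)\<bar> \<le> real (\<rho> u v)"
      using dist_triangle[of l v u] dist_triangle[of l u v] dist_sym[of u v] by linarith
    then have "\<bar>real (\<rho> l v) / real N - real (\<rho> l u) / real N\<bar> \<le> real (\<rho> u v) / real N"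
      using N0 by (simp add: divide_right_mono flip: diff_divide_distrib)
    moreover have "\<bar>\<psi> v - \<psi> u\<bar> \<le> \<bar>real (\<rho> l v) / real N - real (\<rho> l u) / real N\<bar>"
      unfolding \<psi>_def by (auto simp: max_def min_def abs_if)
    moreover have "\<bar>\<psi> v - \<psi> u\<bar> \<le> 1" using \<psi>01[of u] \<psi>01[of v] by (auto simp: abs_if)
    ultimately show ?thesis by simp
  qed
  have z: "ell2_coord z = (\<lambda>v. complex_of_real (\<psi> v) * x v)"
    unfolding z_def using B4 by (rule ell2_coord_Abs_finite) (auto simp: B4_def intro!: \<psi>0)
  have \<kappa>0: "0 \<le> \<kappa>" using \<kappa>[of "{}"] by simp
  have Z0: "0 \<le> Z" using Z[of "{}"] by simp
  have g0: "0 \<le> g" using g[of l] local_norm_nonneg[of N S l w] dist_self by simp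

  have L_le: "local_norm N S l w \<le> norm z"
  proof -
    have "local_norm N S l w = L2_set (\<lambda>v. cmod (ell2_coord z v)) {v. \<rho> l v \<le> N}"
      unfolding local_norm_def z x_def by (intro L2_set_cong) (auto simp: \<psi>1)
    also have "\<dots> \<le> norm z" by (intro L2_set_coord_le_norm finite_ball)
    finally show ?thesis .
  qed
  have blS: "bounded_linear S" using S by (simp add: bounded_ell2_op_def)
  have "z = S (T z)" using ST by (metis comp_apply id_apply)
  then have norm_z: "norm z \<le> onorm S * norm (T z)" using onorm[OF blS, of "T z"] by simp

  define p where "p u = (\<Sum>v\<in>B4. A u v * complex_of_real (\<psi> v - \<psi> u) * x v)" for u
  define q where "q u = complex_of_real (\<psi> u) * (\<Sum>v\<in>B4. A u v * x v)" for u
  have Tz: "ell2_coord (T z) u = p u + q u" for u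
  proof -
    have "((\<lambda>v. A u v * ell2_coord z v) has_sum ell2_coord (T z) u) UNIV"
      using T by (simp add: ell2_op_of_matrix_def)
    moreover have "((\<lambda>v. A u v * ell2_coord z v) has_sum (\<Sum>v\<in>B4. A u v * ell2_coord z v)) UNIV"
      by (rule has_sum_finite_neutralI[OF B4]) (auto simp: z B4_def intro!: \<psi>0)
    ultimately have "ell2_coord (T z) u = (\<Sum>v\<in>B4. A u v * ell2_coord z v)" by (rule has_sum_unique)
    then show ?thesis
      by (simp add: p_def q_def z sum_distrib_left algebra_simps flip: sum.distrib)
  qed
  have density: "D1 * real (Suc (c * N)) powr d / m \<le> D1 / D2 * real c powr d" if "1 \<le> c" for c
  proof -
    have "real (Suc (c * N)) powr d \<le> (real c * real (Suc N)) powr d"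
      using that dim_nonneg by (intro powr_mono2) (auto simp: algebra_simps)
    then have "D1 * real (Suc (c * N)) powr d \<le> D1 * (real c powr d * real (Suc N) powr d)"
      using D1_pos by (simp add: powr_mult)
    then show ?thesis using m D2_pos by (simp add: m_def field_simps)
  qed

  have p_le: "L2_set (\<lambda>u. cmod (p u)) F \<le> D1 / D2 * 5 powr d * (\<kappa> * g)" if F: "finite F" for F
  proof -
    let ?k = "\<lambda>u v. a (\<rho> u v) * min 1 (real (\<rho> u v) / real N)"
    have "cmod (p u) \<le> (\<Sum>v\<in>B4. ?k u v * cmod (x v))" for u
    proof -
      have "cmod (p u) \<le> (\<Sum>v\<in>B4. cmod (A u v * complex_of_real (\<psi> v - \<psi> u) * x v))"
        unfolding p_def by (rule norm_sum)
      also have "\<dots> \<le> (\<Sum>v\<in>B4. ?k u v * cmod (x v))"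
        unfolding norm_mult norm_of_real using Aa a(2) \<psi>_diff
        by (intro sum_mono mult_right_mono mult_mono) auto
      finally show ?thesis .
    qed
    then have "L2_set (\<lambda>u. cmod (p u)) F \<le> L2_set (\<lambda>u. \<Sum>v\<in>B4. ?k u v * cmod (x v)) F"
      by (intro L2_set_mono) auto
    also have "\<dots> \<le> \<kappa> * L2_set (\<lambda>v. cmod (x v)) B4"
    proof (rule Schur_test[OF F B4 _ _ _ \<kappa>0])
      show "0 \<le> ?k u v" for u v using a by auto
      show "(\<Sum>v\<in>B4. ?k u v) \<le> \<kappa>" for u using \<kappa> B4 .
      show "(\<Sum>u\<in>F. ?k u v) \<le> \<kappa>" for v using \<kappa>[OF F, of v] by (simp add: dist_sym)
    qed
    also have "L2_set (\<lambda>v. cmod (x v)) B4 \<le> D1 / D2 * 5 powr d * g"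
    proof -
      \<comment> \<open>Balls of radius N around the points of B(l, 5 N) cover B4 with multiplicity
        at least m, and each of them carries at most g; the number of centers divided by m gives D1
        / D2 * 5 powr d.\<close>
      define G where "G = {y. \<rho> l y \<le> 5 * N}"
      have G: "finite G" unfolding G_def by (rule finite_ball)
      have "m * (\<Sum>v\<in>B4. (cmod (x v))\<^sup>2) \<le> (\<Sum>y\<in>G. \<Sum>v\<in>{v\<in>B4. \<rho> v y \<le> N}. (cmod (x v))\<^sup>2)"
        unfolding m_def
      proof (rule sum_le_sum_balls[OF B4 G])
        fix v y assume "v \<in> B4" "\<rho> v y \<le> N"
        then show "y \<in> G" using dist_triangle[of l y v] by (simp add: B4_def G_def)
      qed simp
      also have "\<dots> \<le> (\<Sum>y\<in>G. g\<^sup>2)"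
      proof (rule sum_mono)
        fix y assume y: "y \<in> G"
        have "(\<Sum>v\<in>{v\<in>B4. \<rho> v y \<le> N}. (cmod (x v))\<^sup>2) \<le> (\<Sum>v\<in>{v. \<rho> y v \<le> N}. (cmod (x v))\<^sup>2)"
          by (intro sum_mono2 finite_ball) (auto simp: dist_sym)
        also have "\<dots> = (local_norm N S y w)\<^sup>2"
          by (simp add: local_norm_def L2_set_def x_def sum_nonneg)
        also have "\<dots> \<le> g\<^sup>2" using g[of y] y local_norm_nonneg by (intro power_mono) (auto simp: G_def)
        finally show "(\<Sum>v\<in>{v\<in>B4. \<rho> v y \<le> N}. (cmod (x v))\<^sup>2) \<le> g\<^sup>2" .
      qed
      also have "\<dots> \<le> D1 * real (Suc (5 * N)) powr d * g\<^sup>2"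
        using card_ball_le[where u = l and n = "5 * N"] by (simp add: G_def mult_right_mono del: of_nat_Suc)
      finally have "(\<Sum>v\<in>B4. (cmod (x v))\<^sup>2) \<le> (D1 * real (Suc (5 * N)) powr d / m) * g\<^sup>2"
        using m by (simp add: field_simps)
      also have "\<dots> \<le> (D1 / D2 * 5 powr d) * g\<^sup>2"
        using density[of 5] by (intro mult_right_mono) auto
      also have "\<dots> \<le> (D1 / D2 * 5 powr d * g)\<^sup>2"
        unfolding power_mult_distrib[of _ g]
        by (intro mult_right_mono self_le_power one_le_density) auto
      finally show ?thesis
        unfolding L2_set_def using D1_pos D2_pos g0 by (intro real_le_lsqrt) auto
    qed
    finally have "L2_set (\<lambda>u. cmod (p u)) F \<le> \<kappa> * (D1 / D2 * 5 powr d * g)"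
      using \<kappa>0 by (simp add: mult_left_mono)
    then show ?thesis by (simp add: mult_ac)
  qed

  \<comment> \<open>The square root comes from Cauchy-Schwarz on a ball of radius N, and m from
    double counting. The l2 norm over the support of \<open>\<psi>\<close> will supply a second root
    of a ball size, and the two roots together cancel m up to a constant.\<close>
  define Q where "Q = sqrt (D1 * real (Suc N) powr d) / m * Z"
  have Q0: "0 \<le> Q" using m Z0 D1_pos by (simp add: Q_def)
  have tail: "(\<Sum>v\<in>F. cmod (A u v * x v)) \<le> Q"
    if u: "\<rho> l u < 2 * N" and F: "finite F" "F \<subseteq> - B4" for u F
  proof -
    define G where "G = (\<Union>v\<in>F. {y. \<rho> v y \<le> N})"
    have G: "finite G" unfolding G_def using F finite_ball by blast
    have ball_sum: "(\<Sum>v\<in>{v. \<rho> y v \<le> N}. cmod (x v)) \<le> sqrt (D1 * real (Suc N) powr d) * local_norm N S y w" for y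
    proof -
      have "(\<Sum>v\<in>{v. \<rho> y v \<le> N}. cmod (x v)) \<le> L2_set (\<lambda>v. 1) {v. \<rho> y v \<le> N} * L2_set (\<lambda>v. cmod (x v)) {v. \<rho> y v \<le> N}"
        using L2_set_mult_ineq[of "\<lambda>v. 1" "\<lambda>v. cmod (x v)" "{v. \<rho> y v \<le> N}"] by simp
      also have "L2_set (\<lambda>v. 1) {v. \<rho> y v \<le> N} \<le> sqrt (D1 * real (Suc N) powr d)"
        using card_ball_le[where u = y and n = N] by (simp add: L2_set_def)
      finally show ?thesis by (simp add: local_norm_def x_def mult_right_mono)
    qed
    have "m * (\<Sum>v\<in>F. cmod (A u v * x v)) \<le> (\<Sum>y\<in>G. \<Sum>v\<in>{v\<in>F. \<rho> v y \<le> N}. cmod (A u v * x v))"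
      unfolding m_def by (rule sum_le_sum_balls[OF F(1) G]) (auto simp: G_def)
    \<comment> \<open>A ball of radius N whose center is closer to l than 3 N lies inside B4 and
      meets no point of F.\<close>
    also have "\<dots> = (\<Sum>y\<in>{y\<in>G. 3 * N \<le> \<rho> l y}. \<Sum>v\<in>{v\<in>F. \<rho> v y \<le> N}. cmod (A u v * x v))"
    proof (rule sum.mono_neutral_right[OF G])
      show "\<forall>y\<in>G - {y \<in> G. 3 * N \<le> \<rho> l y}. (\<Sum>v\<in>{v\<in>F. \<rho> v y \<le> N}. cmod (A u v * x v)) = 0"
      proof
        fix y assume y: "y \<in> G - {y \<in> G. 3 * N \<le> \<rho> l y}"
        have "{v\<in>F. \<rho> v y \<le> N} = {}"
        proof (rule ccontr)
          assume "{v\<in>F. \<rho> v y \<le> N} \<noteq> {}"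
          then obtain v where v: "v \<in> F" "\<rho> v y \<le> N" by blast
          then have "4 * N < \<rho> l v" using F(2) by (auto simp: B4_def)
          then show False using v(2) y dist_triangle[of l v y] dist_sym[of v y] by auto
        qed
        then show "(\<Sum>v\<in>{v\<in>F. \<rho> v y \<le> N}. cmod (A u v * x v)) = 0" by (simp only: sum.empty)
      qed
    qed auto
    also have "\<dots> \<le> (\<Sum>y\<in>{y\<in>G. 3 * N \<le> \<rho> l y}. sqrt (D1 * real (Suc N) powr d) * (a (\<rho> l y div 3) * local_norm N S y w))"
    proof (rule sum_mono)
      fix y
      have "(\<Sum>v\<in>{v\<in>F. \<rho> v y \<le> N}. cmod (A u v * x v)) \<le> (\<Sum>v\<in>{v\<in>F. \<rho> v y \<le> N}. a (\<rho> l y div 3) * cmod (x v))"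
      proof (rule sum_mono)
        fix v assume v: "v \<in> {v\<in>F. \<rho> v y \<le> N}"
        then have "4 * N < \<rho> l v" using F(2) by (auto simp: B4_def)
        moreover have "\<rho> v y \<le> N" using v by simp
        \<comment> \<open>By the triangle inequality \<open>\<rho> l y\<close> is at most
          \<open>\<rho> u v\<close> + 3 N, while the gap gives \<open>\<rho> u v\<close> > 2 N; the
          factor 3 is a rounded-up consequence.\<close>
        ultimately have "\<rho> l y \<le> 3 * \<rho> u v"
          using u dist_triangle[of l v u] dist_triangle[of l y v] by linarith
        then have "\<rho> l y div 3 \<le> \<rho> u v" by linarith
        then have "cmod (A u v) \<le> a (\<rho> l y div 3)" using Aa[of u v] antimonoD[OF a(1)] by (meson order_trans)
        then show "cmod (A u v * x v) \<le> a (\<rho> l y div 3) * cmod (x v)"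
          unfolding norm_mult by (intro mult_right_mono) auto
      qed
      also have "\<dots> \<le> (\<Sum>v\<in>{v. \<rho> y v \<le> N}. a (\<rho> l y div 3) * cmod (x v))"
        using a by (intro sum_mono2 finite_ball) (auto simp: dist_sym)
      also have "\<dots> = a (\<rho> l y div 3) * (\<Sum>v\<in>{v. \<rho> y v \<le> N}. cmod (x v))" by (simp add: sum_distrib_left)
      also have "\<dots> \<le> a (\<rho> l y div 3) * (sqrt (D1 * real (Suc N) powr d) * local_norm N S y w)"
        using a ball_sum by (intro mult_left_mono) auto
      finally show "(\<Sum>v\<in>{v\<in>F. \<rho> v y \<le> N}. cmod (A u v * x v))
          \<le> sqrt (D1 * real (Suc N) powr d) * (a (\<rho> l y div 3) * local_norm N S y w)" by (simp add: mult_ac)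
    qed
    also have "\<dots> \<le> sqrt (D1 * real (Suc N) powr d) * Z"
      using Z[OF G] D1_pos by (simp only: flip: sum_distrib_left) (intro mult_left_mono, auto)
    finally show ?thesis using m by (simp add: Q_def field_simps)
  qed

  have q_le: "cmod (q u) \<le> (if \<rho> l u \<le> 2 * N then Q else 0)" for u
  proof (cases "\<rho> l u < 2 * N")
    case False
    then show ?thesis using \<psi>0[of u] Q0 by (simp add: q_def)
  next
    case True
    have "T (S (unit_ell2 w)) = unit_ell2 w" using TS by (metis comp_apply id_apply)
    moreover have "u \<noteq> w" using True lw by auto
    ultimately have "ell2_coord (T (S (unit_ell2 w))) u = 0" by (simp add: unit_ell2.rep_eq)
    moreover have "((\<lambda>v. A u v * x v) has_sum ell2_coord (T (S (unit_ell2 w))) u) UNIV"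
      using T unfolding ell2_op_of_matrix_def x_def by blast
    ultimately have "((\<lambda>v. A u v * x v) has_sum 0) UNIV" by simp
    \<comment> \<open>Row u of A annihilates x because u differs from w, so the sum over B4 is minus
      the sum over the complement. The latter is a limit of finite sums, each bounded by Q.\<close>
    then have "((\<lambda>v. A u v * x v) has_sum (0 - (\<Sum>v\<in>B4. A u v * x v))) (UNIV - B4)"
      by (intro has_sum_Diff has_sum_finite B4) auto
    then have lim: "(sum (\<lambda>v. A u v * x v) \<longlongrightarrow> - (\<Sum>v\<in>B4. A u v * x v)) (finite_subsets_at_top (- B4))"
      by (simp add: has_sum_def Compl_eq_Diff_UNIV)
    have "cmod (- (\<Sum>v\<in>B4. A u v * x v)) \<le> Q"
    proof (rule tendsto_upperbound[OF tendsto_norm[OF lim]])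
      show "\<forall>\<^sub>F F in finite_subsets_at_top (- B4). cmod (\<Sum>v\<in>F. A u v * x v) \<le> Q"
        by (rule eventually_finite_subsets_at_top_weakI) (rule order_trans[OF norm_sum tail[OF True]])
    qed simp
    then have "\<psi> u * cmod (\<Sum>v\<in>B4. A u v * x v) \<le> 1 * Q"
      using \<psi>01[of u] by (intro mult_mono) auto
    then show ?thesis using True \<psi>01[of u] by (simp add: q_def norm_mult)
  qed
  have q_L2: "L2_set (\<lambda>u. cmod (q u)) F \<le> D1 / D2 * 5 powr d * Z" if F: "finite F" for F
  proof -
    have "(\<Sum>u\<in>F. (cmod (q u))\<^sup>2) \<le> (\<Sum>u\<in>F. (if \<rho> l u \<le> 2 * N then Q\<^sup>2 else 0))"
    proof (rule sum_mono)
      show "(cmod (q u))\<^sup>2 \<le> (if \<rho> l u \<le> 2 * N then Q\<^sup>2 else 0)" for u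
        using power_mono[OF q_le[of u], of 2] by (simp split: if_splits)
    qed
    also have "\<dots> = (\<Sum>u\<in>{u\<in>F. \<rho> l u \<le> 2 * N}. Q\<^sup>2)"
      using F by (simp add: sum.inter_filter[symmetric])
    also have "\<dots> \<le> (\<Sum>u\<in>{u. \<rho> l u \<le> 2 * N}. Q\<^sup>2)"
      by (intro sum_mono2 finite_ball) auto
    also have "\<dots> \<le> D1 * real (Suc (2 * N)) powr d * Q\<^sup>2"
      using card_ball_le[where u = l and n = "2 * N"] by (simp add: mult_right_mono del: of_nat_Suc)
    also have "\<dots> = (D1 * real (Suc (2 * N)) powr d / m) * (D1 * real (Suc (1 * N)) powr d / m) * Z\<^sup>2"
      using D1_pos m by (simp add: Q_def power_mult_distrib power_divide power2_eq_square)
    also have "\<dots> \<le> (D1 / D2 * real 2 powr d) * (D1 / D2 * real 1 powr d) * Z\<^sup>2"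
      using density[of 2] density[of 1] D1_pos D2_pos m
      by (intro mult_right_mono mult_mono) (auto intro!: divide_nonneg_pos)
    also have "\<dots> \<le> (D1 / D2 * 5 powr d) * (D1 / D2 * 5 powr d) * Z\<^sup>2"
      using D1_pos D2_pos dim_nonneg
      by (intro mult_right_mono mult_mono mult_left_mono powr_mono2) auto
    also have "\<dots> = (D1 / D2 * 5 powr d * Z)\<^sup>2" by (simp add: power2_eq_square)
    finally show ?thesis
      unfolding L2_set_def using D1_pos D2_pos Z0 by (intro real_le_lsqrt) auto
  qed
  have "norm (T z) \<le> D1 / D2 * 5 powr d * (\<kappa> * g + Z)"
  proof (rule norm_ell2_leI)
    fix F :: "'v set" assume F: "finite F"
    have "L2_set (\<lambda>u. cmod (ell2_coord (T z) u)) F \<le> L2_set (\<lambda>u. cmod (p u) + cmod (q u)) F"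
      unfolding Tz by (intro L2_set_mono norm_triangle_ineq) auto
    also have "\<dots> \<le> L2_set (\<lambda>u. cmod (p u)) F + L2_set (\<lambda>u. cmod (q u)) F"
      by (rule L2_set_triangle_ineq)
    also have "\<dots> \<le> D1 / D2 * 5 powr d * (\<kappa> * g + Z)"
      using p_le[OF F] q_L2[OF F] by (simp add: distrib_left)
    finally show "L2_set (\<lambda>u. cmod (ell2_coord (T z) u)) F \<le> D1 / D2 * 5 powr d * (\<kappa> * g + Z)" .
  qed
  then have "onorm S * norm (T z) \<le> onorm S * (D1 / D2 * 5 powr d * (\<kappa> * g + Z))"
    using onorm_pos_le[OF blS] by (rule mult_left_mono)
  then show ?thesis using L_le norm_z by linarith
qed

end

text \<open>The vertices y in the far term are divided by their distance to w. Beyond n div 2 the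
  local norm is at most f (n div 2), and the values of a add up to at most \<tau>. Otherwise y is at
  distance at least n div 2 from l, so a contributes at most a (n div 6), and the local norms are
  summed by their distance to w.\<close>

lemma (in regular_metric) local_norm_recursion:
  fixes A :: "'v \<Rightarrow> 'v \<Rightarrow> complex" and a :: "nat \<Rightarrow> real"
  assumes T: "ell2_op_of_matrix A T" and S: "bounded_ell2_op S" and ST: "S \<circ> T = id" and TS: "T \<circ> S = id"
    and a: "antimono a" "\<And>n. 0 \<le> a n" and Aa: "\<And>u v. cmod (A u v) \<le> a (\<rho> u v)"
    and N: "1 \<le> N"
    and \<kappa>: "\<And>F u. finite F \<Longrightarrow> (\<Sum>v\<in>F. a (\<rho> u v) * min 1 (real (\<rho> u v) / real N)) \<le> \<kappa>"
    and \<tau>: "\<And>F u. finite F \<Longrightarrow> (\<Sum>v\<in>{v\<in>F. 3 * N \<le> \<rho> u v}. a (\<rho> u v div 3)) \<le> \<tau>"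
  obtains f where "antimono f" "\<And>n. 0 \<le> f n" "\<And>n. f n \<le> onorm S"
    "\<And>u w. cmod (matrix_of_ell2_op S u w) \<le> f (\<rho> u w)"
    "\<And>n. 10 * N \<le> n \<Longrightarrow> f n \<le> onorm S * (D1 / D2 * 5 powr d *
      ((\<kappa> + \<tau>) * f (n div 2) + a (n div 6) * (D1 * (\<Sum>k<Suc (n div 2). f k * powr_increment d k))))"
proof
  have blS: "bounded_linear S" using S by (simp add: bounded_ell2_op_def)
  have s0: "0 \<le> onorm S" by (rule onorm_pos_le[OF blS])
  have L_le: "local_norm N S y w \<le> onorm S" for y w
    using L2_set_coord_le_norm[OF finite_ball, of "S (unit_ell2 w)" y N] onorm[OF blS, of "unit_ell2 w"]
    by (simp add: local_norm_def norm_unit_ell2)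
  \<comment> \<open>The element 0 covers the case that n exceeds the diameter: there are no pairs
    then, and a supremum of the empty set of reals would be unspecified.\<close>
  define X where "X n = insert 0 {local_norm N S l w | l w. n \<le> \<rho> l w}" for n
  define f where "f n = Sup (X n)" for n
  have bdd: "bdd_above (X n)" for n
    by (rule bdd_aboveI[of _ "onorm S"]) (use L_le s0 in \<open>auto simp: X_def\<close>)
  have Lf: "local_norm N S l w \<le> f n" if "n \<le> \<rho> l w" for l w n
    unfolding f_def by (rule cSup_upper[OF _ bdd]) (use that in \<open>auto simp: X_def\<close>)
  show f0: "0 \<le> f n" for n
    unfolding f_def by (rule cSup_upper[OF _ bdd]) (simp add: X_def)
  have f_leI: "f n \<le> c" if "0 \<le> c" "\<And>l w. n \<le> \<rho> l w \<Longrightarrow> local_norm N S l w \<le> c" for n c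
    unfolding f_def by (rule cSup_least) (use that in \<open>auto simp: X_def\<close>)
  show "antimono f"
    by (intro antimonoI f_leI f0) (auto intro: Lf)
  show "f n \<le> onorm S" for n using f_leI s0 L_le by blast
  show "cmod (matrix_of_ell2_op S u w) \<le> f (\<rho> u w)" for u w
  proof -
    have "cmod (matrix_of_ell2_op S u w) \<le> local_norm N S u w"
      unfolding local_norm_def matrix_of_ell2_op_def
      by (rule member_le_L2_set) (auto simp: finite_ball dist_self)
    also have "\<dots> \<le> f (\<rho> u w)" by (rule Lf) simp
    finally show ?thesis .
  qed
  fix n assume n: "10 * N \<le> n"
  let ?I = "\<Sum>k<Suc (n div 2). f k * powr_increment d k"
  have I0: "0 \<le> ?I" using f0 powr_increment_nonneg[OF dim_nonneg] by (intro sum_nonneg mult_nonneg_nonneg) auto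
  have \<kappa>0: "0 \<le> \<kappa>" using \<kappa>[of "{}"] by simp
  have \<tau>0: "0 \<le> \<tau>" using \<tau>[of "{}"] by simp
  show "f n \<le> onorm S * (D1 / D2 * 5 powr d *
      ((\<kappa> + \<tau>) * f (n div 2) + a (n div 6) * (D1 * ?I)))" (is "_ \<le> ?bound")
  proof (rule f_leI)
    show "0 \<le> ?bound"
      using s0 D1_pos D2_pos \<kappa>0 \<tau>0 f0 a I0 by (intro mult_nonneg_nonneg add_nonneg_nonneg divide_nonneg_nonneg) auto
    fix l w assume lw: "n \<le> \<rho> l w"
    have "local_norm N S l w \<le> onorm S * (D1 / D2 * 5 powr d * (\<kappa> * f (n div 2) + (\<tau> * f (n div 2) + a (n div 6) * (D1 * ?I))))"
    proof (rule localized_estimate[OF T S ST TS a Aa N \<kappa>])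
      show "2 * N \<le> \<rho> l w" using lw n by simp
      show "local_norm N S y w \<le> f (n div 2)" if "\<rho> l y \<le> 5 * N" for y
      proof (rule Lf)
        \<comment> \<open>The threshold 10 N is made for this: moving by 5 N away from l uses at
          most half of the distance to w.\<close>
        show "n div 2 \<le> \<rho> y w" using that lw n dist_triangle[of l w y] by linarith
      qed
      fix F :: "'v set" assume F: "finite F"
      let ?F = "{y\<in>F. 3 * N \<le> \<rho> l y}"
      have "(\<Sum>y\<in>?F. a (\<rho> l y div 3) * local_norm N S y w)
        \<le> (\<Sum>y\<in>?F. a (\<rho> l y div 3) * f (n div 2) + (if \<rho> w y < Suc (n div 2) then a (n div 6) * f (\<rho> w y) else 0))"
      proof (rule sum_mono)
        fix y
        show "a (\<rho> l y div 3) * local_norm N S y w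
          \<le> a (\<rho> l y div 3) * f (n div 2) + (if \<rho> w y < Suc (n div 2) then a (n div 6) * f (\<rho> w y) else 0)"
        proof (cases "\<rho> w y < Suc (n div 2)")
          case True
          then have "n div 2 \<le> \<rho> l y" using lw dist_triangle[of l w y] dist_sym[of w y] by linarith
          then have "n div 6 \<le> \<rho> l y div 3" using div_le_mono[of "n div 2" "\<rho> l y" 3] by (simp add: div_mult2_eq[symmetric])
          then have "a (\<rho> l y div 3) * local_norm N S y w \<le> a (n div 6) * f (\<rho> w y)"
            using antimonoD[OF a(1)] a(2) Lf[of "\<rho> w y" y w] local_norm_nonneg dist_sym[of w y] by (intro mult_mono) auto
          moreover have "0 \<le> a (\<rho> l y div 3) * f (n div 2)" using a f0 by simp
          ultimately show ?thesis using True by simp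
        next
          case False
          then have "local_norm N S y w \<le> f (n div 2)" using dist_sym[of w y] by (intro Lf) simp
          then show ?thesis using False a by (simp add: mult_left_mono)
        qed
      qed
      also have "\<dots> = (\<Sum>y\<in>?F. a (\<rho> l y div 3)) * f (n div 2) + a (n div 6) * (\<Sum>y\<in>{y\<in>?F. \<rho> w y < Suc (n div 2)}. f (\<rho> w y))"
        using F sum.inter_filter[of ?F "\<lambda>y. a (n div 6) * f (\<rho> w y)" "\<lambda>y. \<rho> w y < Suc (n div 2)"]
        by (simp add: sum.distrib sum_distrib_left sum_distrib_right)
      also have "\<dots> \<le> \<tau> * f (n div 2) + a (n div 6) * (D1 * ?I)"
        using \<tau>[OF F, of l] f0 a F \<open>antimono f\<close>
        by (intro add_mono mult_right_mono mult_left_mono sum_dist_less_le) auto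
      finally show "(\<Sum>y\<in>?F. a (\<rho> l y div 3) * local_norm N S y w) \<le> \<tau> * f (n div 2) + a (n div 6) * (D1 * ?I)" .
    qed
    then show "local_norm N S l w \<le> ?bound" by (simp add: algebra_simps)
  qed
qed

section \<open>Sequences satisfying the recursion\<close>

lemma Suc_div_powr_le:
  fixes \<beta> :: real
  assumes "0 \<le> \<beta>" "0 < c"
  shows "real (Suc (n div c)) powr (-\<beta>) \<le> real c powr \<beta> * real (Suc n) powr (-\<beta>)"
proof -
  have "n < c * Suc (n div c)" using assms dividend_less_times_div by auto
  then have "Suc n \<le> c * Suc (n div c)" by simp
  then have "real (Suc n) \<le> real c * real (Suc (n div c))" unfolding of_nat_mult[symmetric] of_nat_le_iff .
  then have "real (Suc (n div c)) powr (-\<beta>) \<le> real c powr \<bar>-\<beta>\<bar> * real (Suc n) powr (-\<beta>)"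
    by (intro powr_le_mult_powr(2)) (auto simp: div_le_dividend)
  then show ?thesis using assms by simp
qed

text \<open>Strong induction with K and H fixed in advance. The sum in the coefficient runs only
  over k up to n div 2, which is below n, so the induction hypothesis already bounds it by H s N
  powr d.\<close>

lemma recursion_pointwise_decay:
  fixes d \<beta> c :: real
  assumes d: "0 \<le> d" "d < \<beta>" and c: "0 \<le> c"
  obtains \<delta> K H where "0 < \<delta>" "0 < K" "0 < H"
    "\<And>f a s P N. \<lbrakk>\<And>n. 0 \<le> f n; \<And>n. f n \<le> s; \<And>n. 0 \<le> a n;
      \<And>n. a n \<le> P * real (Suc n) powr (-\<beta>); 1 \<le> N; s * P * real N powr (d - \<beta>) \<le> \<delta>;
      \<And>n. 10 * N \<le> n \<Longrightarrow> f n \<le> \<delta> * f (n div 2) + c * s * a (n div 6) * (\<Sum>k<Suc (n div 2). f k * powr_increment d k)\<rbrakk>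
      \<Longrightarrow> (\<forall>n. f n \<le> K * s * real N powr \<beta> * real (Suc n) powr (-\<beta>)) \<and>
          (\<forall>m. (\<Sum>k<m. f k * powr_increment d k) \<le> H * s * real N powr d)"
proof -
  let ?c = "d * 2 powr \<bar>d - 1\<bar> + 1"
  have c': "0 < ?c" using d by (simp add: add_nonneg_pos)
  obtain C where C: "0 < C" "\<And>j R. (\<Sum>k\<in>{j..<R}. real (Suc k) powr (- (\<beta> - d) - 1)) \<le> C * real (Suc j) powr (- (\<beta> - d))"
    using sum_powr_tail[of "\<beta> - d"] d by auto
  \<comment> \<open>With this K the claim for n < 10 N is weaker than f n \<le> s.\<close>
  define K where "K = (10::real) powr \<beta>"
  define H where "H = 1 + K * ?c * C"
  \<comment> \<open>Chosen so that
    \<open>\<delta> * (K * 2 powr \<beta> + c * 6 powr \<beta> * H) = K\<close>: the powers of 2 and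
    6 are the losses from n div 2 and n div 6, and the induction closes with the same K.\<close>
  define \<delta> where "\<delta> = K / (K * 2 powr \<beta> + c * 6 powr \<beta> * H)"
  have K: "0 < K" by (simp add: K_def)
  have H: "0 < H" unfolding H_def using K c' C by (simp add: add_pos_pos)
  have den: "0 < K * 2 powr \<beta> + c * 6 powr \<beta> * H" using K H c by (simp add: add_pos_nonneg)
  have \<delta>: "0 < \<delta>" unfolding \<delta>_def using K den by simp
  show ?thesis
  proof (rule that[OF \<delta> K H])
    fix f a :: "nat \<Rightarrow> real" and s P :: real and N :: nat
    assume f: "\<And>n. 0 \<le> f n" "\<And>n. f n \<le> s" and a: "\<And>n. 0 \<le> a n" "\<And>n. a n \<le> P * real (Suc n) powr (-\<beta>)"
      and N: "1 \<le> N" and sP: "s * P * real N powr (d - \<beta>) \<le> \<delta>"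
      and rec: "\<And>n. 10 * N \<le> n \<Longrightarrow> f n \<le> \<delta> * f (n div 2) + c * s * a (n div 6) * (\<Sum>k<Suc (n div 2). f k * powr_increment d k)"
    have s: "0 \<le> s" using f[of 0] by simp
    have inc: "0 \<le> powr_increment d k" for k by (rule powr_increment_nonneg[OF d(1)])
    have Hsum: "(\<Sum>k<m. f k * powr_increment d k) \<le> H * s * real N powr d"
      if IH: "\<And>k. k < m \<Longrightarrow> f k \<le> K * s * real N powr \<beta> * real (Suc k) powr (-\<beta>)" for m
    proof -
      \<comment> \<open>Up to N the bound s is used and gives s N powr d. Beyond N the decay is
        summable because \<beta> > d, and the tail N powr (d - \<beta>) turns N powr \<beta> into N
        powr d again.\<close>
      have "(\<Sum>k<m. f k * powr_increment d k) \<le> (\<Sum>k\<in>{..<N} \<union> {N..<m}. f k * powr_increment d k)"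
        using f inc by (intro sum_mono2) auto
      also have "\<dots> = (\<Sum>k<N. f k * powr_increment d k) + (\<Sum>k\<in>{N..<m}. f k * powr_increment d k)"
        by (intro sum.union_disjoint) auto
      also have "(\<Sum>k<N. f k * powr_increment d k) \<le> (\<Sum>k<N. s * powr_increment d k)"
        using f inc by (intro sum_mono mult_right_mono) auto
      also have "\<dots> = s * real N powr d" by (simp only: sum_powr_increment flip: sum_distrib_left)
      also have "(\<Sum>k\<in>{N..<m}. f k * powr_increment d k)
          \<le> (\<Sum>k\<in>{N..<m}. K * s * real N powr \<beta> * ?c * real (Suc k) powr (- (\<beta> - d) - 1))"
      proof (rule sum_mono)
        fix k assume k: "k \<in> {N..<m}"
        have "f k * powr_increment d k \<le> (K * s * real N powr \<beta> * real (Suc k) powr (-\<beta>)) * (?c * real (Suc k) powr (d - 1))"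
          using IH[of k] k K s inc powr_increment_le[OF d(1), of k] unfolding powr_increment_def[symmetric]
          by (intro mult_mono) auto
        also have "\<dots> = K * s * real N powr \<beta> * ?c * (real (Suc k) powr (-\<beta>) * real (Suc k) powr (d - 1))"
          by (simp add: mult_ac)
        also have "real (Suc k) powr (-\<beta>) * real (Suc k) powr (d - 1) = real (Suc k) powr (- (\<beta> - d) - 1)"
          by (simp add: algebra_simps flip: powr_add)
        finally show "f k * powr_increment d k \<le> K * s * real N powr \<beta> * ?c * real (Suc k) powr (- (\<beta> - d) - 1)" .
      qed
      also have "\<dots> = K * s * real N powr \<beta> * ?c * (\<Sum>k\<in>{N..<m}. real (Suc k) powr (- (\<beta> - d) - 1))"
        by (simp only: sum_distrib_left)
      also have "\<dots> \<le> K * s * real N powr \<beta> * ?c * (C * real (Suc N) powr (- (\<beta> - d)))"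
        using C(2)[of N m] K s c' by (intro mult_left_mono) auto
      also have "\<dots> \<le> K * s * real N powr \<beta> * ?c * (C * real N powr (- (\<beta> - d)))"
        using C(1) K s c' N d by (intro mult_left_mono powr_mono2') auto
      also have "\<dots> = K * ?c * C * s * (real N powr \<beta> * real N powr (- (\<beta> - d)))"
        by (simp add: mult_ac)
      also have "real N powr \<beta> * real N powr (- (\<beta> - d)) = real N powr d"
        by (simp flip: powr_add)
      finally show ?thesis by (simp add: H_def algebra_simps)
    qed
    have bound: "f n \<le> K * s * real N powr \<beta> * real (Suc n) powr (-\<beta>)" for n
    proof (induction n rule: less_induct)
      case (less n)
      show ?case
      proof (cases "n < 10 * N")
        case True
        have "1 = real (Suc n) powr \<beta> * real (Suc n) powr (-\<beta>)" by (simp flip: powr_add)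
        also have "\<dots> \<le> (10 * real N) powr \<beta> * real (Suc n) powr (-\<beta>)"
          using True d by (intro mult_right_mono powr_mono2) auto
        finally have "s * 1 \<le> s * ((10 * real N) powr \<beta> * real (Suc n) powr (-\<beta>))"
          using s by (intro mult_left_mono) auto
        also have "\<dots> = K * s * real N powr \<beta> * real (Suc n) powr (-\<beta>)"
          using N by (simp add: K_def powr_mult mult_ac)
        finally show ?thesis using f(2)[of n] by simp
      next
        case False
        then have n: "10 * N \<le> n" "n div 2 < n" using N by auto
        let ?w = "real (Suc n) powr (-\<beta>)"
        have "f (n div 2) \<le> K * s * real N powr \<beta> * real (Suc (n div 2)) powr (-\<beta>)"
          using less n(2) by blast
        also have "\<dots> \<le> K * s * real N powr \<beta> * (real 2 powr \<beta> * ?w)"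
          using K s d by (intro mult_left_mono Suc_div_powr_le) auto
        finally have 1: "\<delta> * f (n div 2) \<le> \<delta> * (K * s * real N powr \<beta> * (2 powr \<beta> * ?w))"
          using \<delta> by (intro mult_left_mono) auto
        have P: "0 \<le> P" using a(1)[of 0] a(2)[of 0] by simp
        have "a (n div 6) \<le> P * real (Suc (n div 6)) powr (-\<beta>)" by (rule a)
        also have "\<dots> \<le> P * (real 6 powr \<beta> * ?w)"
          using P d by (intro mult_left_mono Suc_div_powr_le) auto
        finally have a6: "a (n div 6) \<le> P * (6 powr \<beta> * ?w)" by simp
        have "(\<Sum>k<Suc (n div 2). f k * powr_increment d k) \<le> H * s * real N powr d"
          using n by (intro Hsum less) auto
        then have "c * s * a (n div 6) * (\<Sum>k<Suc (n div 2). f k * powr_increment d k)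
            \<le> c * s * (P * (6 powr \<beta> * ?w)) * (H * s * real N powr d)"
          using a6 c s a f inc P by (intro mult_mono sum_nonneg mult_nonneg_nonneg) auto
        also have "\<dots> = (s * P * real N powr (d - \<beta>)) * (c * 6 powr \<beta> * H * s * real N powr \<beta> * ?w)"
          using N by (simp add: powr_diff mult_ac)
        also have "\<dots> \<le> \<delta> * (c * 6 powr \<beta> * H * s * real N powr \<beta> * ?w)"
          using sP c H s by (intro mult_right_mono) auto
        finally have 2: "c * s * a (n div 6) * (\<Sum>k<Suc (n div 2). f k * powr_increment d k)
            \<le> \<delta> * (c * 6 powr \<beta> * H * s * real N powr \<beta> * ?w)" .
        have "f n \<le> \<delta> * (K * s * real N powr \<beta> * (2 powr \<beta> * ?w)) + \<delta> * (c * 6 powr \<beta> * H * s * real N powr \<beta> * ?w)"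
          using rec[OF n(1)] 1 2 by linarith
        also have "\<dots> = (\<delta> * (K * 2 powr \<beta> + c * 6 powr \<beta> * H)) * (s * real N powr \<beta> * ?w)"
          by (simp add: algebra_simps)
        also have "\<delta> * (K * 2 powr \<beta> + c * 6 powr \<beta> * H) = K" using den by (simp add: \<delta>_def)
        finally show ?thesis by (simp add: mult_ac)
      qed
    qed
    then show "(\<forall>n. f n \<le> K * s * real N powr \<beta> * real (Suc n) powr (-\<beta>)) \<and>
          (\<forall>m. (\<Sum>k<m. f k * powr_increment d k) \<le> H * s * real N powr d)"
      using Hsum by blast
  qed
qed

lemma add_powr_le:
  fixes x y r :: real
  assumes "0 \<le> x" "0 \<le> y" "0 \<le> r"
  shows "(x + y) powr r \<le> 2 powr r * (x powr r + y powr r)"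
proof -
  have "(x + y) powr r \<le> (2 * max x y) powr r" using assms by (intro powr_mono2) auto
  also have "\<dots> = 2 powr r * (max x y) powr r" using assms by (simp add: powr_mult)
  also have "(max x y) powr r \<le> x powr r + y powr r" by (simp add: max_def)
  finally show ?thesis by simp
qed

text \<open>Absorption: the values f (n div 2) for n < R only involve the same partial sum X, up to
  a constant, and a small \<delta> brings back at most half of X. Since X is finite, this half can
  be subtracted; the rest comes from n < 10 N and from the weighted norm of a.\<close>

lemma recursion_summable_decay:
  fixes \<beta> r c :: real
  assumes \<beta>: "0 < \<beta>" and r: "1 \<le> r" and c: "0 \<le> c"
  obtains \<delta> K where "0 < \<delta>" "0 < K"
    "\<And>f a s M G N R. \<lbrakk>\<And>n. 0 \<le> f n; \<And>n. f n \<le> s; \<And>n. 0 \<le> a n; 0 \<le> G; 0 \<le> M; 1 \<le> N;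
      \<And>R. (\<Sum>n<R. a n powr r * real (Suc n) powr (\<beta> * r - 1)) \<le> M powr r;
      G * M \<le> c * s * real N powr \<beta>;
      \<And>n. 10 * N \<le> n \<Longrightarrow> f n \<le> \<delta> * f (n div 2) + G * a (n div 6)\<rbrakk>
      \<Longrightarrow> (\<Sum>n<R. f n powr r * real (Suc n) powr (\<beta> * r - 1)) \<le> K * (s * real N powr \<beta>) powr r"
proof -
  define e where "e = \<beta> * r - 1"
  \<comment> \<open>The exponent collects r from the inequality for (x + y) powr r, |e| + 1 from the
    halved argument, and 1 for the target 1/2. As \<delta> \<le> 1 and r \<ge> 1,
    \<open>\<delta> powr r\<close> may be replaced by \<delta>.\<close>
  define \<delta> where "\<delta> = (2::real) powr (- (r + \<bar>e\<bar> + 2))"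
  have \<beta>r: "0 < \<beta> * r" using \<beta> r by simp
  obtain C where C: "0 < C" "\<And>n. (\<Sum>k<n. real (Suc k) powr (\<beta> * r - 1)) \<le> C * real n powr (\<beta> * r)"
    using sum_powr_le[OF \<beta>r] by blast
  define K where "K = 2 * (C * 10 powr (\<beta> * r) + 2 powr r * 6 powr (\<bar>e\<bar> + 1) * c powr r)"
  have K: "0 < K" unfolding K_def using C by (intro mult_pos_pos add_pos_nonneg) auto
  have \<delta>: "0 < \<delta>" by (simp add: \<delta>_def)
  have "\<delta> \<le> 2 powr 0"
    unfolding \<delta>_def using r by (intro powr_mono) auto
  then have "\<delta> powr r \<le> \<delta> powr 1"
    using r \<delta> by (intro powr_mono') auto
  then have "2 powr r * \<delta> powr r * 2 powr (\<bar>e\<bar> + 1) \<le> 2 powr r * \<delta> * 2 powr (\<bar>e\<bar> + 1)"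
    using \<delta> by simp
  also have "\<dots> = 2 powr (-1::real)"
    unfolding \<delta>_def by (simp add: algebra_simps flip: powr_add)
  finally have half: "2 powr r * \<delta> powr r * 2 powr (\<bar>e\<bar> + 1) \<le> 1 / 2" by (simp add: powr_minus)
  show ?thesis
  proof (rule that[OF \<delta> K])
    fix f a :: "nat \<Rightarrow> real" and s M G :: real and N R :: nat
    assume f: "\<And>n. 0 \<le> f n" "\<And>n. f n \<le> s" and a: "\<And>n. 0 \<le> a n" and G: "0 \<le> G" and M: "0 \<le> M" and N: "1 \<le> N"
      and aM: "\<And>R. (\<Sum>n<R. a n powr r * real (Suc n) powr (\<beta> * r - 1)) \<le> M powr r"
      and GM: "G * M \<le> c * s * real N powr \<beta>"
      and rec: "\<And>n. 10 * N \<le> n \<Longrightarrow> f n \<le> \<delta> * f (n div 2) + G * a (n div 6)"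
    let ?w = "\<lambda>n. real (Suc n) powr e"
    have s: "0 \<le> s" using f[of 0] by simp
    define X where "X = (\<Sum>n<R. f n powr r * ?w n)"
    have "f n powr r * ?w n \<le> (if n < 10 * N then s powr r * ?w n else 0)
        + 2 powr r * \<delta> powr r * (f (n div 2) powr r * ?w n) + 2 powr r * G powr r * (a (n div 6) powr r * ?w n)" for n
    proof (cases "n < 10 * N")
      case True
      have "f n powr r * ?w n \<le> s powr r * ?w n" using f r by (intro mult_right_mono powr_mono2) auto
      then show ?thesis using True by (simp add: add_increasing2)
    next
      case False
      then have "f n powr r \<le> (\<delta> * f (n div 2) + G * a (n div 6)) powr r"
        using rec[of n] f r by (intro powr_mono2) auto
      also have "\<dots> \<le> 2 powr r * ((\<delta> * f (n div 2)) powr r + (G * a (n div 6)) powr r)"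
        using \<delta> f G a r by (intro add_powr_le) auto
      also have "\<dots> = 2 powr r * (\<delta> powr r * f (n div 2) powr r + G powr r * a (n div 6) powr r)"
        using \<delta> f G a by (simp add: powr_mult)
      finally have "f n powr r * ?w n \<le> 2 powr r * (\<delta> powr r * f (n div 2) powr r + G powr r * a (n div 6) powr r) * ?w n"
        by (rule mult_right_mono) auto
      then show ?thesis using False by (simp add: algebra_simps)
    qed
    then have "X \<le> (\<Sum>n<R. (if n < 10 * N then s powr r * ?w n else 0)
        + 2 powr r * \<delta> powr r * (f (n div 2) powr r * ?w n) + 2 powr r * G powr r * (a (n div 6) powr r * ?w n))"
      unfolding X_def by (rule sum_mono)
    also have "\<dots> = (\<Sum>n<R. (if n < 10 * N then s powr r * ?w n else 0))
        + 2 powr r * \<delta> powr r * (\<Sum>n<R. f (n div 2) powr r * ?w n)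
        + 2 powr r * G powr r * (\<Sum>n<R. a (n div 6) powr r * ?w n)"
      by (simp add: sum.distrib sum_distrib_left)
    also have "(\<Sum>n<R. (if n < 10 * N then s powr r * ?w n else 0)) \<le> (\<Sum>n<10 * N. s powr r * ?w n)"
      by (subst sum.inter_filter[symmetric]) (auto intro!: sum_mono2)
    also have "\<dots> \<le> s powr r * (C * real (10 * N) powr (\<beta> * r))"
      unfolding sum_distrib_left[symmetric] e_def by (intro mult_left_mono C) auto
    also have "\<dots> = C * 10 powr (\<beta> * r) * (s * real N powr \<beta>) powr r"
      using s by (simp add: powr_mult powr_powr)
    also have "2 powr r * \<delta> powr r * (\<Sum>n<R. f (n div 2) powr r * ?w n)
        \<le> 2 powr r * \<delta> powr r * (real 2 powr (\<bar>e\<bar> + 1) * X)"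
      unfolding X_def by (intro mult_left_mono sum_div_weight_le[where g = "\<lambda>n. f n powr r"]) auto
    also have "\<dots> = (2 powr r * \<delta> powr r * 2 powr (\<bar>e\<bar> + 1)) * X" by simp
    also have "\<dots> \<le> 1 / 2 * X" using half f by (intro mult_right_mono) (auto simp: X_def intro!: sum_nonneg)
    also have "2 powr r * G powr r * (\<Sum>n<R. a (n div 6) powr r * ?w n)
        \<le> 2 powr r * G powr r * (real 6 powr (\<bar>e\<bar> + 1) * (\<Sum>n<R. a n powr r * ?w n))"
      by (intro mult_left_mono sum_div_weight_le[where g = "\<lambda>n. a n powr r"]) auto
    also have "\<dots> \<le> 2 powr r * G powr r * (real 6 powr (\<bar>e\<bar> + 1) * M powr r)"
      using aM unfolding e_def by (intro mult_left_mono) auto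
    also have "\<dots> = 2 powr r * 6 powr (\<bar>e\<bar> + 1) * (G * M) powr r"
      using G M by (simp add: powr_mult mult_ac)
    also have "\<dots> \<le> 2 powr r * 6 powr (\<bar>e\<bar> + 1) * (c * (s * real N powr \<beta>)) powr r"
      using GM G M r by (intro mult_left_mono powr_mono2) (auto simp: mult_ac)
    also have "\<dots> = 2 powr r * 6 powr (\<bar>e\<bar> + 1) * c powr r * (s * real N powr \<beta>) powr r"
      using c s by (subst powr_mult) auto
    finally have "X \<le> 1 / 2 * X + 1 / 2 * K * (s * real N powr \<beta>) powr r"
      by (simp add: K_def algebra_simps)
    then show "(\<Sum>n<R. f n powr r * real (Suc n) powr (\<beta> * r - 1)) \<le> K * (s * real N powr \<beta>) powr r"
      by (simp add: X_def e_def)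
  qed
qed

section \<open>Norm bounds in terms of off-diagonal decay\<close>

text \<open>The real counterpart of a bound \<open>M\<close> on the norm of a matrix with off-diagonal suprema \<open>a\<close>.\<close>

definition seq_bound :: "ereal \<Rightarrow> real \<Rightarrow> real \<Rightarrow> (nat \<Rightarrow> real) \<Rightarrow> real \<Rightarrow> bool" where
  "seq_bound r \<alpha> d a M \<longleftrightarrow>
    (if r = \<infinity> then \<forall>n. a n * real (Suc n) powr \<alpha> \<le> M
     else \<forall>R. (\<Sum>n<R. a n powr real_of_ereal r * real (Suc n) powr (\<alpha> * real_of_ereal r + d - 1))
       \<le> M powr real_of_ereal r)"

text \<open>All weights are positive, so a finite norm forces every off-diagonal supremum to be
  finite, and the extended values can be replaced by real ones.\<close>

lemma beurling_class_majorant: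
  assumes r: "1 \<le> r" and A: "A \<in> beurling_class E r \<alpha>"
  obtains a where "antimono a" "\<And>n. 0 \<le> a n" "\<And>u v. cmod (A u v) \<le> a (geodesic_dist E u v)"
    "seq_bound r \<alpha> (beurling_dim E) a (enn2real (beurling_norm E r \<alpha> A))"
proof -
  define a where "a n = enn2real (offdiag_sup E A n)" for n
  define M where "M = enn2real (beurling_norm E r \<alpha> A)"
  have fin_norm: "beurling_norm E r \<alpha> A < \<infinity>" using A by (simp add: beurling_class_def)
  have bound: "(\<forall>n. offdiag_sup E A n \<noteq> \<infinity>) \<and> seq_bound r \<alpha> (beurling_dim E) a M"
  proof (cases "r = \<infinity>")
    case True
    have le: "offdiag_sup E A n * ennreal (real (n + 1) powr \<alpha>) \<le> ennreal M" for n
    proof -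
      have "offdiag_sup E A n * ennreal (real (n + 1) powr \<alpha>) \<le> beurling_norm E r \<alpha> A"
        using True by (auto simp: beurling_norm_def intro: SUP_upper)
      then show ?thesis using fin_norm by (simp add: M_def)
    qed
    have ne: "offdiag_sup E A n \<noteq> \<infinity>" for n
    proof
      assume "offdiag_sup E A n = \<infinity>"
      then have "offdiag_sup E A n * ennreal (real (n + 1) powr \<alpha>) = \<infinity>"
        by (simp add: ennreal_top_mult)
      then show False using le[of n] by (simp add: top_unique)
    qed
    have "a n * real (Suc n) powr \<alpha> \<le> M" for n
    proof -
      have "offdiag_sup E A n = ennreal (a n)" using ne[of n] by (simp add: a_def less_top)
      then have "ennreal (a n * real (Suc n) powr \<alpha>) \<le> ennreal M"
        using le[of n] by (simp add: ennreal_mult a_def add.commute)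
      then show ?thesis by (subst (asm) ennreal_le_iff) (auto simp: M_def)
    qed
    then show ?thesis using ne True by (simp add: seq_bound_def)
  next
    case False
    define q where "q = real_of_ereal r"
    have q: "1 \<le> q" using r False unfolding q_def by (cases r) auto
    let ?w = "\<lambda>n. real (n + 1) powr (\<alpha> * q + beurling_dim E - 1)"
    let ?t = "\<lambda>n. ennreal_powr (offdiag_sup E A n) q * ennreal (?w n)"
    have norm: "beurling_norm E r \<alpha> A = ennreal_powr (\<Sum>n. ?t n) (1 / q)"
      using False by (simp add: beurling_norm_def q_def)
    then have sum_ne: "(\<Sum>n. ?t n) \<noteq> \<infinity>" using fin_norm by (auto simp: ennreal_powr_def)
    define X where "X = enn2real (\<Sum>n. ?t n)"
    have X: "(\<Sum>n. ?t n) = ennreal X" using sum_ne by (simp add: X_def less_top)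
    have "M = X powr (1 / q)"
      unfolding M_def norm using sum_ne by (simp add: ennreal_powr_def X_def)
    then have MX: "M powr q = X" using q by (simp add: powr_powr X_def)
    have part: "(\<Sum>n<R. ?t n) \<le> ennreal X" for R
      unfolding X[symmetric] by (rule sum_le_suminf) auto
    have ne: "offdiag_sup E A n \<noteq> \<infinity>" for n
    proof
      assume "offdiag_sup E A n = \<infinity>"
      then have "?t n = \<infinity>" by (simp add: ennreal_top_mult ennreal_powr_def)
      moreover have "?t n \<le> (\<Sum>n<Suc n. ?t n)" by simp
      ultimately show False using part[of "Suc n"] by (simp add: top_unique)
    qed
    have t: "?t n = ennreal (a n powr q * ?w n)" for n
      using ne[of n] by (simp add: ennreal_powr_def a_def ennreal_mult)
    have "(\<Sum>n<R. a n powr q * real (Suc n) powr (\<alpha> * q + beurling_dim E - 1)) \<le> M powr q" for R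
    proof -
      have "ennreal (\<Sum>n<R. a n powr q * ?w n) \<le> ennreal X"
        using part[of R] unfolding t by (subst sum_ennreal[symmetric]) auto
      then show ?thesis unfolding MX by (subst (asm) ennreal_le_iff) (auto simp: X_def add.commute)
    qed
    then show ?thesis using ne False by (simp add: seq_bound_def q_def)
  qed
  then have e: "offdiag_sup E A n = ennreal (a n)" for n by (simp add: a_def less_top)
  show ?thesis
  proof (rule that)
    show "antimono a"
    proof (rule antimonoI)
      fix m n :: nat assume "m \<le> n"
      then have "offdiag_sup E A n \<le> offdiag_sup E A m"
        unfolding offdiag_sup_def by (intro SUP_subset_mono) auto
      then show "a n \<le> a m" unfolding a_def using bound by (intro enn2real_mono) (auto simp: less_top)
    qed
    show "0 \<le> a n" for n by (simp add: a_def)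
    show "cmod (A u v) \<le> a (geodesic_dist E u v)" for u v
    proof -
      have "ennreal (cmod (A u v)) \<le> offdiag_sup E A (geodesic_dist E u v)"
        unfolding offdiag_sup_def by (rule SUP_upper2[of "(u, v)"]) auto
      then show ?thesis unfolding e by (subst (asm) ennreal_le_iff) (auto simp: a_def)
    qed
    show "seq_bound r \<alpha> (beurling_dim E) a (enn2real (beurling_norm E r \<alpha> A))"
      using bound by (simp add: M_def)
  qed
qed

lemma beurling_norm_le:
  assumes r: "1 \<le> r" and f: "antimono f" "\<And>n. 0 \<le> f n" and K: "0 \<le> K"
    and B: "\<And>u v. cmod (B u v) \<le> f (geodesic_dist E u v)"
    and fK: "seq_bound r \<alpha> (beurling_dim E) f K"
  shows "beurling_norm E r \<alpha> B \<le> ennreal K"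
proof -
  have h: "offdiag_sup E B n \<le> ennreal (f n)" for n
    unfolding offdiag_sup_def
  proof (rule SUP_least, clarify)
    fix u v assume "n \<le> geodesic_dist E u v"
    then have "cmod (B u v) \<le> f n" using B[of u v] antimonoD[OF f(1)] by (meson order_trans)
    then show "ennreal (cmod (B u v)) \<le> ennreal (f n)" by (rule ennreal_leI)
  qed
  show ?thesis
  proof (cases "r = \<infinity>")
    case True
    have "offdiag_sup E B n * ennreal (real (n + 1) powr \<alpha>) \<le> ennreal K" for n
    proof -
      have "offdiag_sup E B n * ennreal (real (n + 1) powr \<alpha>) \<le> ennreal (f n) * ennreal (real (n + 1) powr \<alpha>)"
        by (intro mult_right_mono h) auto
      also have "\<dots> = ennreal (f n * real (Suc n) powr \<alpha>)" using f by (simp add: ennreal_mult add.commute)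
      also have "\<dots> \<le> ennreal K" using fK True by (intro ennreal_leI) (simp add: seq_bound_def)
      finally show ?thesis .
    qed
    then show ?thesis using True by (simp add: beurling_norm_def SUP_least)
  next
    case False
    define q where "q = real_of_ereal r"
    have q: "1 \<le> q" using r False unfolding q_def by (cases r) auto
    let ?w = "\<lambda>n. real (n + 1) powr (\<alpha> * q + beurling_dim E - 1)"
    let ?t = "\<lambda>n. ennreal_powr (offdiag_sup E B n) q * ennreal (?w n)"
    have mono: "ennreal_powr x p \<le> ennreal (y powr p)" if "x \<le> ennreal y" "0 \<le> y" "0 \<le> p" for x y p
    proof -
      have "x \<noteq> \<infinity>" using that by (auto simp: top_unique)
      moreover have "enn2real x \<le> y" using enn2real_leI[OF that(2,1)] .
      ultimately show ?thesis using that by (auto simp: ennreal_powr_def intro!: ennreal_leI powr_mono2)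
    qed
    have "(\<Sum>n. ?t n) \<le> ennreal (K powr q)"
    proof (rule suminf_le_const)
      show "(\<Sum>n<R. ?t n) \<le> ennreal (K powr q)" for R
      proof -
        have "(\<Sum>n<R. ?t n) \<le> (\<Sum>n<R. ennreal (f n powr q) * ennreal (?w n))"
          using f q by (intro sum_mono mult_right_mono mono h) auto
        also have "\<dots> = ennreal (\<Sum>n<R. f n powr q * ?w n)"
          by (simp add: ennreal_mult[symmetric] sum_ennreal)
        also have "\<dots> \<le> ennreal (K powr q)"
          using fK False unfolding seq_bound_def q_def by (intro ennreal_leI) (simp add: add.commute)
        finally show ?thesis .
      qed
    qed auto
    then have "ennreal_powr (\<Sum>n. ?t n) (1 / q) \<le> ennreal ((K powr q) powr (1 / q))"
      using q by (intro mono) auto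
    then show ?thesis using False q K by (simp add: beurling_norm_def q_def powr_powr)
  qed
qed

text \<open>The real number \<open>p\<close> is \<open>1 / r'\<close>.\<close>

lemma over_exp_conj:
  assumes "1 \<le> r"
  obtains p where "0 \<le> p" "p \<le> 1" "\<And>x. over_exp x (conj_exp r) = x * p"
    "\<And>x. over_exp x r = x * (1 - p)" "r \<noteq> \<infinity> \<Longrightarrow> p = 1 - 1 / real_of_ereal r" "r = \<infinity> \<Longrightarrow> p = 1"
proof (cases "r = \<infinity>")
  case True
  show ?thesis by (rule that[of 1]) (auto simp: True over_exp_def conj_exp_def)
next
  case False
  then obtain q where q: "r = ereal q" "1 \<le> q" using assms by (cases r) auto
  have "r - 1 = ereal (q - 1)" using q by (simp add: one_ereal_def)
  show ?thesis
  proof (cases "q = 1")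
    case True
    then show ?thesis using q by (intro that[of 0]) (auto simp: over_exp_def conj_exp_def one_ereal_def)
  next
    case False
    then have "conj_exp r = ereal (q / (q - 1))" using q by (simp add: conj_exp_def one_ereal_def)
    then show ?thesis using q False by (intro that[of "1 - 1 / q"]) (auto simp: over_exp_def field_simps)
  qed
qed

lemma le_mult_powr_minusI:
  fixes x y :: real
  assumes "x * y powr e \<le> c" "0 < y"
  shows "x \<le> c * y powr (-e)"
  using assms by (simp add: powr_minus field_simps)

text \<open>For antitone a and finite r, the first n + 1 terms of the weighted sum all contain at
  least a n, and their total weight is of order (n+1) powr (\<beta> r).\<close>

lemma seq_bound_pointwise:
  assumes r: "1 \<le> r" and d: "0 \<le> d" and p: "0 \<le> p" "p \<le> 1" "r \<noteq> \<infinity> \<Longrightarrow> p = 1 - 1 / real_of_ereal r" "r = \<infinity> \<Longrightarrow> p = 1"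
    and \<beta>: "\<beta> = \<alpha> + d * (1 - p)" "d < \<beta>"
  obtains C where "0 < C" "\<And>a M n. antimono a \<Longrightarrow> (\<And>n. 0 \<le> a n) \<Longrightarrow> 0 \<le> M \<Longrightarrow> seq_bound r \<alpha> d a M \<Longrightarrow>
    a n \<le> C * M * real (Suc n) powr (-\<beta>)"
proof (cases "r = \<infinity>")
  case True
  show ?thesis
  proof (rule that[of 1])
    fix a :: "nat \<Rightarrow> real" and M :: real and n :: nat
    assume "seq_bound r \<alpha> d a M"
    then have "a n * real (Suc n) powr \<alpha> \<le> M" using True by (simp add: seq_bound_def)
    then have "a n \<le> M * real (Suc n) powr (-\<alpha>)" by (rule le_mult_powr_minusI) simp
    then show "a n \<le> 1 * M * real (Suc n) powr (-\<beta>)" using True p(4) \<beta> by simp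
  qed simp
next
  case False
  define q where "q = real_of_ereal r"
  have q: "1 \<le> q" using r False unfolding q_def by (cases r) auto
  \<comment> \<open>This identity of conjugate exponents rewrites the weight exponent \<alpha> r + d
    - 1 as \<beta> r - 1.\<close>
  have "p * q = q - 1" using p(3) False q by (simp add: q_def[symmetric] field_simps)
  then have "d * (p * q) = d * q - d" by (simp only: right_diff_distrib mult_1_right)
  moreover have "\<beta> * q = \<alpha> * q + d * q - d * (p * q)" by (simp add: \<beta> algebra_simps)
  ultimately have \<beta>q: "\<alpha> * q + d = \<beta> * q" by linarith
  have pos: "0 < \<beta> * q" using \<beta> d q by simp
  obtain C where C: "0 < C" "\<And>n. real n powr (\<beta> * q) \<le> C * (\<Sum>k<n. real (Suc k) powr (\<beta> * q - 1))"
    using sum_powr_ge[OF pos] by blast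
  show ?thesis
  proof (rule that[of "C powr (1 / q)"])
    fix a :: "nat \<Rightarrow> real" and M :: real and n :: nat
    assume a: "antimono a" "\<And>n. 0 \<le> a n" and M: "0 \<le> M" and sb: "seq_bound r \<alpha> d a M"
    have "a n powr q * real (Suc n) powr (\<beta> * q) \<le> a n powr q * (C * (\<Sum>k<Suc n. real (Suc k) powr (\<beta> * q - 1)))"
      by (intro mult_left_mono C) auto
    also have "\<dots> = C * (\<Sum>k<Suc n. a n powr q * real (Suc k) powr (\<beta> * q - 1))"
      by (simp only: sum_distrib_left mult_ac)
    also have "\<dots> \<le> C * (\<Sum>k<Suc n. a k powr q * real (Suc k) powr (\<beta> * q - 1))"
      using C(1) a q by (intro mult_left_mono sum_mono mult_right_mono powr_mono2 antimonoD[OF a(1)]) auto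
    also have "\<dots> \<le> C * M powr q"
    proof (rule mult_left_mono)
      have "\<forall>R. (\<Sum>k<R. a k powr q * real (Suc k) powr (\<beta> * q - 1)) \<le> M powr q"
        using sb False \<beta>q by (simp add: seq_bound_def q_def)
      then show "(\<Sum>k<Suc n. a k powr q * real (Suc k) powr (\<beta> * q - 1)) \<le> M powr q" ..
    qed (use C in simp)
    finally have "(a n powr q * real (Suc n) powr (\<beta> * q)) powr (1 / q) \<le> (C * M powr q) powr (1 / q)"
      using q by (intro powr_mono2) auto
    then have "a n * real (Suc n) powr \<beta> \<le> C powr (1 / q) * M"
      using q a M C by (simp add: powr_mult powr_powr)
    then show "a n \<le> C powr (1 / q) * M * real (Suc n) powr (-\<beta>)" by (rule le_mult_powr_minusI) simp
  qed (use C in simp)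
qed

section \<open>The critical exponent, the size of the commutator and the choice of the scale\<close>

lemma sum_inverse_le: "1 \<le> N \<Longrightarrow> (\<Sum>k<N. real (Suc k) powr (-1)) \<le> 1 + ln (real N)"
proof (induction N rule: dec_induct)
  case (step n)
  have "1 / real (Suc n) = - (real n / real (Suc n) - 1)" by (simp add: field_simps)
  also have "\<dots> \<le> - ln (real n / real (Suc n))"
    using step.hyps ln_le_minus_one[of "real n / real (Suc n)"] by (simp del: of_nat_Suc)
  also have "\<dots> = ln (real (Suc n)) - ln (real n)" using step.hyps by (simp add: ln_div del: of_nat_Suc)
  finally show ?case using step.IH by (simp add: powr_minus divide_inverse del: of_nat_Suc)
qed simp

text \<open>Hoelder's inequality against (k+1) powr (-1/r'), whose r'-norm is a harmonic sum to the
  power 1/r' = p. It is derived from Young's inequality for normalized terms; the end points r = 1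
  and r = \<infinity> are direct.\<close>

lemma seq_bound_critical_sum:
  assumes r: "1 \<le> r" and p: "0 \<le> p" "p \<le> 1" "r \<noteq> \<infinity> \<Longrightarrow> p = 1 - 1 / real_of_ereal r" "r = \<infinity> \<Longrightarrow> p = 1"
    and \<alpha>: "\<alpha> = 1 + d * p" and a: "\<And>n. 0 \<le> a n" and M: "0 < M" and sb: "seq_bound r \<alpha> d a M" and N: "1 \<le> N"
  shows "(\<Sum>k<N. a k * real (Suc k) powr d) \<le> M * (1 + ln (real N)) powr p"
proof -
  have H: "1 \<le> 1 + ln (real N)" using N by simp
  consider "r = \<infinity>" | "r = 1" | "r \<noteq> \<infinity>" "r \<noteq> 1" by blast
  then show ?thesis
  proof cases
    case 1
    have "a k * real (Suc k) powr d \<le> M * real (Suc k) powr (-1)" for k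
    proof -
      have "a k * real (Suc k) powr (1 + d) * real (Suc k) powr (-1) \<le> M * real (Suc k) powr (-1)"
        using sb 1 \<alpha> p(4) by (intro mult_right_mono) (simp_all add: seq_bound_def)
      moreover have "real (Suc k) powr (1 + d) * real (Suc k) powr (-1) = real (Suc k) powr d"
        unfolding powr_add[symmetric] by simp
      ultimately show ?thesis by (simp only: mult.assoc)
    qed
    then have "(\<Sum>k<N. a k * real (Suc k) powr d) \<le> (\<Sum>k<N. M * real (Suc k) powr (-1))"
      by (rule sum_mono)
    also have "\<dots> \<le> M * (1 + ln (real N))"
      unfolding sum_distrib_left[symmetric] using M sum_inverse_le[OF N] by (intro mult_left_mono) auto
    finally show ?thesis using 1 p(4) H by simp
  next
    case 2
    then have "(\<Sum>k<N. a k powr 1 * real (Suc k) powr (\<alpha> * 1 + d - 1)) \<le> M powr 1"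
      using sb by (auto simp: seq_bound_def)
    moreover have "p = 0" using p(3) 2 by simp
    ultimately show ?thesis using a M H \<alpha> by simp
  next
    case 3
    define q where "q = real_of_ereal r"
    have q: "1 < q" using r 3 unfolding q_def by (cases r) (auto simp: one_ereal_def)
    define q' where "q' = q / (q - 1)"
    have q': "1 < q'" "1 / q + 1 / q' = 1" using q by (auto simp: q'_def field_simps)
    have pq: "p = 1 / q'" using p(3) 3 q by (simp add: q'_def q_def[symmetric] field_simps)
    define H where "H = 1 + ln (real N)"
    have H1: "1 \<le> H" using H by (simp add: H_def)
    \<comment> \<open>Both sequences are normalized to have norm at most 1. At the critical \<alpha>
      the two exponents of k + 1 add up to d.\<close>
    let ?b = "\<lambda>k. a k * real (Suc k) powr ((\<alpha> * q + d - 1) / q) / M"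
    let ?c = "\<lambda>k. real (Suc k) powr (- 1 / q') / H powr p"
    have "?b k * ?c k \<le> (a k powr q * real (Suc k) powr (\<alpha> * q + d - 1) / M powr q) / q + (real (Suc k) powr (-1) / H) / q'" for k
    proof -
      have "?b k * ?c k \<le> ?b k powr q / q + ?c k powr q' / q'"
        using q q' a M by (intro Youngs_inequality) auto
      also have "?b k powr q = a k powr q * real (Suc k) powr (\<alpha> * q + d - 1) / M powr q"
        using a M q by (simp add: powr_mult powr_divide powr_powr del: of_nat_Suc)
      also have "?c k powr q' = real (Suc k) powr (-1) / H"
        using H1 q' by (simp add: powr_divide powr_powr pq del: of_nat_Suc)
      finally show ?thesis .
    qed
    then have "(\<Sum>k<N. ?b k * ?c k) \<le> (\<Sum>k<N. (a k powr q * real (Suc k) powr (\<alpha> * q + d - 1) / M powr q) / q + (real (Suc k) powr (-1) / H) / q')"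
      by (rule sum_mono)
    also have "\<dots> = (\<Sum>k<N. a k powr q * real (Suc k) powr (\<alpha> * q + d - 1)) / M powr q / q + (\<Sum>k<N. real (Suc k) powr (-1)) / H / q'"
      by (simp only: sum.distrib sum_divide_distrib)
    also have "\<dots> \<le> M powr q / M powr q / q + H / H / q'"
    proof (intro add_mono divide_right_mono)
      show "(\<Sum>k<N. a k powr q * real (Suc k) powr (\<alpha> * q + d - 1)) \<le> M powr q"
        using sb 3 by (simp add: seq_bound_def q_def)
      show "(\<Sum>k<N. real (Suc k) powr (-1)) \<le> H" unfolding H_def by (rule sum_inverse_le[OF N])
    qed (use H1 q q' in auto)
    also have "\<dots> = 1" using M H1 q' by simp
    finally have "(\<Sum>k<N. ?b k * ?c k) \<le> 1" .
    moreover have "?b k * ?c k = a k * real (Suc k) powr d / (M * H powr p)" for k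
    proof -
      have "\<alpha> * q + d - 1 = (d + 1 / q') * q"
        unfolding \<alpha> pq using q by (simp add: q'_def field_simps)
      then have "(\<alpha> * q + d - 1) / q + - 1 / q' = d" using q by simp
      then have "real (Suc k) powr ((\<alpha> * q + d - 1) / q) * real (Suc k) powr (- 1 / q') = real (Suc k) powr d"
        by (simp only: flip: powr_add)
      then show ?thesis by (simp add: mult.assoc)
    qed
    ultimately have "(\<Sum>k<N. a k * real (Suc k) powr d) / (M * H powr p) \<le> 1"
      by (simp only: sum_divide_distrib)
    then show ?thesis using M H1 by (simp add: H_def divide_le_eq)
  qed
qed

text \<open>Up to the factor \<open>\<parallel>A\<parallel>\<close>, the norm of the commutator of \<open>A\<close> with a cutoff at scale \<open>N\<close>.\<close>

definition commutator_rate :: "real \<Rightarrow> real \<Rightarrow> nat \<Rightarrow> real" where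
  "commutator_rate g p N =
    (if g = 1 then (1 + ln (real N)) powr p / real N else real N powr (- min g 1))"

text \<open>Contributions from distances beyond N are of order N powr (-g); this absorbs them into
  the rate.\<close>

lemma powr_le_commutator_rate:
  assumes "1 \<le> N" "0 \<le> p"
  shows "real N powr (- g) \<le> commutator_rate g p N"
proof (cases "g = 1")
  case True
  have "1 \<le> (1 + ln (real N)) powr p" using assms by (intro ge_one_powr_ge_zero) auto
  then have "1 / real N \<le> (1 + ln (real N)) powr p / real N" by (intro divide_right_mono) auto
  then show ?thesis using True assms by (simp add: commutator_rate_def powr_minus divide_inverse)
next
  case False
  then show ?thesis using assms by (auto simp: commutator_rate_def intro!: powr_mono)
qed

text \<open>Away from g = 1 the pointwise decay of a is sharp enough. At g = 1 it would give the
  full factor 1 + ln N, whereas the weighted norm gives its p-th power.\<close>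

lemma seq_bound_weighted_mean:
  assumes r: "1 \<le> r" and d: "0 \<le> d" and p: "0 \<le> p" "p \<le> 1" "r \<noteq> \<infinity> \<Longrightarrow> p = 1 - 1 / real_of_ereal r" "r = \<infinity> \<Longrightarrow> p = 1"
    and \<alpha>: "d * p < \<alpha>"
  obtains C where "0 < C" "\<And>a M N. antimono a \<Longrightarrow> (\<And>n. 0 \<le> a n) \<Longrightarrow> 0 < M \<Longrightarrow> seq_bound r \<alpha> d a M \<Longrightarrow> 1 \<le> N \<Longrightarrow>
    (\<Sum>k<N. a k * real (Suc k) powr d) / real N \<le> C * M * commutator_rate (\<alpha> - d * p) p N"
proof (cases "\<alpha> - d * p = 1")
  case True
  show ?thesis
  proof (rule that[of 1])
    fix a :: "nat \<Rightarrow> real" and M :: real and N :: nat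
    assume a: "\<And>n. 0 \<le> a n" and M: "0 < M" and sb: "seq_bound r \<alpha> d a M" and N: "1 \<le> N"
    have "\<alpha> = 1 + d * p" using True by simp
    then have "(\<Sum>k<N. a k * real (Suc k) powr d) / real N \<le> M * (1 + ln (real N)) powr p / real N"
      using seq_bound_critical_sum[OF r p _ a M sb N] by (intro divide_right_mono) auto
    then show "(\<Sum>k<N. a k * real (Suc k) powr d) / real N \<le> 1 * M * commutator_rate (\<alpha> - d * p) p N"
      using True by (simp add: commutator_rate_def)
  qed simp
next
  case False
  define g where "g = \<alpha> - d * p"
  define \<beta> where "\<beta> = \<alpha> + d * (1 - p)"
  have g: "0 < g" "g \<noteq> 1" "d - \<beta> = - g" "d < \<beta>" using \<alpha> False by (auto simp: g_def \<beta>_def algebra_simps)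
  obtain C where C: "0 < C" "\<And>a M n. antimono a \<Longrightarrow> (\<And>n. 0 \<le> a n) \<Longrightarrow> 0 \<le> M \<Longrightarrow> seq_bound r \<alpha> d a M \<Longrightarrow>
    a n \<le> C * M * real (Suc n) powr (-\<beta>)"
    using seq_bound_pointwise[OF r d p \<beta>_def g(4)] by blast
  obtain C' where C': "0 < C'" "\<And>N. 1 \<le> N \<Longrightarrow> (\<Sum>k<N. real (Suc k) powr (- g)) / real N \<le> C' * real N powr (- min g 1)"
    using mean_powr_le[OF g(1,2)] by blast
  show ?thesis
  proof (rule that[of "C * C'"])
    fix a :: "nat \<Rightarrow> real" and M :: real and N :: nat
    assume a: "antimono a" "\<And>n. 0 \<le> a n" and M: "0 < M" and sb: "seq_bound r \<alpha> d a M" and N: "1 \<le> N"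
    have "a k * real (Suc k) powr d \<le> C * M * real (Suc k) powr (- g)" for k
    proof -
      have "a k * real (Suc k) powr d \<le> C * M * real (Suc k) powr (-\<beta>) * real (Suc k) powr d"
        using M by (intro mult_right_mono C a sb) auto
      also have "\<dots> = C * M * (real (Suc k) powr (-\<beta>) * real (Suc k) powr d)" by (simp add: mult_ac)
      also have "real (Suc k) powr (-\<beta>) * real (Suc k) powr d = real (Suc k) powr (- g)"
        using g(3) by (simp flip: powr_add del: of_nat_Suc)
      finally show ?thesis .
    qed
    then have "(\<Sum>k<N. a k * real (Suc k) powr d) \<le> (\<Sum>k<N. C * M * real (Suc k) powr (- g))"
      by (rule sum_mono)
    then have "(\<Sum>k<N. a k * real (Suc k) powr d) / real N \<le> C * M * ((\<Sum>k<N. real (Suc k) powr (- g)) / real N)"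
      by (simp add: divide_right_mono flip: sum_distrib_left)
    also have "\<dots> \<le> C * M * (C' * real N powr (- min g 1))"
      using C M by (intro mult_left_mono C' N) auto
    finally show "(\<Sum>k<N. a k * real (Suc k) powr d) / real N \<le> C * C' * M * commutator_rate (\<alpha> - d * p) p N"
      using g(2) by (simp add: commutator_rate_def g_def mult_ac)
  qed (use C C' in simp)
qed

text \<open>Solving \<kappa> times rate = \<delta> for a real y and rounding up. For g = 1 the
  equation is implicit in ln N, so y is given the form K \<kappa> l powr p with l = ln (\<kappa> +
  1), where K depends on c and \<delta> only.\<close>

lemma exists_scale:
  assumes g: "0 < g" and p: "0 \<le> p" "p \<le> 1" and c: "0 < c" and \<delta>: "0 < \<delta>" and \<beta>: "0 \<le> \<beta>"
  obtains C where "0 < C" "\<And>\<kappa>. c \<le> \<kappa> \<Longrightarrow> \<exists>N\<ge>1. \<kappa> * commutator_rate g p N \<le> \<delta> \<and>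
    real N powr \<beta> \<le> C * (\<kappa> powr (\<beta> / min g 1) * (if g = 1 then ln (\<kappa> + 1) powr (\<beta> * p) else 1))"
proof (cases "g = 1")
  case False
  define m where "m = min g 1"
  have m: "0 < m" using g by (simp add: m_def)
  define B where "B = \<delta> powr (- 1 / m) + c powr (- 1 / m)"
  have B: "0 < B" using c \<delta> by (simp add: B_def add_pos_pos)
  show ?thesis
  proof (rule that[of "B powr \<beta>"])
    fix \<kappa> assume \<kappa>: "c \<le> \<kappa>"
    have \<kappa>0: "0 < \<kappa>" using \<kappa> c by simp
    define y where "y = (\<kappa> / \<delta>) powr (1 / m)"
    have y: "0 < y" using \<kappa>0 \<delta> by (simp add: y_def)
    define N where "N = nat \<lceil>y\<rceil>"
    have N: "y \<le> real N" "real N \<le> y + 1" "1 \<le> N" using y unfolding N_def by linarith+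
    have "real N powr (- m) \<le> y powr (- m)" using N y m by (intro powr_mono2') auto
    also have "y powr (- m) = \<delta> / \<kappa>" using m \<kappa>0 \<delta> by (simp add: y_def powr_powr powr_minus)
    finally have 1: "\<kappa> * commutator_rate g p N \<le> \<delta>"
      using False \<kappa>0 by (simp add: commutator_rate_def m_def field_simps)
    \<comment> \<open>The lower bound on \<kappa> turns the summand 1 from rounding up into a
      multiple of \<open>\<kappa> powr (1 / m)\<close>.\<close>
    have "1 \<le> c powr (- 1 / m) * \<kappa> powr (1 / m)"
    proof -
      have "c powr (- 1 / m) * c powr (1 / m) = 1" using c by (simp flip: powr_add)
      moreover have "c powr (1 / m) \<le> \<kappa> powr (1 / m)" using c \<kappa> m by (intro powr_mono2) auto
      ultimately show ?thesis by (metis mult_left_mono powr_ge_zero)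
    qed
    moreover have "y = \<delta> powr (- 1 / m) * \<kappa> powr (1 / m)"
      using \<kappa>0 \<delta> powr_minus_divide[of \<delta> "1 / m"] by (simp add: y_def powr_divide)
    ultimately have "real N \<le> B * \<kappa> powr (1 / m)" using N(2) by (simp add: B_def distrib_right)
    then have "real N powr \<beta> \<le> (B * \<kappa> powr (1 / m)) powr \<beta>" using \<beta> by (intro powr_mono2) auto
    also have "\<dots> = B powr \<beta> * \<kappa> powr (\<beta> / m)" using B by (simp add: powr_mult powr_powr)
    finally show "\<exists>N\<ge>1. \<kappa> * commutator_rate g p N \<le> \<delta> \<and>
      real N powr \<beta> \<le> B powr \<beta> * (\<kappa> powr (\<beta> / min g 1) * (if g = 1 then ln (\<kappa> + 1) powr (\<beta> * p) else 1))"
      using 1 N(3) False by (auto simp: m_def)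
  qed (use B in simp)
next
  case True
  define l0 where "l0 = ln (1 + c)"
  have l0: "0 < l0" using c by (simp add: l0_def)
  define D where "D = 1 / l0 + 2"
  have D: "1 \<le> D" using l0 by (simp add: D_def)
  have "((\<lambda>x::real. ln x / x) \<longlongrightarrow> 0) at_top" by (rule ln_x_over_x_tendsto_0)
  moreover have "((\<lambda>x::real. 1 / x) \<longlongrightarrow> 0) at_top"
    by (rule tendsto_divide_0[OF tendsto_const filterlim_at_top_imp_at_infinity[OF filterlim_ident]])
  ultimately have "((\<lambda>x::real. 1 / x + ln x / x) \<longlongrightarrow> 0 + 0) at_top" by (intro tendsto_add)
  then have "\<forall>\<^sub>F x in at_top. 1 / x + ln x / x < \<delta> / (2 * D)"
    by (rule order_tendstoD) (use \<delta> D in simp)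
  then have "\<forall>\<^sub>F x in at_top. 1 / x + ln x / x < \<delta> / (2 * D) \<and> 2 \<le> x"
    using eventually_ge_at_top eventually_conj by blast
  then obtain x :: real where x: "1 / x + ln x / x < \<delta> / (2 * D)" "2 \<le> x"
    using eventually_happens'[OF trivial_limit_at_top_linorder] by blast
  \<comment> \<open>K also enters ln N and has to beat its own logarithm: the requirement is Y * D
    \<le> \<delta> * K with Y = 1 + ln (K + 1), and x was taken large enough for it because ln x / x
    tends to 0.\<close>
  define K where "K = x - 1"
  have K: "1 \<le> K" using x by (simp add: K_def)
  define Y where "Y = 1 + ln (K + 1)"
  have Y: "1 \<le> Y" using K by (simp add: Y_def)
  have "Y / x < \<delta> / (2 * D)" using x by (simp add: Y_def K_def add_divide_distrib)
  then have "Y * (2 * D) < \<delta> * x" using D x by (simp add: field_simps)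
  also have "\<delta> * x \<le> \<delta> * (2 * K)" using \<delta> x by (intro mult_left_mono) (auto simp: K_def)
  finally have YK: "Y * D \<le> \<delta> * K" by simp
  define B where "B = K + 1 / (c * l0 powr p)"
  have B: "0 < B" using K c l0 by (simp add: B_def add_pos_pos)
  show ?thesis
  proof (rule that[of "B powr \<beta>"])
    fix \<kappa> assume \<kappa>: "c \<le> \<kappa>"
    have \<kappa>0: "0 < \<kappa>" using \<kappa> c by simp
    define l where "l = ln (\<kappa> + 1)"
    have l: "l0 \<le> l" using \<kappa> c by (simp add: l_def l0_def)
    have l_le: "l \<le> \<kappa>" using ln_add_one_self_le_self[of \<kappa>] \<kappa>0 by (simp add: l_def add.commute)
    have lp: "0 < l powr p" using l l0 by simp
    define y where "y = K * \<kappa> * l powr p"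
    have y: "0 < y" using K \<kappa>0 lp by (simp add: y_def)
    define N where "N = nat \<lceil>y\<rceil>"
    have N: "y \<le> real N" "real N \<le> y + 1" "1 \<le> N" using y unfolding N_def by linarith+
    \<comment> \<open>A crude bound is enough here, since N matters only through its logarithm: N is
      at most quadratic in \<kappa> + 1, hence 1 + ln N is at most a constant times l.\<close>
    have "l powr p \<le> (1 + l) powr p" using l l0 p by (intro powr_mono2) auto
    also have "\<dots> \<le> (1 + l) powr 1" using l l0 p by (intro powr_mono) auto
    finally have "l powr p \<le> \<kappa> + 1" using l l0 l_le by simp
    then have "y \<le> K * \<kappa> * (\<kappa> + 1)" unfolding y_def using K \<kappa>0 by (intro mult_left_mono) auto
    then have "real N \<le> K * \<kappa> * (\<kappa> + 1) + 1" using N(2) by simp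
    also have "\<dots> \<le> (K + 1) * (\<kappa> + 1)\<^sup>2"
      using K \<kappa>0 by (simp add: power2_eq_square algebra_simps add_increasing2)
    finally have "ln (real N) \<le> ln ((K + 1) * (\<kappa> + 1)\<^sup>2)"
      using N(3) K \<kappa>0 by (subst ln_le_cancel_iff) auto
    also have "\<dots> = ln (K + 1) + 2 * l"
      using K \<kappa>0 by (simp add: ln_mult ln_realpow l_def)
    finally have "1 + ln (real N) \<le> Y * 1 + 2 * l" by (simp add: Y_def)
    also have "\<dots> \<le> Y * (l / l0) + Y * (2 * l)"
      using Y l l0 by (intro add_mono mult_left_mono) (auto simp: mult_le_cancel_right1)
    also have "\<dots> = Y * D * l" by (simp add: D_def algebra_simps)
    finally have "(1 + ln (real N)) powr p \<le> (Y * D * l) powr p"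
      using N(3) p by (intro powr_mono2) auto
    also have "\<dots> = (Y * D) powr p * l powr p" using Y D l l0 by (simp add: powr_mult)
    also have "(Y * D) powr p \<le> (Y * D) powr 1"
      using p Y D mult_mono[of 1 Y 1 D] by (intro powr_mono) auto
    finally have "(1 + ln (real N)) powr p \<le> (Y * D) * l powr p" using Y D by (simp add: mult_right_mono)
    also have "\<dots> \<le> (\<delta> * K) * l powr p" using YK by (intro mult_right_mono) auto
    finally have "\<kappa> * (1 + ln (real N)) powr p \<le> \<kappa> * ((\<delta> * K) * l powr p)"
      using \<kappa>0 by (intro mult_left_mono) auto
    also have "\<dots> = \<delta> * y" by (simp add: y_def mult_ac)
    also have "\<dots> \<le> \<delta> * real N" using \<delta> N by simp
    finally have 1: "\<kappa> * commutator_rate g p N \<le> \<delta>"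
      using True N(3) by (simp add: commutator_rate_def divide_le_eq)
    have "c * l0 powr p \<le> \<kappa> * l powr p" using \<kappa> c l l0 p by (intro mult_mono powr_mono2) auto
    then have "1 \<le> 1 / (c * l0 powr p) * (\<kappa> * l powr p)" using c l0 by (simp add: le_divide_eq)
    then have "real N \<le> B * (\<kappa> * l powr p)" using N(2) by (simp add: B_def y_def algebra_simps)
    then have "real N powr \<beta> \<le> (B * (\<kappa> * l powr p)) powr \<beta>" using \<beta> by (intro powr_mono2) auto
    also have "\<dots> = B powr \<beta> * (\<kappa> powr \<beta> * l powr (\<beta> * p))"
      using B \<kappa>0 by (simp add: powr_mult powr_powr mult.commute)
    finally show "\<exists>N\<ge>1. \<kappa> * commutator_rate g p N \<le> \<delta> \<and>
      real N powr \<beta> \<le> B powr \<beta> * (\<kappa> powr (\<beta> / min g 1) * (if g = 1 then ln (\<kappa> + 1) powr (\<beta> * p) else 1))"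
      using 1 N(3) True by (auto simp: l_def)
  qed (use B in simp)
qed

section \<open>Decay of the inverse\<close>

text \<open>The two passes prescribe their thresholds for the coefficient of f (n div 2) before N is
  known; N is then chosen once, for the smaller threshold, and depends on A and S through \<kappa>
  only.\<close>

lemma (in regular_metric) inverse_decay:
  fixes r :: ereal
  assumes r: "1 \<le> r" and p: "0 \<le> p" "p \<le> 1" "r \<noteq> \<infinity> \<Longrightarrow> p = 1 - 1 / real_of_ereal r" "r = \<infinity> \<Longrightarrow> p = 1"
    and \<alpha>: "d * p < \<alpha>"
  obtains C where "0 < C" "\<And>A T S a M. ell2_op_of_matrix A T \<Longrightarrow> bounded_ell2_op S \<Longrightarrow> S \<circ> T = id \<Longrightarrow> T \<circ> S = id \<Longrightarrow>
    antimono a \<Longrightarrow> (\<And>n. 0 \<le> a n) \<Longrightarrow> (\<And>u v. cmod (A u v) \<le> a (\<rho> u v)) \<Longrightarrow> 0 \<le> M \<Longrightarrow> seq_bound r \<alpha> d a M \<Longrightarrow>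
    \<exists>f. antimono f \<and> (\<forall>n. 0 \<le> f n) \<and> (\<forall>u w. cmod (matrix_of_ell2_op S u w) \<le> f (\<rho> u w)) \<and>
      seq_bound r \<alpha> d f (C * onorm S * ((onorm S * M) powr ((\<alpha> + d * (1 - p)) / min (\<alpha> - d * p) 1) *
        (if \<alpha> - d * p = 1 then ln (onorm S * M + 1) powr ((d + 1) * p) else 1)))"
proof -
  define g where "g = \<alpha> - d * p"
  define \<beta> where "\<beta> = \<alpha> + d * (1 - p)"
  have g: "0 < g" "d - \<beta> = - g" "d < \<beta>" "0 < \<beta>"
    using \<alpha> dim_nonneg by (auto simp: g_def \<beta>_def algebra_simps)
  define Cd where "Cd = D1 / D2 * 5 powr d"
  have Cd: "0 < Cd" using D1_pos D2_pos by (simp add: Cd_def)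
  obtain Cp where Cp: "0 < Cp" "\<And>a M n. antimono a \<Longrightarrow> (\<And>n. 0 \<le> a n) \<Longrightarrow> 0 \<le> M \<Longrightarrow> seq_bound r \<alpha> d a M \<Longrightarrow>
    a n \<le> Cp * M * real (Suc n) powr (-\<beta>)"
    using seq_bound_pointwise[OF r dim_nonneg p \<beta>_def g(3)] by blast
  obtain Cm where Cm: "0 < Cm" "\<And>a M N. antimono a \<Longrightarrow> (\<And>n. 0 \<le> a n) \<Longrightarrow> 0 < M \<Longrightarrow> seq_bound r \<alpha> d a M \<Longrightarrow> 1 \<le> N \<Longrightarrow>
    (\<Sum>k<N. a k * real (Suc k) powr d) / real N \<le> Cm * M * commutator_rate g p N"
    using seq_bound_weighted_mean[OF r dim_nonneg p \<alpha>] unfolding g_def by blast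
  obtain Ct where Ct: "0 < Ct" "\<And>F u j. finite F \<Longrightarrow>
    (\<Sum>v\<in>{v\<in>F. j \<le> \<rho> u v}. real (Suc (\<rho> u v)) powr (-\<beta>)) \<le> Ct * real (Suc j) powr (d - \<beta>)"
    using sum_dist_tail[OF g(3)] by blast
  obtain Ck where Ck: "0 < Ck" "\<And>a P F u N. antimono a \<Longrightarrow> (\<And>n. 0 \<le> a n) \<Longrightarrow>
    (\<And>n. a n \<le> P * real (Suc n) powr (-\<beta>)) \<Longrightarrow> finite F \<Longrightarrow> 1 \<le> N \<Longrightarrow>
    (\<Sum>v\<in>F. a (\<rho> u v) * min 1 (real (\<rho> u v) / real N))
      \<le> Ck * ((\<Sum>k<N. a k * real (Suc k) powr d) / real N + P * real N powr (d - \<beta>))"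
    using sum_commutator_kernel[OF g(3)] by blast
  define cr where "cr = Cd * D1"
  have cr: "0 \<le> cr" using Cd D1_pos by (simp add: cr_def)
  obtain \<delta>1 K1 H where \<delta>1: "0 < \<delta>1" "0 < K1" "0 < H" and pointwise:
    "\<And>f a s P N. \<lbrakk>\<And>n. 0 \<le> f n; \<And>n. f n \<le> s; \<And>n. 0 \<le> a n;
      \<And>n. a n \<le> P * real (Suc n) powr (-\<beta>); 1 \<le> N; s * P * real N powr (d - \<beta>) \<le> \<delta>1;
      \<And>n. 10 * N \<le> n \<Longrightarrow> f n \<le> \<delta>1 * f (n div 2) + cr * s * a (n div 6) * (\<Sum>k<Suc (n div 2). f k * powr_increment d k)\<rbrakk>
      \<Longrightarrow> (\<forall>n. f n \<le> K1 * s * real N powr \<beta> * real (Suc n) powr (-\<beta>)) \<and>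
          (\<forall>m. (\<Sum>k<m. f k * powr_increment d k) \<le> H * s * real N powr d)"
    using recursion_pointwise_decay[OF dim_nonneg g(3) cr] by blast
  define c2 where "c2 = cr * H * \<delta>1 / Cp"
  have c2: "0 \<le> c2" using cr \<delta>1 Cp by (simp add: c2_def)
  define q where "q = (if r = \<infinity> then 1 else real_of_ereal r)"
  have q: "1 \<le> q" using r unfolding q_def by (cases r) auto
  obtain \<delta>2 K2 where \<delta>2: "0 < \<delta>2" "0 < K2" and summable:
    "\<And>f a s M G N R. \<lbrakk>\<And>n. 0 \<le> f n; \<And>n. f n \<le> s; \<And>n. 0 \<le> a n; 0 \<le> G; 0 \<le> M; 1 \<le> N;
      \<And>R. (\<Sum>n<R. a n powr q * real (Suc n) powr (\<beta> * q - 1)) \<le> M powr q;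
      G * M \<le> c2 * s * real N powr \<beta>;
      \<And>n. 10 * N \<le> n \<Longrightarrow> f n \<le> \<delta>2 * f (n div 2) + G * a (n div 6)\<rbrakk>
      \<Longrightarrow> (\<Sum>n<R. f n powr q * real (Suc n) powr (\<beta> * q - 1)) \<le> K2 * (s * real N powr \<beta>) powr q"
    using recursion_summable_decay[OF g(4) q c2] by blast
  define \<delta>3 where "\<delta>3 = min \<delta>1 \<delta>2"
  have \<delta>3: "0 < \<delta>3" using \<delta>1 \<delta>2 by (simp add: \<delta>3_def)
  define B where "B = Ck * (Cm + Cp) + Cp * 3 powr \<beta> * Ct"
  have B: "0 < B" unfolding B_def using Ck Cm Cp Ct by (intro add_pos_pos mult_pos_pos) auto
  \<comment> \<open>The denominator meets two demands at once: Cd * B is for the coefficient of f (n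
    div 2), and Cp for the smallness of s P N powr (d - \<beta>) in the first pass.\<close>
  define \<delta> where "\<delta> = \<delta>3 / (Cd * B + Cp)"
  have den: "0 < Cd * B + Cp" using Cd B Cp by (simp add: add_pos_pos)
  have \<delta>: "0 < \<delta>" using \<delta>3 den by (simp add: \<delta>_def)
  have pos: "0 < 1 / (Cp * Ct)" using Cp Ct by simp
  obtain C where C: "0 < C" "\<And>\<kappa>. 1 / (Cp * Ct) \<le> \<kappa> \<Longrightarrow> \<exists>N\<ge>1. \<kappa> * commutator_rate g p N \<le> \<delta> \<and>
    real N powr \<beta> \<le> C * (\<kappa> powr (\<beta> / min g 1) * (if g = 1 then ln (\<kappa> + 1) powr (\<beta> * p) else 1))"
    using exists_scale[OF g(1) p(1,2) pos \<delta> less_imp_le[OF g(4)]] by blast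
  define C0 where "C0 = (if r = \<infinity> then K1 else K2 powr (1 / real_of_ereal r)) * C"
  have C0: "0 < C0" using C \<delta>1 \<delta>2 by (simp add: C0_def)
  show ?thesis
  proof (rule that[OF C0])
    fix A :: "'v \<Rightarrow> 'v \<Rightarrow> complex" and T S and a :: "nat \<Rightarrow> real" and M :: real
    assume T: "ell2_op_of_matrix A T" and S: "bounded_ell2_op S" and ST: "S \<circ> T = id" and TS: "T \<circ> S = id"
      and a: "antimono a" "\<And>n. 0 \<le> a n" and Aa: "\<And>u v. cmod (A u v) \<le> a (\<rho> u v)"
      and M0: "0 \<le> M" and sb: "seq_bound r \<alpha> d a M"
    define s where "s = onorm S"
    define \<kappa> where "\<kappa> = s * M"
    have blS: "bounded_linear S" using S by (simp add: bounded_ell2_op_def)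
    have s0: "0 \<le> s" unfolding s_def by (rule onorm_pos_le[OF blS])
    have aP: "a n \<le> Cp * M * real (Suc n) powr (-\<beta>)" for n by (rule Cp(2)[OF a M0 sb])
    \<comment> \<open>The unit vector at w equals S (T e), where e is that vector, so 1 is at most s
      times the norm of column w of A. The pointwise decay bounds the l1 norm of this column by Cp
      Ct M.\<close>
    have \<kappa>: "1 / (Cp * Ct) \<le> \<kappa>"
    proof -
      fix w :: 'v
      have "norm (T (unit_ell2 w)) \<le> Cp * M * Ct"
      proof (rule norm_ell2_leI)
        fix F :: "'v set" assume F: "finite F"
        have "ell2_coord (T (unit_ell2 w)) u = A u w" for u
        proof -
          have "((\<lambda>v. A u v * ell2_coord (unit_ell2 w) v) has_sum ell2_coord (T (unit_ell2 w)) u) UNIV"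
            using T by (simp add: ell2_op_of_matrix_def)
          moreover have "((\<lambda>v. A u v * ell2_coord (unit_ell2 w) v) has_sum A u w) UNIV"
            by (rule has_sum_finite_neutralI[of "{w}"]) (auto simp: unit_ell2.rep_eq)
          ultimately show ?thesis by (rule has_sum_unique)
        qed
        then have "L2_set (\<lambda>u. cmod (ell2_coord (T (unit_ell2 w)) u)) F \<le> (\<Sum>u\<in>F. cmod (A u w))"
          by (simp add: L2_set_le_sum)
        also have "\<dots> \<le> (\<Sum>u\<in>F. Cp * M * real (Suc (\<rho> w u)) powr (-\<beta>))"
          using Aa aP dist_sym by (intro sum_mono) (metis order_trans)
        also have "\<dots> \<le> Cp * M * Ct"
          using Ct(2)[OF F, of w 0] Cp M0 unfolding sum_distrib_left[symmetric]
          by (intro mult_left_mono) auto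
        finally show "L2_set (\<lambda>u. cmod (ell2_coord (T (unit_ell2 w)) u)) F \<le> Cp * M * Ct" .
      qed
      then have "s * norm (T (unit_ell2 w)) \<le> s * (Cp * M * Ct)" using s0 by (rule mult_left_mono)
      moreover have "norm (S (T (unit_ell2 w))) \<le> s * norm (T (unit_ell2 w))"
        unfolding s_def by (rule onorm[OF blS])
      moreover have "S (T (unit_ell2 w)) = unit_ell2 w" using ST by (metis comp_apply id_apply)
      ultimately have "1 \<le> \<kappa> * (Cp * Ct)" by (simp add: norm_unit_ell2 \<kappa>_def mult_ac)
      then show ?thesis using Cp Ct by (simp add: divide_le_eq)
    qed
    have \<kappa>0: "0 < \<kappa>" using \<kappa> Cp Ct by (meson divide_pos_pos less_le_trans mult_pos_pos zero_less_one)
    then have M: "0 < M" and s: "0 < s" using M0 s0 by (auto simp: \<kappa>_def zero_less_mult_iff)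
    obtain N where N: "1 \<le> N" and rate: "\<kappa> * commutator_rate g p N \<le> \<delta>" and
      N_le: "real N powr \<beta> \<le> C * (\<kappa> powr (\<beta> / min g 1) * (if g = 1 then ln (\<kappa> + 1) powr (\<beta> * p) else 1))"
      using C(2)[OF \<kappa>] by blast
    let ?\<epsilon> = "commutator_rate g p N"
    have \<epsilon>: "real N powr (- g) \<le> ?\<epsilon>" by (rule powr_le_commutator_rate[OF N p(1)])
    have \<epsilon>0: "0 \<le> ?\<epsilon>" using \<epsilon> by (meson order_trans powr_ge_zero)
    define k where "k = Ck * (Cm + Cp) * M * ?\<epsilon>"
    define t where "t = Cp * 3 powr \<beta> * Ct * M * ?\<epsilon>"
    have k: "(\<Sum>v\<in>F. a (\<rho> u v) * min 1 (real (\<rho> u v) / real N)) \<le> k" if F: "finite F" for F u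
    proof -
      have "(\<Sum>v\<in>F. a (\<rho> u v) * min 1 (real (\<rho> u v) / real N))
        \<le> Ck * ((\<Sum>k<N. a k * real (Suc k) powr d) / real N + Cp * M * real N powr (d - \<beta>))"
        by (rule Ck(2)[OF a aP F N])
      also have "\<dots> \<le> Ck * (Cm * M * ?\<epsilon> + Cp * M * ?\<epsilon>)"
        using Ck(1) Cp(1) M \<epsilon> g(2) by (intro mult_left_mono add_mono Cm(2) a sb N) auto
      finally show ?thesis by (simp add: k_def algebra_simps)
    qed
    have t: "(\<Sum>v\<in>{v\<in>F. 3 * N \<le> \<rho> u v}. a (\<rho> u v div 3)) \<le> t" if F: "finite F" for F u
    proof -
      have "a (n div 3) \<le> Cp * M * (3 powr \<beta> * real (Suc n) powr (-\<beta>))" for n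
        using aP[of "n div 3"] Suc_div_powr_le[of \<beta> 3 n] g(4) Cp(1) M
        by (intro order_trans[OF aP] mult_left_mono) auto
      then have "(\<Sum>v\<in>{v\<in>F. 3 * N \<le> \<rho> u v}. a (\<rho> u v div 3))
          \<le> (\<Sum>v\<in>{v\<in>F. 3 * N \<le> \<rho> u v}. Cp * M * 3 powr \<beta> * real (Suc (\<rho> u v)) powr (-\<beta>))"
        by (intro sum_mono) (simp add: mult_ac)
      also have "\<dots> \<le> Cp * M * 3 powr \<beta> * (Ct * real (Suc (3 * N)) powr (d - \<beta>))"
        unfolding sum_distrib_left[symmetric] using Cp(1) M by (intro mult_left_mono Ct(2) F) auto
      also have "\<dots> \<le> Cp * M * 3 powr \<beta> * (Ct * ?\<epsilon>)"
      proof -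
        have "real (Suc (3 * N)) powr (d - \<beta>) \<le> real N powr (d - \<beta>)"
          using N g by (intro powr_mono2') auto
        then show ?thesis using Cp(1) Ct(1) M \<epsilon> g(2) by (intro mult_left_mono) auto
      qed
      finally show ?thesis by (simp add: t_def mult_ac)
    qed
    obtain f where f: "antimono f" "\<And>n. 0 \<le> f n" "\<And>n. f n \<le> s"
      "\<And>u w. cmod (matrix_of_ell2_op S u w) \<le> f (\<rho> u w)"
      and rec: "\<And>n. 10 * N \<le> n \<Longrightarrow> f n \<le> s * (Cd *
        ((k + t) * f (n div 2) + a (n div 6) * (D1 * (\<Sum>k<Suc (n div 2). f k * powr_increment d k))))"
      using local_norm_recursion[OF T S ST TS a Aa N k t] unfolding s_def Cd_def by blast
    have \<delta>_bound: "s * (Cd * (k + t)) \<le> \<delta>3" and P_bound: "s * (Cp * M) * real N powr (d - \<beta>) \<le> \<delta>3"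
    proof -
      have "s * (Cd * (k + t)) = (Cd * B) * (\<kappa> * ?\<epsilon>)" by (simp add: k_def t_def B_def \<kappa>_def algebra_simps)
      also have "\<dots> \<le> (Cd * B + Cp) * \<delta>" using rate \<delta> Cd B Cp \<kappa>0 \<epsilon>0 by (intro mult_mono) auto
      also have "\<dots> = \<delta>3" using den by (simp add: \<delta>_def)
      finally show "s * (Cd * (k + t)) \<le> \<delta>3" .
      have "s * (Cp * M) * real N powr (d - \<beta>) = Cp * (\<kappa> * real N powr (- g))"
        using g(2) by (simp add: \<kappa>_def mult_ac)
      also have "\<dots> \<le> Cp * (\<kappa> * ?\<epsilon>)" using \<epsilon> Cp(1) \<kappa>0 by (intro mult_left_mono) auto
      also have "\<dots> \<le> (Cd * B + Cp) * \<delta>" using rate \<delta> Cd B Cp \<kappa>0 \<epsilon>0 by (intro mult_mono) auto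
      also have "\<dots> = \<delta>3" using den by (simp add: \<delta>_def)
      finally show "s * (Cp * M) * real N powr (d - \<beta>) \<le> \<delta>3" .
    qed
    let ?I = "\<lambda>n. \<Sum>k<Suc (n div 2). f k * powr_increment d k"
    have rec': "f n \<le> \<delta>3 * f (n div 2) + cr * s * a (n div 6) * ?I n" if "10 * N \<le> n" for n
    proof -
      have "f n \<le> s * (Cd * (k + t)) * f (n div 2) + cr * s * a (n div 6) * ?I n"
        using rec[OF that] by (simp add: cr_def algebra_simps)
      moreover have "s * (Cd * (k + t)) * f (n div 2) \<le> \<delta>3 * f (n div 2)"
        using \<delta>_bound f by (intro mult_right_mono) auto
      ultimately show ?thesis by simp
    qed
    have pw: "(\<forall>n. f n \<le> K1 * s * real N powr \<beta> * real (Suc n) powr (-\<beta>)) \<and>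
          (\<forall>m. (\<Sum>k<m. f k * powr_increment d k) \<le> H * s * real N powr d)"
    proof (rule pointwise[OF f(2,3) a(2) aP N])
      show "s * (Cp * M) * real N powr (d - \<beta>) \<le> \<delta>1" using P_bound by (simp add: \<delta>3_def)
      fix n assume "10 * N \<le> n"
      moreover have "\<delta>3 * f (n div 2) \<le> \<delta>1 * f (n div 2)" using f by (intro mult_right_mono) (auto simp: \<delta>3_def)
      ultimately show "f n \<le> \<delta>1 * f (n div 2) + cr * s * a (n div 6) * ?I n" using rec'[of n] by simp
    qed
    let ?K0 = "if r = \<infinity> then K1 else K2 powr (1 / real_of_ereal r)"
    have N_le': "?K0 * (s * real N powr \<beta>) \<le> C0 * s * (\<kappa> powr (\<beta> / min g 1) * (if g = 1 then ln (\<kappa> + 1) powr ((d + 1) * p) else 1))"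
    proof -
      \<comment> \<open>The scale carries the logarithm to the power \<beta> p; the claimed exponent
        agrees because \<beta> = d + g.\<close>
      have "(if g = 1 then ln (\<kappa> + 1) powr (\<beta> * p) else 1) = (if g = 1 then ln (\<kappa> + 1) powr ((d + 1) * p) else 1)"
      proof (cases "g = 1")
        case True
        then have "\<beta> = d + 1" using g(2) by simp
        then show ?thesis by simp
      qed simp
      then have "?K0 * (s * real N powr \<beta>) \<le> ?K0 * (s * (C * (\<kappa> powr (\<beta> / min g 1) * (if g = 1 then ln (\<kappa> + 1) powr ((d + 1) * p) else 1))))"
        using N_le \<delta>1 \<delta>2 s by (intro mult_left_mono) auto
      then show ?thesis by (simp add: C0_def mult_ac)
    qed
    have "seq_bound r \<alpha> d f (?K0 * (s * real N powr \<beta>))"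
    proof (cases "r = \<infinity>")
      case True
      then have \<beta>\<alpha>: "\<beta> = \<alpha>" using p(4) by (simp add: \<beta>_def)
      have "f n * real (Suc n) powr \<alpha> \<le> K1 * (s * real N powr \<beta>)" for n
      proof -
        have "f n * real (Suc n) powr \<beta> \<le> K1 * s * real N powr \<beta> * real (Suc n) powr (-\<beta>) * real (Suc n) powr \<beta>"
          using pw by (intro mult_right_mono) auto
        also have "\<dots> = K1 * s * real N powr \<beta> * (real (Suc n) powr (-\<beta>) * real (Suc n) powr \<beta>)"
          by (simp only: mult.assoc)
        also have "real (Suc n) powr (-\<beta>) * real (Suc n) powr \<beta> = 1" by (simp flip: powr_add)
        finally show ?thesis by (simp add: \<beta>\<alpha> mult_ac)
      qed
      then show ?thesis using True by (simp add: seq_bound_def)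
    next
      case False
      then have qr: "real_of_ereal r = q" by (simp add: q_def)
      have "p * q = q - 1" using p(3) False q by (simp add: qr field_simps)
      then have "d * (p * q) = d * q - d" by (simp only: right_diff_distrib mult_1_right)
      moreover have "\<beta> * q = \<alpha> * q + d * q - d * (p * q)" by (simp add: \<beta>_def algebra_simps)
      ultimately have \<beta>q: "\<alpha> * q + d - 1 = \<beta> * q - 1" by linarith
      \<comment> \<open>With the sum over f frozen at its bound from the first pass, the recursion
        has a constant coefficient G. The smallness of s M N powr (d - \<beta>) is what makes G M of
        order s N powr \<beta>.\<close>
      define G where "G = cr * s * (H * s * real N powr d)"
      have "(\<Sum>n<R. f n powr q * real (Suc n) powr (\<beta> * q - 1)) \<le> K2 * (s * real N powr \<beta>) powr q" for R
      proof (rule summable[where a = a and M = M and G = G])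
        show "0 \<le> G" using cr s \<delta>1 by (simp add: G_def)
        show "(\<Sum>n<R. a n powr q * real (Suc n) powr (\<beta> * q - 1)) \<le> M powr q" for R
          using sb False \<beta>q unfolding seq_bound_def qr by simp
        have "G * M = cr * H / Cp * (s * (Cp * M) * real N powr (d - \<beta>)) * (s * real N powr \<beta>)"
          using N Cp(1) by (simp add: G_def powr_diff)
        also have "\<dots> \<le> cr * H / Cp * \<delta>1 * (s * real N powr \<beta>)"
          using P_bound cr \<delta>1 Cp(1) s by (intro mult_right_mono mult_left_mono) (auto simp: \<delta>3_def)
        finally show "G * M \<le> c2 * s * real N powr \<beta>" by (simp add: c2_def mult_ac)
        show "f n \<le> \<delta>2 * f (n div 2) + G * a (n div 6)" if n: "10 * N \<le> n" for n
        proof -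
          have "\<delta>3 * f (n div 2) \<le> \<delta>2 * f (n div 2)" using f by (intro mult_right_mono) (auto simp: \<delta>3_def)
          moreover have "cr * s * a (n div 6) * ?I n \<le> cr * s * a (n div 6) * (H * s * real N powr d)"
            using cr s a by (intro mult_left_mono pw[THEN conjunct2, rule_format] mult_nonneg_nonneg) auto
          ultimately show ?thesis
            using rec'[OF n] by (simp add: G_def mult_ac)
        qed
      qed (use f a M N in auto)
      moreover have "K2 * (s * real N powr \<beta>) powr q = (K2 powr (1 / q) * (s * real N powr \<beta>)) powr q"
        using \<delta>2 s q by (simp add: powr_mult powr_powr)
      ultimately show ?thesis using False \<beta>q by (simp add: seq_bound_def qr)
    qed
    moreover have mono: "seq_bound r \<alpha> d f K'" if "seq_bound r \<alpha> d f K" "0 \<le> K" "K \<le> K'" for K K'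
    proof (cases "r = \<infinity>")
      case True
      then show ?thesis using that unfolding seq_bound_def by (auto intro: order_trans)
    next
      case False
      then have "K powr real_of_ereal r \<le> K' powr real_of_ereal r"
        using that r by (intro powr_mono2) (cases r; auto)+
      then show ?thesis using that False unfolding seq_bound_def by (auto intro: order_trans)
    qed
    ultimately have "seq_bound r \<alpha> d f (C0 * s * (\<kappa> powr (\<beta> / min g 1) * (if g = 1 then ln (\<kappa> + 1) powr ((d + 1) * p) else 1)))"
      using N_le' \<delta>1 \<delta>2 s by (elim mono) auto
    then show "\<exists>f. antimono f \<and> (\<forall>n. 0 \<le> f n) \<and> (\<forall>u w. cmod (matrix_of_ell2_op S u w) \<le> f (\<rho> u w)) \<and>
      seq_bound r \<alpha> d f (C0 * onorm S * ((onorm S * M) powr ((\<alpha> + d * (1 - p)) / min (\<alpha> - d * p) 1) *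
        (if \<alpha> - d * p = 1 then ln (onorm S * M + 1) powr ((d + 1) * p) else 1)))"
      using f unfolding s_def \<kappa>_def \<beta>_def g_def by blast
  qed
qed

theorem theorem5p1:
  fixes E :: "'v \<Rightarrow> 'v \<Rightarrow> bool" and r r' :: ereal and d \<alpha> :: real
  assumes "1 \<le> r" and "r' = conj_exp r"
    and "simple_graph E" and "connected_graph E"
    and "polynomial_growth E" and "d = beurling_dim E"
    and "normal_counting_measure E"
    and "\<alpha> > over_exp d r'"
  shows "\<exists>C>0. \<forall>A\<in>beurling_class E r \<alpha>. \<forall>Ainv. ell2_inverse_of A Ainv \<longrightarrow>
    (let \<kappa> = onorm Ainv * enn2real (beurling_norm E r \<alpha> A);
         L = (if \<alpha> = 1 + over_exp d r' then ln (\<kappa> + 1) powr over_exp (d + 1) r' else 1)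
     in beurling_norm E r \<alpha> (matrix_of_ell2_op Ainv)
          \<le> ennreal (C * onorm Ainv *
              \<kappa> powr ((\<alpha> + over_exp d r) / min (\<alpha> - over_exp d r') 1) * L))"
proof -
  obtain D1 D2 where "regular_metric (geodesic_dist E) (beurling_dim E) D1 D2"
    using regular_metric_of_normal_graph assms(3,4,5,7) by blast
  then interpret regular_metric "geodesic_dist E" d D1 D2 by (simp add: assms(6))
  obtain p where p: "0 \<le> p" "p \<le> 1" "r \<noteq> \<infinity> \<Longrightarrow> p = 1 - 1 / real_of_ereal r" "r = \<infinity> \<Longrightarrow> p = 1"
    and over: "\<And>x. over_exp x r' = x * p" "\<And>x. over_exp x r = x * (1 - p)"
    using over_exp_conj[OF assms(1)] unfolding assms(2) by metis
  have \<alpha>: "d * p < \<alpha>" using assms(8) over by simp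
  obtain C where C: "0 < C" and decay: "\<And>A T S a M. ell2_op_of_matrix A T \<Longrightarrow> bounded_ell2_op S \<Longrightarrow> S \<circ> T = id \<Longrightarrow> T \<circ> S = id \<Longrightarrow>
    antimono a \<Longrightarrow> (\<And>n. 0 \<le> a n) \<Longrightarrow> (\<And>u v. cmod (A u v) \<le> a (geodesic_dist E u v)) \<Longrightarrow> 0 \<le> M \<Longrightarrow> seq_bound r \<alpha> d a M \<Longrightarrow>
    \<exists>f. antimono f \<and> (\<forall>n. 0 \<le> f n) \<and> (\<forall>u w. cmod (matrix_of_ell2_op S u w) \<le> f (geodesic_dist E u w)) \<and>
      seq_bound r \<alpha> d f (C * onorm S * ((onorm S * M) powr ((\<alpha> + d * (1 - p)) / min (\<alpha> - d * p) 1) *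
        (if \<alpha> - d * p = 1 then ln (onorm S * M + 1) powr ((d + 1) * p) else 1)))"
    using inverse_decay[OF assms(1) p \<alpha>] by blast
  show ?thesis
  proof (intro exI[of _ C] conjI C ballI allI impI)
    fix A Ainv assume A: "A \<in> beurling_class E r \<alpha>" and inv: "ell2_inverse_of A Ainv"
    define M where "M = enn2real (beurling_norm E r \<alpha> A)"
    obtain a where a: "antimono a" "\<And>n. 0 \<le> a n" "\<And>u v. cmod (A u v) \<le> a (geodesic_dist E u v)"
      "seq_bound r \<alpha> d a M"
      using beurling_class_majorant[OF assms(1) A] unfolding M_def assms(6) by blast
    obtain T where T: "ell2_op_of_matrix A T" "bounded_ell2_op Ainv" "Ainv \<circ> T = id" "T \<circ> Ainv = id"
      using inv unfolding ell2_inverse_of_def by blast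
    let ?K = "C * onorm Ainv * ((onorm Ainv * M) powr ((\<alpha> + d * (1 - p)) / min (\<alpha> - d * p) 1) *
        (if \<alpha> - d * p = 1 then ln (onorm Ainv * M + 1) powr ((d + 1) * p) else 1))"
    obtain f where f: "antimono f" "\<And>n. 0 \<le> f n" "\<And>u w. cmod (matrix_of_ell2_op Ainv u w) \<le> f (geodesic_dist E u w)"
      "seq_bound r \<alpha> d f ?K"
      using decay[OF T a(1,2,3) _ a(4)] unfolding M_def by auto
    have "0 \<le> onorm Ainv" using T(2) by (simp add: bounded_ell2_op_def onorm_pos_le)
    then have bound: "beurling_norm E r \<alpha> (matrix_of_ell2_op Ainv) \<le> ennreal ?K"
      using C f(4) unfolding assms(6) by (intro beurling_norm_le[OF assms(1) f(1,2) _ f(3)]) auto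
    have critical: "\<alpha> = 1 + d * p \<longleftrightarrow> \<alpha> - d * p = 1" by auto
    show "let \<kappa> = onorm Ainv * enn2real (beurling_norm E r \<alpha> A);
         L = (if \<alpha> = 1 + over_exp d r' then ln (\<kappa> + 1) powr over_exp (d + 1) r' else 1)
     in beurling_norm E r \<alpha> (matrix_of_ell2_op Ainv)
          \<le> ennreal (C * onorm Ainv *
              \<kappa> powr ((\<alpha> + over_exp d r) / min (\<alpha> - over_exp d r') 1) * L)"
      unfolding Let_def over M_def[symmetric] critical using bound by (simp only: mult.assoc)
  qed
qed

end
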